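(* In the setting below, every $g\in G^1\setminus B^1$ can be written as $g=u\,l\,n_{e_4}\,u'$ with $u\in U_J(K,L)\cap\operatorname{Fix}(\sigma)$, $l\in L_J(K,L)\cap\operatorname{Fix}(\sigma)$ and $u'\in U^-_{w_{e_4},J}\cap\operatorname{Fix}(\sigma)$.
   Context: Setting: Let $k\subseteq\ell$ be fields of characteristic $2$ with $\ell^2\subseteq k$. Let $\delta\in k$ be such that $x^2+x+\delta$ is irreducible over $\ell$, $\gamma$ a root, $K=k(\gamma)$, $L=\ell(\gamma)$ (so $L^2\subseteq K\subseteq L$), and $t\mapsto\overline{t}$ the nontrivial automorphism of $L/\ell$. Let $\Phi\subset\mathbb{R}^4$ be the root system of type $\mathsf{F}_4$ w.r.t. an orthonormal basis $e_1,\dots,e_4$: long roots $\pm e_i\pm e_j$ ($i<j$), short roots $\pm e_i$ and $\frac12(\pm e_1\pm e_2\pm e_3\pm e_4)$; fundamental roots $\alpha_1=\frac12(-e_1-e_2-e_3+e_4)$, $\alpha_2=e_3$, $\alpha_3=e_2-e_3$, $\alpha_4=e_1-e_2$; positive/negative roots $\Phi^\pm$. Let $\mathsf{F}_4(L)$ be the adjoint Chevalley group over $L$ with root elements $u_r(t)$, $n_r(t)=u_r(t)u_{-r}(t^{-1})u_r(t)$, $h_r(t)=n_r(t)n_r(1)$, torus $T(L)=\langle h_r(t)\rangle$. For $r\in\Phi$ let $U_r=\{u_r(t)\mid t\in K\}$ if $r$ is long and $U_r=\{u_r(t)\mid t\in L\}$ if $r$ is short; $\mathsf{F}_4(K,L)=\langle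 U_r\mid r\in\Phi\rangle$ (the mixed group), $T(K,L)=\{h\in T(L)\mid r(h)\in K$ for all long $r\}$ where $hu_r(t)h^{-1}=u_r(r(h)t)$, $N(K,L)=\langle n_r(t)\mid t\in K^\times\rangle T(K,L)$, and $W=N(K,L)/T(K,L)$, identified with the Weyl group of $\Phi$. Let $J=\{\alpha_2,\alpha_3,\alpha_4\}$, $\Phi_J=\Phi\cap\operatorname{span}J$ (the roots with zero $e_4$-coordinate), $W_J=\langle w_{\alpha_2},w_{\alpha_3},w_{\alpha_4}\rangle$. In $\mathsf{F}_4(L)$ let $U_J=\langle u_r(t)\mid r\in\Phi^+\setminus\Phi_J\rangle$, $U_J^-=\langle u_r(t)\mid r\in\Phi^-\setminus\Phi_J\rangle$, $L_J=\langle T(L),u_r(t)\mid r\in\Phi_J\rangle$, $P_J=U_JL_J$, and put $U_J(K,L)=U_J\cap\mathsf{F}_4(K,L)$, $U_J^-(K,L)=U_J^-\cap\mathsf{F}_4(K,L)$, $L_J(K,L)=L_J\cap\mathsf{F}_4(K,L)$, $P_J(K,L)=P_J\cap\mathsf{F}_4(K,L)$. Let $\alpha,\beta\in k^\times$ be such that $q(y_1,y_2,y_3,y_4)=y_1^2+\alpha y_2\overline{y_2}+\beta y_3\overline{y_3}+\alpha\beta y_4\overline{y_4}$ is anisotropic on $\ell\oplus K^3$. Also write $\sigma$ for the orthogonal map of $\mathbb{R}^4$ fixing $e_4$ and negating $e_1,e_2,e_3$; it preserves $\Phi$ and equals the longest element $w_0^J$ of $W_J$. Assume $\sigma\colon\mathsf{F}_4(K,L)\to\mathsf{F}_4(K,L)$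 is an automorphism with $\sigma^2=1$ and $\sigma(u_r(t))=u_{\sigma(r)}(c_r\overline{t})$ for all $r\in\Phi$ and admissible $t$, for constants $c_r\in K^\times$ with $c_{\alpha_1}=\alpha^{-1}\beta^{-1}$, $c_{\alpha_2}=\alpha\beta$, $c_{\alpha_3}=\alpha^{-1}$, $c_{\alpha_4}=\alpha\beta^{-1}$. Let $\operatorname{Fix}(\sigma)$ be the fixed points of $\sigma$, $U^1=U_J(K,L)\cap\operatorname{Fix}(\sigma)$, $V^1=U_J^-(K,L)\cap\operatorname{Fix}(\sigma)$, $G^1=\langle U^1,V^1\rangle$, $B^1=P_J(K,L)\cap G^1$; $n_{e_4}=u_{e_4}(1)u_{-e_4}(1)u_{e_4}(1)$, $w_{e_4}$ the reflection in $e_4$, and $U^-_{w_{e_4},J}=\langle U_r\mid r\in\Phi^+\setminus\Phi_J,\ w_{e_4}(r)\in\Phi^-\rangle$. *)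

theory Defs
  imports "Jordan_Normal_Form.Matrix" "HOL-Computational_Algebra.Polynomial"
begin

definition is_subfield :: "'a::field set \<Rightarrow> bool" where
  "is_subfield F \<longleftrightarrow> 0 \<in> F \<and> 1 \<in> F \<and>
     (\<forall>x\<in>F. \<forall>y\<in>F. x + y \<in> F \<and> x * y \<in> F) \<and>
     (\<forall>x\<in>F. - x \<in> F) \<and> (\<forall>x\<in>F. x \<noteq> 0 \<longrightarrow> inverse x \<in> F)"

definition adjoin :: "'a::field set \<Rightarrow> 'a \<Rightarrow> 'a set" where
  "adjoin F x = \<Inter> {E. is_subfield E \<and> F \<subseteq> E \<and> x \<in> E}"

definition poly_over :: "'a::field set \<Rightarrow> 'a poly \<Rightarrow> bool" where
  "poly_over F p \<longleftrightarrow> (\<forall>i. coeff p i \<in> F)"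

definition irreducible_over :: "'a::field set \<Rightarrow> 'a poly \<Rightarrow> bool" where
  "irreducible_over F p \<longleftrightarrow> poly_over F p \<and> 0 < degree p \<and>
     \<not> (\<exists>f g. poly_over F f \<and> poly_over F g \<and> 0 < degree f \<and> 0 < degree g \<and> p = f * g)"

text \<open>A vector of R^4 all of whose coordinates lie in (1/2)Z is represented by the
  integer 4-tuple of its DOUBLED coordinates.  Thus e_i is represented by 2 in slot i.\<close>
type_synonym root4 = "int \<times> int \<times> int \<times> int"

definition F4_roots :: "root4 list" where
  "F4_roots =
  [ (2, 2, 0, 0) ,
   (2, -2, 0, 0) ,
   (-2, 2, 0, 0) ,
   (-2, -2, 0, 0) ,
   (2, 0, 2, 0) ,
   (2, 0, -2, 0) ,
   (-2, 0, 2, 0) ,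
   (-2, 0, -2, 0) ,
   (2, 0, 0, 2) ,
   (2, 0, 0, -2) ,
   (-2, 0, 0, 2) ,
   (-2, 0, 0, -2) ,
   (0, 2, 2, 0) ,
   (0, 2, -2, 0) ,
   (0, -2, 2, 0) ,
   (0, -2, -2, 0) ,
   (0, 2, 0, 2) ,
   (0, 2, 0, -2) ,
   (0, -2, 0, 2) ,
   (0, -2, 0, -2) ,
   (0, 0, 2, 2) ,
   (0, 0, 2, -2) ,
   (0, 0, -2, 2) ,
   (0, 0, -2, -2) ,
   (2, 0, 0, 0) ,
   (-2, 0, 0, 0) ,
   (0, 2, 0, 0) ,
   (0, -2, 0, 0) ,
   (0, 0, 2, 0) ,
   (0, 0, -2, 0) ,
   (0, 0, 0, 2) ,
   (0, 0, 0, -2) ,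
   (1, 1, 1, 1) ,
   (1, 1, 1, -1) ,
   (1, 1, -1, 1) ,
   (1, 1, -1, -1) ,
   (1, -1, 1, 1) ,
   (1, -1, 1, -1) ,
   (1, -1, -1, 1) ,
   (1, -1, -1, -1) ,
   (-1, 1, 1, 1) ,
   (-1, 1, 1, -1) ,
   (-1, 1, -1, 1) ,
   (-1, 1, -1, -1) ,
   (-1, -1, 1, 1) ,
   (-1, -1, 1, -1) ,
   (-1, -1, -1, 1) ,
   (-1, -1, -1, -1) ]"

definition F4_Phi :: "root4 set" where
  "F4_Phi = set F4_roots"

definition rneg :: "root4 \<Rightarrow> root4" where
  "rneg r = (case r of (a, b, c, d) \<Rightarrow> (-a, -b, -c, -d))"

definition radd :: "root4 \<Rightarrow> root4 \<Rightarrow> root4" where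
  "radd r s = (case r of (a, b, c, d) \<Rightarrow> case s of (a', b', c', d') \<Rightarrow> (a + a', b + b', c + c', d + d'))"

definition rscale :: "int \<Rightarrow> root4 \<Rightarrow> root4" where
  "rscale n r = (case r of (a, b, c, d) \<Rightarrow> (n * a, n * b, n * c, n * d))"

text \<open>long roots: squared length 2, i.e. doubled coordinates have squared length 8\<close>
definition F4_long :: "root4 \<Rightarrow> bool" where
  "F4_long r = (case r of (a, b, c, d) \<Rightarrow> a*a + b*b + c*c + d*d = 8)"

definition alpha1 :: root4 where "alpha1 = (-1, -1, -1, 1)"
definition alpha2 :: root4 where "alpha2 = (0, 0, 2, 0)"
definition alpha3 :: root4 where "alpha3 = (0, 2, -2, 0)"
definition alpha4 :: root4 where "alpha4 = (2, -2, 0, 0)"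
definition e4 :: root4 where "e4 = (0, 0, 0, 2)"

definition F4_pos :: "root4 \<Rightarrow> bool" where
  "F4_pos r \<longleftrightarrow> r \<in> F4_Phi \<and> (\<exists>c1 c2 c3 c4 :: int. 0 \<le> c1 \<and> 0 \<le> c2 \<and> 0 \<le> c3 \<and> 0 \<le> c4 \<and>
      r = radd (rscale c1 alpha1) (radd (rscale c2 alpha2) (radd (rscale c3 alpha3) (rscale c4 alpha4))))"

definition F4_neg :: "root4 \<Rightarrow> bool" where
  "F4_neg r \<longleftrightarrow> F4_pos (rneg r)"

text \<open>Phi_J: roots in the span of J = {alpha2, alpha3, alpha4}, i.e. zero e4-coordinate\<close>
definition in_PhiJ :: "root4 \<Rightarrow> bool" where
  "in_PhiJ r \<longleftrightarrow> r \<in> F4_Phi \<and> (case r of (a, b, c, d) \<Rightarrow> d = 0)"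

definition sigma_root :: "root4 \<Rightarrow> root4" where
  "sigma_root r = (case r of (a, b, c, d) \<Rightarrow> (-a, -b, -c, d))"

definition w_e4 :: "root4 \<Rightarrow> root4" where
  "w_e4 r = (case r of (a, b, c, d) \<Rightarrow> (a, b, c, -d))"

text \<open>We realise F4(L) in its defining (adjoint) representation on the Chevalley
  Z-form of the Lie algebra of type F4, tensored with L.  Basis: index i < 48 is
  the root vector e_r for r = F4_roots ! i, and index 48 + i (i < 4) is the coroot
  element h_{alpha_(i+1)}.  The root element u_r(t) = exp(t ad e_r) =
  sum_k t^k (ad e_r)^k / k! has integer matrix coefficients; reduced modulo 2 they are
  0 or 1 (signs of the structure constants become irrelevant).  An entry (ri, i, j, k)
  of the list below means that the (i, j) entry of u_r(t), r = F4_roots ! ri, receives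
  a summand t^k; besides these, u_r(t) has 1 on the diagonal.  This is valid over
  fields of characteristic 2, which is the only case used here.\<close>
definition chev_entries :: "(nat \<times> nat \<times> nat \<times> nat) list" where
  "chev_entries =
  [ (0, 0, 3, 2), (0, 49, 3, 1), (0, 51, 3, 1), (0, 12, 6, 1), (0, 13, 7, 1), (0, 16, 10, 1), (0, 17, 11, 1), (0, 4, 14, 1),
   (0, 5, 15, 1), (0, 8, 18, 1), (0, 9, 19, 1), (0, 26, 25, 1), (0, 24, 27, 1), (0, 32, 44, 1), (0, 33, 45, 1), (0, 34, 46, 1),
   (0, 35, 47, 1), (0, 0, 50, 1), (1, 1, 2, 2), (1, 51, 2, 1), (1, 14, 6, 1), (1, 15, 7, 1), (1, 18, 10, 1), (1, 19, 11, 1),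
   (1, 4, 12, 1), (1, 5, 13, 1), (1, 8, 16, 1), (1, 9, 17, 1), (1, 27, 25, 1), (1, 24, 26, 1), (1, 36, 40, 1), (1, 37, 41, 1),
   (1, 38, 42, 1), (1, 39, 43, 1), (1, 1, 50, 1), (2, 2, 1, 2), (2, 51, 1, 1), (2, 12, 4, 1), (2, 13, 5, 1), (2, 16, 8, 1),
   (2, 17, 9, 1), (2, 6, 14, 1), (2, 7, 15, 1), (2, 10, 18, 1), (2, 11, 19, 1), (2, 26, 24, 1), (2, 25, 27, 1), (2, 40, 36, 1),
   (2, 41, 37, 1), (2, 42, 38, 1), (2, 43, 39, 1), (2, 2, 50, 1), (3, 3, 0, 2), (3, 49, 0, 1), (3, 51, 0, 1), (3, 14, 4, 1),
   (3, 15, 5, 1), (3, 18, 8, 1), (3, 19, 9, 1), (3, 6, 12, 1), (3, 7, 13, 1), (3, 10, 16, 1), (3, 11, 17, 1), (3, 27, 24, 1),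
   (3, 25, 26, 1), (3, 44, 32, 1), (3, 45, 33, 1), (3, 46, 34, 1), (3, 47, 35, 1), (3, 3, 50, 1), (4, 12, 2, 1), (4, 14, 3, 1),
   (4, 4, 7, 2), (4, 49, 7, 1), (4, 50, 7, 1), (4, 51, 7, 1), (4, 20, 10, 1), (4, 21, 11, 1), (4, 0, 13, 1), (4, 1, 15, 1),
   (4, 8, 22, 1), (4, 9, 23, 1), (4, 28, 25, 1), (4, 24, 29, 1), (4, 32, 42, 1), (4, 33, 43, 1), (4, 36, 46, 1), (4, 37, 47, 1),
   (4, 4, 50, 1), (4, 4, 51, 1), (5, 13, 2, 1), (5, 15, 3, 1), (5, 5, 6, 2), (5, 50, 6, 1), (5, 51, 6, 1), (5, 22, 10, 1),
   (5, 23, 11, 1), (5, 0, 12, 1), (5, 1, 14, 1), (5, 8, 20, 1), (5, 9, 21, 1), (5, 29, 25, 1), (5, 24, 28, 1), (5, 34, 40, 1),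
   (5, 35, 41, 1), (5, 38, 44, 1), (5, 39, 45, 1), (5, 5, 50, 1), (5, 5, 51, 1), (6, 12, 0, 1), (6, 14, 1, 1), (6, 6, 5, 2),
   (6, 50, 5, 1), (6, 51, 5, 1), (6, 20, 8, 1), (6, 21, 9, 1), (6, 2, 13, 1), (6, 3, 15, 1), (6, 10, 22, 1), (6, 11, 23, 1),
   (6, 28, 24, 1), (6, 25, 29, 1), (6, 40, 34, 1), (6, 41, 35, 1), (6, 44, 38, 1), (6, 45, 39, 1), (6, 6, 50, 1), (6, 6, 51, 1),
   (7, 13, 0, 1), (7, 15, 1, 1), (7, 7, 4, 2), (7, 49, 4, 1), (7, 50, 4, 1), (7, 51, 4, 1), (7, 22, 8, 1), (7, 23, 9, 1),
   (7, 2, 12, 1), (7, 3, 14, 1), (7, 10, 20, 1), (7, 11, 21, 1), (7, 29, 24, 1), (7, 25, 28, 1), (7, 42, 32, 1), (7, 43, 33, 1),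
   (7, 46, 36, 1), (7, 47, 37, 1), (7, 7, 50, 1), (7, 7, 51, 1), (8, 16, 2, 1), (8, 18, 3, 1), (8, 20, 6, 1), (8, 22, 7, 1),
   (8, 8, 11, 2), (8, 48, 11, 1), (8, 50, 11, 1), (8, 0, 17, 1), (8, 1, 19, 1), (8, 4, 21, 1), (8, 5, 23, 1), (8, 30, 25, 1),
   (8, 24, 31, 1), (8, 32, 41, 1), (8, 34, 43, 1), (8, 36, 45, 1), (8, 38, 47, 1), (8, 8, 51, 1), (9, 17, 2, 1), (9, 19, 3, 1),
   (9, 21, 6, 1), (9, 23, 7, 1), (9, 9, 10, 2), (9, 48, 10, 1), (9, 49, 10, 1), (9, 50, 10, 1), (9, 0, 16, 1), (9, 1, 18, 1),
   (9, 4, 20, 1), (9, 5, 22, 1), (9, 31, 25, 1), (9, 24, 30, 1), (9, 33, 40, 1), (9, 35, 42, 1), (9, 37, 44, 1), (9, 39, 46, 1),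
   (9, 9, 51, 1), (10, 16, 0, 1), (10, 18, 1, 1), (10, 20, 4, 1), (10, 22, 5, 1), (10, 10, 9, 2), (10, 48, 9, 1), (10, 49, 9, 1),
   (10, 50, 9, 1), (10, 2, 17, 1), (10, 3, 19, 1), (10, 6, 21, 1), (10, 7, 23, 1), (10, 30, 24, 1), (10, 25, 31, 1), (10, 40, 33, 1),
   (10, 42, 35, 1), (10, 44, 37, 1), (10, 46, 39, 1), (10, 10, 51, 1), (11, 17, 0, 1), (11, 19, 1, 1), (11, 21, 4, 1), (11, 23, 5, 1),
   (11, 11, 8, 2), (11, 48, 8, 1), (11, 50, 8, 1), (11, 2, 16, 1), (11, 3, 18, 1), (11, 6, 20, 1), (11, 7, 22, 1), (11, 31, 24, 1),
   (11, 25, 30, 1), (11, 41, 32, 1), (11, 43, 34, 1), (11, 45, 36, 1), (11, 47, 38, 1), (11, 11, 51, 1), (12, 4, 1, 1), (12, 6, 3, 1),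
   (12, 0, 5, 1), (12, 2, 7, 1), (12, 12, 15, 2), (12, 49, 15, 1), (12, 50, 15, 1), (12, 20, 18, 1), (12, 21, 19, 1), (12, 16, 22, 1),
   (12, 17, 23, 1), (12, 28, 27, 1), (12, 26, 29, 1), (12, 32, 38, 1), (12, 33, 39, 1), (12, 40, 46, 1), (12, 41, 47, 1), (12, 12, 51, 1),
   (13, 5, 1, 1), (13, 7, 3, 1), (13, 0, 4, 1), (13, 2, 6, 1), (13, 13, 14, 2), (13, 50, 14, 1), (13, 22, 18, 1), (13, 23, 19, 1),
   (13, 16, 20, 1), (13, 17, 21, 1), (13, 29, 27, 1), (13, 26, 28, 1), (13, 34, 36, 1), (13, 35, 37, 1), (13, 42, 44, 1), (13, 43, 45, 1),
   (13, 13, 51, 1), (14, 4, 0, 1), (14, 6, 2, 1), (14, 1, 5, 1), (14, 3, 7, 1), (14, 14, 13, 2), (14, 50, 13, 1), (14, 20, 16, 1),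
   (14, 21, 17, 1), (14, 18, 22, 1), (14, 19, 23, 1), (14, 28, 26, 1), (14, 27, 29, 1), (14, 36, 34, 1), (14, 37, 35, 1), (14, 44, 42, 1),
   (14, 45, 43, 1), (14, 14, 51, 1), (15, 5, 0, 1), (15, 7, 2, 1), (15, 1, 4, 1), (15, 3, 6, 1), (15, 15, 12, 2), (15, 49, 12, 1),
   (15, 50, 12, 1), (15, 22, 16, 1), (15, 23, 17, 1), (15, 18, 20, 1), (15, 19, 21, 1), (15, 29, 26, 1), (15, 27, 28, 1), (15, 38, 32, 1),
   (15, 39, 33, 1), (15, 46, 40, 1), (15, 47, 41, 1), (15, 15, 51, 1), (16, 8, 1, 1), (16, 10, 3, 1), (16, 0, 9, 1), (16, 2, 11, 1),
   (16, 20, 14, 1), (16, 22, 15, 1), (16, 16, 19, 2), (16, 48, 19, 1), (16, 50, 19, 1), (16, 51, 19, 1), (16, 12, 21, 1), (16, 13, 23, 1),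
   (16, 30, 27, 1), (16, 26, 31, 1), (16, 32, 37, 1), (16, 34, 39, 1), (16, 40, 45, 1), (16, 42, 47, 1), (16, 16, 50, 1), (16, 16, 51, 1),
   (17, 9, 1, 1), (17, 11, 3, 1), (17, 0, 8, 1), (17, 2, 10, 1), (17, 21, 14, 1), (17, 23, 15, 1), (17, 17, 18, 2), (17, 48, 18, 1),
   (17, 49, 18, 1), (17, 50, 18, 1), (17, 51, 18, 1), (17, 12, 20, 1), (17, 13, 22, 1), (17, 31, 27, 1), (17, 26, 30, 1), (17, 33, 36, 1),
   (17, 35, 38, 1), (17, 41, 44, 1), (17, 43, 46, 1), (17, 17, 50, 1), (17, 17, 51, 1), (18, 8, 0, 1), (18, 10, 2, 1), (18, 1, 9, 1),
   (18, 3, 11, 1), (18, 20, 12, 1), (18, 22, 13, 1), (18, 18, 17, 2), (18, 48, 17, 1), (18, 49, 17, 1), (18, 50, 17, 1), (18, 51, 17, 1),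
   (18, 14, 21, 1), (18, 15, 23, 1), (18, 30, 26, 1), (18, 27, 31, 1), (18, 36, 33, 1), (18, 38, 35, 1), (18, 44, 41, 1), (18, 46, 43, 1),
   (18, 18, 50, 1), (18, 18, 51, 1), (19, 9, 0, 1), (19, 11, 2, 1), (19, 1, 8, 1), (19, 3, 10, 1), (19, 21, 12, 1), (19, 23, 13, 1),
   (19, 19, 16, 2), (19, 48, 16, 1), (19, 50, 16, 1), (19, 51, 16, 1), (19, 14, 20, 1), (19, 15, 22, 1), (19, 31, 26, 1), (19, 27, 30, 1),
   (19, 37, 32, 1), (19, 39, 34, 1), (19, 45, 40, 1), (19, 47, 42, 1), (19, 19, 50, 1), (19, 19, 51, 1), (20, 8, 5, 1), (20, 10, 7, 1),
   (20, 4, 9, 1), (20, 6, 11, 1), (20, 16, 13, 1), (20, 18, 15, 1), (20, 12, 17, 1), (20, 14, 19, 1), (20, 20, 23, 2), (20, 48, 23, 1),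
   (20, 51, 23, 1), (20, 30, 29, 1), (20, 28, 31, 1), (20, 32, 35, 1), (20, 36, 39, 1), (20, 40, 43, 1), (20, 44, 47, 1), (20, 20, 50, 1),
   (21, 9, 5, 1), (21, 11, 7, 1), (21, 4, 8, 1), (21, 6, 10, 1), (21, 17, 13, 1), (21, 19, 15, 1), (21, 12, 16, 1), (21, 14, 18, 1),
   (21, 21, 22, 2), (21, 48, 22, 1), (21, 49, 22, 1), (21, 51, 22, 1), (21, 31, 29, 1), (21, 28, 30, 1), (21, 33, 34, 1), (21, 37, 38, 1),
   (21, 41, 42, 1), (21, 45, 46, 1), (21, 21, 50, 1), (22, 8, 4, 1), (22, 10, 6, 1), (22, 5, 9, 1), (22, 7, 11, 1), (22, 16, 12, 1),
   (22, 18, 14, 1), (22, 13, 17, 1), (22, 15, 19, 1), (22, 22, 21, 2), (22, 48, 21, 1), (22, 49, 21, 1), (22, 51, 21, 1), (22, 30, 28, 1),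
   (22, 29, 31, 1), (22, 34, 33, 1), (22, 38, 37, 1), (22, 42, 41, 1), (22, 46, 45, 1), (22, 22, 50, 1), (23, 9, 4, 1), (23, 11, 6, 1),
   (23, 5, 8, 1), (23, 7, 10, 1), (23, 17, 12, 1), (23, 19, 14, 1), (23, 13, 16, 1), (23, 15, 18, 1), (23, 23, 20, 2), (23, 48, 20, 1),
   (23, 51, 20, 1), (23, 31, 28, 1), (23, 29, 30, 1), (23, 35, 32, 1), (23, 39, 36, 1), (23, 43, 40, 1), (23, 47, 44, 1), (23, 23, 50, 1),
   (24, 26, 2, 1), (24, 0, 2, 2), (24, 27, 3, 1), (24, 1, 3, 2), (24, 28, 6, 1), (24, 4, 6, 2), (24, 29, 7, 1), (24, 5, 7, 2),
   (24, 30, 10, 1), (24, 8, 10, 2), (24, 31, 11, 1), (24, 9, 11, 2), (24, 24, 25, 2), (24, 49, 25, 1), (24, 32, 40, 1), (24, 33, 41, 1),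
   (24, 34, 42, 1), (24, 35, 43, 1), (24, 36, 44, 1), (24, 37, 45, 1), (24, 38, 46, 1), (24, 39, 47, 1), (24, 24, 48, 1), (24, 24, 51, 1),
   (25, 26, 0, 1), (25, 2, 0, 2), (25, 27, 1, 1), (25, 3, 1, 2), (25, 28, 4, 1), (25, 6, 4, 2), (25, 29, 5, 1), (25, 7, 5, 2),
   (25, 30, 8, 1), (25, 10, 8, 2), (25, 31, 9, 1), (25, 11, 9, 2), (25, 25, 24, 2), (25, 49, 24, 1), (25, 40, 32, 1), (25, 41, 33, 1),
   (25, 42, 34, 1), (25, 43, 35, 1), (25, 44, 36, 1), (25, 45, 37, 1), (25, 46, 38, 1), (25, 47, 39, 1), (25, 25, 48, 1), (25, 25, 51, 1),
   (26, 24, 1, 1), (26, 0, 1, 2), (26, 25, 3, 1), (26, 2, 3, 2), (26, 28, 14, 1), (26, 12, 14, 2), (26, 29, 15, 1), (26, 13, 15, 2),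
   (26, 30, 18, 1), (26, 16, 18, 2), (26, 31, 19, 1), (26, 17, 19, 2), (26, 26, 27, 2), (26, 49, 27, 1), (26, 32, 36, 1), (26, 33, 37, 1),
   (26, 34, 38, 1), (26, 35, 39, 1), (26, 40, 44, 1), (26, 41, 45, 1), (26, 42, 46, 1), (26, 43, 47, 1), (26, 26, 48, 1), (26, 26, 50, 1),
   (26, 26, 51, 1), (27, 24, 0, 1), (27, 1, 0, 2), (27, 25, 2, 1), (27, 3, 2, 2), (27, 28, 12, 1), (27, 14, 12, 2), (27, 29, 13, 1),
   (27, 15, 13, 2), (27, 30, 16, 1), (27, 18, 16, 2), (27, 31, 17, 1), (27, 19, 17, 2), (27, 27, 26, 2), (27, 49, 26, 1), (27, 36, 32, 1),
   (27, 37, 33, 1), (27, 38, 34, 1), (27, 39, 35, 1), (27, 44, 40, 1), (27, 45, 41, 1), (27, 46, 42, 1), (27, 47, 43, 1), (27, 27, 48, 1),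
   (27, 27, 50, 1), (27, 27, 51, 1), (28, 24, 5, 1), (28, 4, 5, 2), (28, 25, 7, 1), (28, 6, 7, 2), (28, 26, 13, 1), (28, 12, 13, 2),
   (28, 27, 15, 1), (28, 14, 15, 2), (28, 30, 22, 1), (28, 20, 22, 2), (28, 31, 23, 1), (28, 21, 23, 2), (28, 28, 29, 2), (28, 49, 29, 1),
   (28, 32, 34, 1), (28, 33, 35, 1), (28, 36, 38, 1), (28, 37, 39, 1), (28, 40, 42, 1), (28, 41, 43, 1), (28, 44, 46, 1), (28, 45, 47, 1),
   (28, 28, 48, 1), (28, 28, 50, 1), (29, 24, 4, 1), (29, 5, 4, 2), (29, 25, 6, 1), (29, 7, 6, 2), (29, 26, 12, 1), (29, 13, 12, 2),
   (29, 27, 14, 1), (29, 15, 14, 2), (29, 30, 20, 1), (29, 22, 20, 2), (29, 31, 21, 1), (29, 23, 21, 2), (29, 29, 28, 2), (29, 49, 28, 1),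
   (29, 34, 32, 1), (29, 35, 33, 1), (29, 38, 36, 1), (29, 39, 37, 1), (29, 42, 40, 1), (29, 43, 41, 1), (29, 46, 44, 1), (29, 47, 45, 1),
   (29, 29, 48, 1), (29, 29, 50, 1), (30, 24, 9, 1), (30, 8, 9, 2), (30, 25, 11, 1), (30, 10, 11, 2), (30, 26, 17, 1), (30, 16, 17, 2),
   (30, 27, 19, 1), (30, 18, 19, 2), (30, 28, 21, 1), (30, 20, 21, 2), (30, 29, 23, 1), (30, 22, 23, 2), (30, 30, 31, 2), (30, 49, 31, 1),
   (30, 32, 33, 1), (30, 34, 35, 1), (30, 36, 37, 1), (30, 38, 39, 1), (30, 40, 41, 1), (30, 42, 43, 1), (30, 44, 45, 1), (30, 46, 47, 1),
   (30, 30, 48, 1), (31, 24, 8, 1), (31, 9, 8, 2), (31, 25, 10, 1), (31, 11, 10, 2), (31, 26, 16, 1), (31, 17, 16, 2), (31, 27, 18, 1),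
   (31, 19, 18, 2), (31, 28, 20, 1), (31, 21, 20, 2), (31, 29, 22, 1), (31, 23, 22, 2), (31, 31, 30, 2), (31, 49, 30, 1), (31, 33, 32, 1),
   (31, 35, 34, 1), (31, 37, 36, 1), (31, 39, 38, 1), (31, 41, 40, 1), (31, 43, 42, 1), (31, 45, 44, 1), (31, 47, 46, 1), (31, 31, 48, 1),
   (32, 44, 3, 1), (32, 20, 3, 2), (32, 42, 7, 1), (32, 16, 7, 2), (32, 41, 11, 1), (32, 12, 11, 2), (32, 38, 15, 1), (32, 8, 15, 2),
   (32, 37, 19, 1), (32, 4, 19, 2), (32, 35, 23, 1), (32, 0, 23, 2), (32, 40, 25, 1), (32, 36, 27, 1), (32, 34, 29, 1), (32, 33, 31, 1),
   (32, 24, 39, 1), (32, 26, 43, 1), (32, 28, 45, 1), (32, 30, 46, 1), (32, 32, 47, 2), (32, 48, 47, 1), (32, 49, 47, 1), (32, 32, 48, 1),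
   (32, 32, 49, 1), (33, 45, 3, 1), (33, 21, 3, 2), (33, 43, 7, 1), (33, 17, 7, 2), (33, 40, 10, 1), (33, 12, 10, 2), (33, 39, 15, 1),
   (33, 9, 15, 2), (33, 36, 18, 1), (33, 4, 18, 2), (33, 34, 22, 1), (33, 0, 22, 2), (33, 41, 25, 1), (33, 37, 27, 1), (33, 35, 29, 1),
   (33, 32, 30, 1), (33, 24, 38, 1), (33, 26, 42, 1), (33, 28, 44, 1), (33, 33, 46, 2), (33, 48, 46, 1), (33, 31, 47, 1), (33, 33, 49, 1),
   (34, 46, 3, 1), (34, 22, 3, 2), (34, 40, 6, 1), (34, 16, 6, 2), (34, 43, 11, 1), (34, 13, 11, 2), (34, 36, 14, 1), (34, 8, 14, 2),
   (34, 39, 19, 1), (34, 5, 19, 2), (34, 33, 21, 1), (34, 0, 21, 2), (34, 42, 25, 1), (34, 38, 27, 1), (34, 32, 28, 1), (34, 35, 31, 1),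
   (34, 24, 37, 1), (34, 26, 41, 1), (34, 30, 44, 1), (34, 34, 45, 2), (34, 48, 45, 1), (34, 29, 47, 1), (34, 34, 49, 1), (34, 34, 50, 1),
   (35, 47, 3, 1), (35, 23, 3, 2), (35, 41, 6, 1), (35, 17, 6, 2), (35, 42, 10, 1), (35, 13, 10, 2), (35, 37, 14, 1), (35, 9, 14, 2),
   (35, 38, 18, 1), (35, 5, 18, 2), (35, 32, 20, 1), (35, 0, 20, 2), (35, 43, 25, 1), (35, 39, 27, 1), (35, 33, 28, 1), (35, 34, 30, 1),
   (35, 24, 36, 1), (35, 26, 40, 1), (35, 35, 44, 2), (35, 48, 44, 1), (35, 49, 44, 1), (35, 31, 45, 1), (35, 29, 46, 1), (35, 35, 48, 1),
   (35, 35, 49, 1), (35, 35, 50, 1), (36, 40, 2, 1), (36, 20, 2, 2), (36, 46, 7, 1), (36, 18, 7, 2), (36, 45, 11, 1), (36, 14, 11, 2),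
   (36, 34, 13, 1), (36, 8, 13, 2), (36, 33, 17, 1), (36, 4, 17, 2), (36, 39, 23, 1), (36, 1, 23, 2), (36, 44, 25, 1), (36, 32, 26, 1),
   (36, 38, 29, 1), (36, 37, 31, 1), (36, 24, 35, 1), (36, 28, 41, 1), (36, 30, 42, 1), (36, 36, 43, 2), (36, 48, 43, 1), (36, 27, 47, 1),
   (36, 36, 49, 1), (36, 36, 50, 1), (36, 36, 51, 1), (37, 41, 2, 1), (37, 21, 2, 2), (37, 47, 7, 1), (37, 19, 7, 2), (37, 44, 10, 1),
   (37, 14, 10, 2), (37, 35, 13, 1), (37, 9, 13, 2), (37, 32, 16, 1), (37, 4, 16, 2), (37, 38, 22, 1), (37, 1, 22, 2), (37, 45, 25, 1),
   (37, 33, 26, 1), (37, 39, 29, 1), (37, 36, 30, 1), (37, 24, 34, 1), (37, 28, 40, 1), (37, 37, 42, 2), (37, 48, 42, 1), (37, 49, 42, 1),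
   (37, 31, 43, 1), (37, 27, 46, 1), (37, 37, 48, 1), (37, 37, 49, 1), (37, 37, 50, 1), (37, 37, 51, 1), (38, 42, 2, 1), (38, 22, 2, 2),
   (38, 44, 6, 1), (38, 18, 6, 2), (38, 47, 11, 1), (38, 15, 11, 2), (38, 32, 12, 1), (38, 8, 12, 2), (38, 35, 17, 1), (38, 5, 17, 2),
   (38, 37, 21, 1), (38, 1, 21, 2), (38, 46, 25, 1), (38, 34, 26, 1), (38, 36, 28, 1), (38, 39, 31, 1), (38, 24, 33, 1), (38, 30, 40, 1),
   (38, 38, 41, 2), (38, 48, 41, 1), (38, 49, 41, 1), (38, 29, 43, 1), (38, 27, 45, 1), (38, 38, 48, 1), (38, 38, 49, 1), (38, 38, 51, 1),
   (39, 43, 2, 1), (39, 23, 2, 2), (39, 45, 6, 1), (39, 19, 6, 2), (39, 46, 10, 1), (39, 15, 10, 2), (39, 33, 12, 1), (39, 9, 12, 2),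
   (39, 34, 16, 1), (39, 5, 16, 2), (39, 36, 20, 1), (39, 1, 20, 2), (39, 47, 25, 1), (39, 35, 26, 1), (39, 37, 28, 1), (39, 38, 30, 1),
   (39, 24, 32, 1), (39, 39, 40, 2), (39, 48, 40, 1), (39, 31, 41, 1), (39, 29, 42, 1), (39, 27, 44, 1), (39, 39, 49, 1), (39, 39, 51, 1),
   (40, 36, 1, 1), (40, 20, 1, 2), (40, 34, 5, 1), (40, 16, 5, 2), (40, 33, 9, 1), (40, 12, 9, 2), (40, 46, 15, 1), (40, 10, 15, 2),
   (40, 45, 19, 1), (40, 6, 19, 2), (40, 43, 23, 1), (40, 2, 23, 2), (40, 32, 24, 1), (40, 44, 27, 1), (40, 42, 29, 1), (40, 41, 31, 1),
   (40, 26, 35, 1), (40, 28, 37, 1), (40, 30, 38, 1), (40, 40, 39, 2), (40, 48, 39, 1), (40, 25, 47, 1), (40, 40, 49, 1), (40, 40, 51, 1),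
   (41, 37, 1, 1), (41, 21, 1, 2), (41, 35, 5, 1), (41, 17, 5, 2), (41, 32, 8, 1), (41, 12, 8, 2), (41, 47, 15, 1), (41, 11, 15, 2),
   (41, 44, 18, 1), (41, 6, 18, 2), (41, 42, 22, 1), (41, 2, 22, 2), (41, 33, 24, 1), (41, 45, 27, 1), (41, 43, 29, 1), (41, 40, 30, 1),
   (41, 26, 34, 1), (41, 28, 36, 1), (41, 41, 38, 2), (41, 48, 38, 1), (41, 49, 38, 1), (41, 31, 39, 1), (41, 25, 46, 1), (41, 41, 48, 1),
   (41, 41, 49, 1), (41, 41, 51, 1), (42, 38, 1, 1), (42, 22, 1, 2), (42, 32, 4, 1), (42, 16, 4, 2), (42, 35, 9, 1), (42, 13, 9, 2),
   (42, 44, 14, 1), (42, 10, 14, 2), (42, 47, 19, 1), (42, 7, 19, 2), (42, 41, 21, 1), (42, 2, 21, 2), (42, 34, 24, 1), (42, 46, 27, 1),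
   (42, 40, 28, 1), (42, 43, 31, 1), (42, 26, 33, 1), (42, 30, 36, 1), (42, 42, 37, 2), (42, 48, 37, 1), (42, 49, 37, 1), (42, 29, 39, 1),
   (42, 25, 45, 1), (42, 42, 48, 1), (42, 42, 49, 1), (42, 42, 50, 1), (42, 42, 51, 1), (43, 39, 1, 1), (43, 23, 1, 2), (43, 33, 4, 1),
   (43, 17, 4, 2), (43, 34, 8, 1), (43, 13, 8, 2), (43, 45, 14, 1), (43, 11, 14, 2), (43, 46, 18, 1), (43, 7, 18, 2), (43, 40, 20, 1),
   (43, 2, 20, 2), (43, 35, 24, 1), (43, 47, 27, 1), (43, 41, 28, 1), (43, 42, 30, 1), (43, 26, 32, 1), (43, 43, 36, 2), (43, 48, 36, 1),
   (43, 31, 37, 1), (43, 29, 38, 1), (43, 25, 44, 1), (43, 43, 49, 1), (43, 43, 50, 1), (43, 43, 51, 1), (44, 32, 0, 1), (44, 20, 0, 2),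
   (44, 38, 5, 1), (44, 18, 5, 2), (44, 37, 9, 1), (44, 14, 9, 2), (44, 42, 13, 1), (44, 10, 13, 2), (44, 41, 17, 1), (44, 6, 17, 2),
   (44, 47, 23, 1), (44, 3, 23, 2), (44, 36, 24, 1), (44, 40, 26, 1), (44, 46, 29, 1), (44, 45, 31, 1), (44, 28, 33, 1), (44, 30, 34, 1),
   (44, 44, 35, 2), (44, 48, 35, 1), (44, 49, 35, 1), (44, 27, 39, 1), (44, 25, 43, 1), (44, 44, 48, 1), (44, 44, 49, 1), (44, 44, 50, 1),
   (45, 33, 0, 1), (45, 21, 0, 2), (45, 39, 5, 1), (45, 19, 5, 2), (45, 36, 8, 1), (45, 14, 8, 2), (45, 43, 13, 1), (45, 11, 13, 2),
   (45, 40, 16, 1), (45, 6, 16, 2), (45, 46, 22, 1), (45, 3, 22, 2), (45, 37, 24, 1), (45, 41, 26, 1), (45, 47, 29, 1), (45, 44, 30, 1),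
   (45, 28, 32, 1), (45, 45, 34, 2), (45, 48, 34, 1), (45, 31, 35, 1), (45, 27, 38, 1), (45, 25, 42, 1), (45, 45, 49, 1), (45, 45, 50, 1),
   (46, 34, 0, 1), (46, 22, 0, 2), (46, 36, 4, 1), (46, 18, 4, 2), (46, 39, 9, 1), (46, 15, 9, 2), (46, 40, 12, 1), (46, 10, 12, 2),
   (46, 43, 17, 1), (46, 7, 17, 2), (46, 45, 21, 1), (46, 3, 21, 2), (46, 38, 24, 1), (46, 42, 26, 1), (46, 44, 28, 1), (46, 47, 31, 1),
   (46, 30, 32, 1), (46, 46, 33, 2), (46, 48, 33, 1), (46, 29, 35, 1), (46, 27, 37, 1), (46, 25, 41, 1), (46, 46, 49, 1), (47, 35, 0, 1),
   (47, 23, 0, 2), (47, 37, 4, 1), (47, 19, 4, 2), (47, 38, 8, 1), (47, 15, 8, 2), (47, 41, 12, 1), (47, 11, 12, 2), (47, 42, 16, 1),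
   (47, 7, 16, 2), (47, 44, 20, 1), (47, 3, 20, 2), (47, 39, 24, 1), (47, 43, 26, 1), (47, 45, 28, 1), (47, 46, 30, 1), (47, 47, 32, 2),
   (47, 48, 32, 1), (47, 49, 32, 1), (47, 31, 33, 1), (47, 29, 34, 1), (47, 27, 36, 1), (47, 25, 40, 1), (47, 47, 48, 1), (47, 47, 49, 1) ]"

definition u_el :: "root4 \<Rightarrow> 'a::field \<Rightarrow> 'a mat" where
  "u_el r t = mat 52 52 (\<lambda>(i, j). (if i = j then 1 else 0) +
      sum_list (map (\<lambda>(ri, i', j', k). if F4_roots ! ri = r \<and> i' = i \<and> j' = j then t ^ k else 0)
        chev_entries))"

inductive_set grp_gen :: "'a::field mat set \<Rightarrow> 'a mat set" for S where
  gen_one: "1\<^sub>m 52 \<in> grp_gen S"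
| gen_incl: "A \<in> S \<Longrightarrow> A \<in> grp_gen S"
| gen_mult: "A \<in> grp_gen S \<Longrightarrow> B \<in> grp_gen S \<Longrightarrow> A * B \<in> grp_gen S"
| gen_inv: "A \<in> grp_gen S \<Longrightarrow> B \<in> carrier_mat 52 52 \<Longrightarrow> A * B = 1\<^sub>m 52 \<Longrightarrow> B \<in> grp_gen S"

definition n_el :: "root4 \<Rightarrow> 'a::field \<Rightarrow> 'a mat" where
  "n_el r t = u_el r t * u_el (rneg r) (inverse t) * u_el r t"

definition h_el :: "root4 \<Rightarrow> 'a::field \<Rightarrow> 'a mat" where
  "h_el r t = n_el r t * n_el r 1"

definition F4 :: "'a::field set \<Rightarrow> 'a mat set" where
  "F4 L = grp_gen {u_el r t | r t. r \<in> F4_Phi \<and> t \<in> L}"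

definition torus :: "'a::field set \<Rightarrow> 'a mat set" where
  "torus L = grp_gen {h_el r t | r t. r \<in> F4_Phi \<and> t \<in> L \<and> t \<noteq> 0}"

definition U_root :: "'a::field set \<Rightarrow> 'a set \<Rightarrow> root4 \<Rightarrow> 'a mat set" where
  "U_root K L r = {u_el r t | t. t \<in> (if F4_long r then K else L)}"

definition F4_mixed :: "'a::field set \<Rightarrow> 'a set \<Rightarrow> 'a mat set" where
  "F4_mixed K L = grp_gen (\<Union>r\<in>F4_Phi. U_root K L r)"

definition U_J :: "'a::field set \<Rightarrow> 'a mat set" where
  "U_J L = grp_gen {u_el r t | r t. F4_pos r \<and> \<not> in_PhiJ r \<and> t \<in> L}"

definition U_J_minus :: "'a::field set \<Rightarrow> 'a mat set" where
  "U_J_minus L = grp_gen {u_el r t | r t. F4_neg r \<and> \<not> in_PhiJ r \<and> t \<in> L}"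

definition L_J :: "'a::field set \<Rightarrow> 'a mat set" where
  "L_J L = grp_gen (torus L \<union> {u_el r t | r t. in_PhiJ r \<and> t \<in> L})"

definition P_J :: "'a::field set \<Rightarrow> 'a mat set" where
  "P_J L = {a * b | a b. a \<in> U_J L \<and> b \<in> L_J L}"

definition U_w_e4_J :: "'a::field set \<Rightarrow> 'a set \<Rightarrow> 'a mat set" where
  "U_w_e4_J K L = grp_gen (\<Union>r\<in>{r. F4_pos r \<and> \<not> in_PhiJ r \<and> F4_neg (w_e4 r)}. U_root K L r)"

definition n_e4 :: "'a::field mat" where
  "n_e4 = u_el e4 1 * u_el (rneg e4) 1 * u_el e4 1"

definition Fix :: "'a::field set \<Rightarrow> 'a set \<Rightarrow> ('a mat \<Rightarrow> 'a mat) \<Rightarrow> 'a mat set" where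
  "Fix K L \<sigma> = {g \<in> F4_mixed K L. \<sigma> g = g}"

end

theory Submission
  imports Defs "Jordan_Normal_Form.Determinant"
begin

text \<open>Let P be the subgroup of the mixed group G belonging to the roots with nonnegative
  e4-coordinate. Then G is the union of five double cosets of P, the extreme ones being P and
  P n_e4 P. The root elements with e4-coordinate 1 generate an elementary abelian normal subgroup Z
  of P with a P-invariant notion of singular vector of a quadratic form, and the form in the
  anisotropy hypothesis is its restriction to the fixed points of sigma. If a fixed g lies in one of
  the three middle double cosets, then Z and its conjugate by g determine a nontrivial sigma-stable
  subgroup A of Z consisting of singular elements. By anisotropy A has no nontrivial fixed points, but
  z * sigma(z) is fixed for every z in A, so A is trivial, a contradiction. A fixed element
  of P n_e4 P has a unique decomposition u l n_e4 u', and sigma preserves the three groups involved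
  and fixes n_e4; hence sigma fixes all factors.\<close>

section \<open>Evaluating words in root elements\<close>

text \<open>The double cosets of P correspond to the orbits of W_J on the 24 short roots, which are
  the images of e4. The orbits have sizes 1, 8, 6, 8, 1 and are told apart by the e4-coordinate.
  Characteristic 2 supplies three facts. The elements \<open>n_el r 1\<close> are involutions and
  the relations used between them hold without torus factors, so Weyl words can be handled as
  matrices. Orthogonal short roots have trivial commutators, which keeps the parameters of long
  roots in K. The root elements of Phi_J fix the vectors of e4 and -e4 in the adjoint module, so the
  entry of z in row e4 and column -e4, which is the quadratic form, changes only by a scalar when P
  acts on Z. The third middle coset is the obstacle: up to P, the conjugate of Z there belongs to
  roots with nonpositive e4-coordinate, so A cannot be an intersection with Z as in the first two.
  It is the set of elements of Z that carry the conjugate into itself.\<close>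

text \<open>An identity between words in root elements with monomial parameters is checked by
  rewriting, one basis column at a time: a column is a list of triples (i, a, b) standing for
  x^a y^b in row i, and equal triples cancel in characteristic 2. A root element is a triple (n, a, b)
  standing for u_r(x^a y^b) with r = F4_roots ! n; the roots alpha1, alpha2, alpha3, alpha4, e4 have the
  indices 46, 28, 13, 1, 30.\<close>

primrec cons_if :: "bool \<Rightarrow> 'b \<Rightarrow> 'b list \<Rightarrow> 'b list" where
  "cons_if True x xs = x # xs"
| "cons_if False x xs = xs"

primrec sel_row :: "nat \<Rightarrow> (nat \<times> nat \<times> nat \<times> nat) list \<Rightarrow> (nat \<times> nat \<times> int) list" where
  "sel_row n [] = []"
| "sel_row n (e # es) = cons_if (fst e = n) (fst (snd (snd e)), fst (snd e), int (snd (snd (snd e)))) (sel_row n es)"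

primrec sel_col :: "(nat \<times> 'b) list \<Rightarrow> nat \<Rightarrow> 'b list" where
  "sel_col [] j = []"
| "sel_col (e # es) j = cons_if (fst e = j) (snd e) (sel_col es j)"

text \<open>The off-diagonal entries in column j of root element number n, as pairs of a row and an
  exponent of the parameter. The diagonal 1 is supplied by \<open>act\<close>, which keeps every
  term that it transforms.\<close>

definition ucol :: "nat \<Rightarrow> nat \<Rightarrow> (nat \<times> int) list" where
  "ucol n j = sel_col (sel_row n chev_entries) j"

definition idx48 :: "nat list" where
  "idx48 = [0, 1, 2, 3, 4, 5, 6, 7, 8, 9, 10, 11, 12, 13, 14, 15, 16, 17, 18, 19, 20, 21, 22, 23, 24, 25, 26, 27, 28, 29, 30, 31, 32, 33, 34, 35, 36, 37, 38, 39, 40, 41, 42, 43, 44, 45, 46, 47]"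

definition idx52 :: "nat list" where
  "idx52 = [0, 1, 2, 3, 4, 5, 6, 7, 8, 9, 10, 11, 12, 13, 14, 15, 16, 17, 18, 19, 20, 21, 22, 23, 24, 25, 26, 27, 28, 29, 30, 31, 32, 33, 34, 35, 36, 37, 38, 39, 40, 41, 42, 43, 44, 45, 46, 47, 48, 49, 50, 51]"

lemma idx48: "idx48 = [0..<48]"
  unfolding idx48_def by (simp add: upt_rec)

lemma idx52: "idx52 = [0..<52]"
  unfolding idx52_def by (simp add: upt_rec)

lemma row_map: "map (ucol n) idx52 = map (sel_col (sel_row n chev_entries)) idx52"
  by (simp add: ucol_def)

lemmas num_rules = one_neq_zero zero_neq_one eq_num_simps eq_numeral_simps arith_simps
  mult_1_left mult_1_right mult_minus1 mult_minus1_right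
  numeral_One one_add_one one_plus_numeral numeral_plus_one add_neg_numeral_special diff_numeral_special of_nat_numeral of_nat_1 of_nat_0 simp_thms fst_conv snd_conv prod.inject

lemmas row_eval = sel_row.simps cons_if.simps num_rules
lemmas col_eval = list.map sel_col.simps cons_if.simps list.inject num_rules

text \<open>Each instance compares two lists of length 52 componentwise and so becomes 52 equations
  for \<open>ucol n j\<close>. All columns of the 48 root elements are thus tabulated once, and the
  evaluations below never search \<open>chev_entries\<close> again.\<close>

lemmas ucol_rules =
  row_map[of 0, unfolded chev_entries_def, simplified row_eval, unfolded idx52_def, simplified col_eval]
  row_map[of 1, unfolded chev_entries_def, simplified row_eval, unfolded idx52_def, simplified col_eval]
  row_map[of 2, unfolded chev_entries_def, simplified row_eval, unfolded idx52_def, simplified col_eval]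
  row_map[of 3, unfolded chev_entries_def, simplified row_eval, unfolded idx52_def, simplified col_eval]
  row_map[of 4, unfolded chev_entries_def, simplified row_eval, unfolded idx52_def, simplified col_eval]
  row_map[of 5, unfolded chev_entries_def, simplified row_eval, unfolded idx52_def, simplified col_eval]
  row_map[of 6, unfolded chev_entries_def, simplified row_eval, unfolded idx52_def, simplified col_eval]
  row_map[of 7, unfolded chev_entries_def, simplified row_eval, unfolded idx52_def, simplified col_eval]
  row_map[of 8, unfolded chev_entries_def, simplified row_eval, unfolded idx52_def, simplified col_eval]
  row_map[of 9, unfolded chev_entries_def, simplified row_eval, unfolded idx52_def, simplified col_eval]
  row_map[of 10, unfolded chev_entries_def, simplified row_eval, unfolded idx52_def, simplified col_eval]
  row_map[of 11, unfolded chev_entries_def, simplified row_eval, unfolded idx52_def, simplified col_eval]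
  row_map[of 12, unfolded chev_entries_def, simplified row_eval, unfolded idx52_def, simplified col_eval]
  row_map[of 13, unfolded chev_entries_def, simplified row_eval, unfolded idx52_def, simplified col_eval]
  row_map[of 14, unfolded chev_entries_def, simplified row_eval, unfolded idx52_def, simplified col_eval]
  row_map[of 15, unfolded chev_entries_def, simplified row_eval, unfolded idx52_def, simplified col_eval]
  row_map[of 16, unfolded chev_entries_def, simplified row_eval, unfolded idx52_def, simplified col_eval]
  row_map[of 17, unfolded chev_entries_def, simplified row_eval, unfolded idx52_def, simplified col_eval]
  row_map[of 18, unfolded chev_entries_def, simplified row_eval, unfolded idx52_def, simplified col_eval]
  row_map[of 19, unfolded chev_entries_def, simplified row_eval, unfolded idx52_def, simplified col_eval]
  row_map[of 20, unfolded chev_entries_def, simplified row_eval, unfolded idx52_def, simplified col_eval]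
  row_map[of 21, unfolded chev_entries_def, simplified row_eval, unfolded idx52_def, simplified col_eval]
  row_map[of 22, unfolded chev_entries_def, simplified row_eval, unfolded idx52_def, simplified col_eval]
  row_map[of 23, unfolded chev_entries_def, simplified row_eval, unfolded idx52_def, simplified col_eval]
  row_map[of 24, unfolded chev_entries_def, simplified row_eval, unfolded idx52_def, simplified col_eval]
  row_map[of 25, unfolded chev_entries_def, simplified row_eval, unfolded idx52_def, simplified col_eval]
  row_map[of 26, unfolded chev_entries_def, simplified row_eval, unfolded idx52_def, simplified col_eval]
  row_map[of 27, unfolded chev_entries_def, simplified row_eval, unfolded idx52_def, simplified col_eval]
  row_map[of 28, unfolded chev_entries_def, simplified row_eval, unfolded idx52_def, simplified col_eval]
  row_map[of 29, unfolded chev_entries_def, simplified row_eval, unfolded idx52_def, simplified col_eval]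
  row_map[of 30, unfolded chev_entries_def, simplified row_eval, unfolded idx52_def, simplified col_eval]
  row_map[of 31, unfolded chev_entries_def, simplified row_eval, unfolded idx52_def, simplified col_eval]
  row_map[of 32, unfolded chev_entries_def, simplified row_eval, unfolded idx52_def, simplified col_eval]
  row_map[of 33, unfolded chev_entries_def, simplified row_eval, unfolded idx52_def, simplified col_eval]
  row_map[of 34, unfolded chev_entries_def, simplified row_eval, unfolded idx52_def, simplified col_eval]
  row_map[of 35, unfolded chev_entries_def, simplified row_eval, unfolded idx52_def, simplified col_eval]
  row_map[of 36, unfolded chev_entries_def, simplified row_eval, unfolded idx52_def, simplified col_eval]
  row_map[of 37, unfolded chev_entries_def, simplified row_eval, unfolded idx52_def, simplified col_eval]
  row_map[of 38, unfolded chev_entries_def, simplified row_eval, unfolded idx52_def, simplified col_eval]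
  row_map[of 39, unfolded chev_entries_def, simplified row_eval, unfolded idx52_def, simplified col_eval]
  row_map[of 40, unfolded chev_entries_def, simplified row_eval, unfolded idx52_def, simplified col_eval]
  row_map[of 41, unfolded chev_entries_def, simplified row_eval, unfolded idx52_def, simplified col_eval]
  row_map[of 42, unfolded chev_entries_def, simplified row_eval, unfolded idx52_def, simplified col_eval]
  row_map[of 43, unfolded chev_entries_def, simplified row_eval, unfolded idx52_def, simplified col_eval]
  row_map[of 44, unfolded chev_entries_def, simplified row_eval, unfolded idx52_def, simplified col_eval]
  row_map[of 45, unfolded chev_entries_def, simplified row_eval, unfolded idx52_def, simplified col_eval]
  row_map[of 46, unfolded chev_entries_def, simplified row_eval, unfolded idx52_def, simplified col_eval]
  row_map[of 47, unfolded chev_entries_def, simplified row_eval, unfolded idx52_def, simplified col_eval]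

type_synonym letter = "nat \<times> int \<times> int"

primrec tog_if :: "bool \<Rightarrow> 'b \<Rightarrow> 'b list \<Rightarrow> 'b list \<Rightarrow> 'b list" where
  "tog_if True x xs ys = xs"
| "tog_if False x xs ys = x # ys"

primrec tog :: "'b \<Rightarrow> 'b list \<Rightarrow> 'b list" where
  "tog e [] = [e]"
| "tog e (x # xs) = tog_if (e = x) x xs (tog e xs)"

primrec togs :: "'b list \<Rightarrow> 'b list \<Rightarrow> 'b list" where
  "togs [] acc = acc"
| "togs (e # es) acc = togs es (tog e acc)"

text \<open>The off-diagonal part of the image of one term x^c y^d under the root element with
  parameter x^a y^b. It is toggled into \<open>acc\<close> directly, so that terms cancel as soon as
  they meet.\<close>

primrec shift :: "int \<Rightarrow> int \<Rightarrow> int \<Rightarrow> int \<Rightarrow> (nat \<times> int) list \<Rightarrow> letter list \<Rightarrow> letter list" where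
  "shift a b c d [] acc = acc"
| "shift a b c d (e # es) acc = shift a b c d es (tog (fst e, c + snd e * a, d + snd e * b) acc)"

primrec act :: "nat \<Rightarrow> int \<Rightarrow> int \<Rightarrow> letter list \<Rightarrow> letter list \<Rightarrow> letter list" where
  "act n a b [] acc = acc"
| "act n a b (e # es) acc = act n a b es (shift a b (fst (snd e)) (snd (snd e)) (ucol n (fst e)) (tog e acc))"

primrec run :: "letter list \<Rightarrow> letter list \<Rightarrow> letter list" where
  "run [] V = V"
| "run (w # ws) V = act (fst w) (fst (snd w)) (snd (snd w)) (run ws V) []"

text \<open>Toggling one column into the other and testing for emptiness makes the comparison
  independent of the order in which terms were produced.\<close>

definition same :: "letter list \<Rightarrow> letter list \<Rightarrow> bool" where
  "same ws ws' \<longleftrightarrow> list_all (\<lambda>j. togs (run ws [(j, 0, 0)]) (run ws' [(j, 0, 0)]) = []) idx52"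

lemmas run_rules = ucol_rules tog_if.simps tog.simps togs.simps shift.simps act.simps run.simps
  list.pred_inject list.distinct num_rules

section \<open>Soundness of the symbolic evaluation\<close>

abbreviation M52 :: "'a::field mat set" where
  "M52 \<equiv> carrier_mat 52 52"

lemma u_el_carrier [simp]: "u_el r t \<in> M52"
  by (simp add: u_el_def)

lemma dim_u_el [simp]: "dim_row (u_el r t) = 52" "dim_col (u_el r t) = 52"
  by (simp_all add: u_el_def)

lemma roots_distinct: "distinct F4_roots"
  by (simp add: F4_roots_def)

lemma length_roots [simp]: "length F4_roots = 48"
  by (simp add: F4_roots_def)

lemma roots_nth_map: "map ((!) F4_roots) idx48 = F4_roots"
  using map_nth[of F4_roots] by (simp only: idx48 length_roots)

lemmas roots_nth = roots_nth_map[unfolded F4_roots_def idx48_def list.map list.inject simp_thms, folded F4_roots_def]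

text \<open>The weights of the adjoint module: a root vector carries its root, and the four coroot
  elements carry zero.\<close>

definition weight :: "nat \<Rightarrow> root4" where
  "weight j = (F4_roots @ [(0, 0, 0, 0), (0, 0, 0, 0), (0, 0, 0, 0), (0, 0, 0, 0)]) ! j"

lemma weight_map: "map weight idx52 = F4_roots @ [(0, 0, 0, 0), (0, 0, 0, 0), (0, 0, 0, 0), (0, 0, 0, 0)]"
  using map_nth[of "F4_roots @ [(0, 0, 0, 0), (0, 0, 0, 0), (0, 0, 0, 0), (0, 0, 0, 0)]"]
  by (simp add: idx52 weight_def[abs_def] del: upt_rec_numeral)

lemmas weight_eval = weight_map[unfolded F4_roots_def idx52_def list.map append.simps list.inject simp_thms]

lemma weight_root: "n < 48 \<Longrightarrow> weight n = F4_roots ! n"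
  by (simp add: weight_def nth_append)

definition entry_ok :: "nat \<times> nat \<times> nat \<times> nat \<Rightarrow> bool" where
  "entry_ok e \<longleftrightarrow> (fst e < 48 \<and> fst (snd e) < 52 \<and> fst (snd (snd e)) < 52) \<and>
     (fst (snd e) \<noteq> fst (snd (snd e)) \<and> (snd (snd (snd e)) = 1 \<or> snd (snd (snd e)) = 2)) \<and>
     weight (fst (snd e)) = radd (weight (fst (snd (snd e)))) (rscale (int (snd (snd (snd e)))) (weight (fst e)))"

text \<open>The grading of the table: the coefficient of t^k in a root element raises weights by k
  times the root, with k = 1 or 2. The later arguments with weights rest on this.\<close>

lemma entries_ok: "list_all entry_ok chev_entries"
  unfolding chev_entries_def
  by (simp only: list.pred_inject entry_ok_def weight_eval radd_def rscale_def prod.case num_rules rel_simps)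

lemma entry_okD:
  assumes "(ri, i, j, k) \<in> set chev_entries"
  shows "ri < 48" "i < 52" "j < 52" "i \<noteq> j" "k = 1 \<or> k = 2"
    "weight i = radd (weight j) (rscale (int k) (weight ri))"
  using entries_ok assms by (auto simp: list_all_iff entry_ok_def)

lemma sel_row_set: "(j, i, k) \<in> set (sel_row n es) \<longleftrightarrow> (\<exists>m. k = int m \<and> (n, i, j, m) \<in> set es)"
proof (induction es)
  case (Cons e es)
  show ?case by (cases e; cases "fst e = n") (use Cons in auto)
qed simp

lemma sel_col_set: "x \<in> set (sel_col es j) \<longleftrightarrow> (j, x) \<in> set es"
proof (induction es)
  case (Cons e es)
  show ?case by (cases e; cases "fst e = j") (use Cons in auto)
qed simp

lemma ucol_set: "(i, k) \<in> set (ucol n j) \<longleftrightarrow> (\<exists>m. k = int m \<and> (n, i, j, m) \<in> set chev_entries)"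
  by (simp add: ucol_def sel_col_set sel_row_set)

lemma ucolD:
  assumes "(i, k) \<in> set (ucol n j)"
  shows "n < 48" "i < 52" "j < 52" "i \<noteq> j" "k = 1 \<or> k = 2" "weight i = radd (weight j) (rscale k (weight n))"
proof -
  obtain m where m: "k = int m" "(n, i, j, m) \<in> set chev_entries"
    using assms by (auto simp: ucol_set)
  show "n < 48" "i < 52" "j < 52" "i \<noteq> j" "k = 1 \<or> k = 2" "weight i = radd (weight j) (rscale k (weight n))"
    using entry_okD[OF m(2)] unfolding m(1) by auto
qed

lemma u_entry:
  assumes n: "n < 48" and "i < 52" "j < 52"
  shows "u_el (F4_roots ! n) t $$ (i, j) =
    (if i = j then 1 else 0) + (\<Sum>e\<leftarrow>ucol n j. if fst e = i then t powi snd e else 0)"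
proof -
  have root_eq: "F4_roots ! ri = F4_roots ! n \<longleftrightarrow> ri = n" if "ri < 48" for ri
    using roots_distinct n that by (simp add: nth_eq_iff_index_eq)
  \<comment> \<open>The claim is made for any part of the table, since the bound on the root index
    that \<open>root_eq\<close> asks for is known only for members of
    \<open>chev_entries\<close>.\<close>
  have main: "(\<Sum>(ri, i', j', k)\<leftarrow>es. if F4_roots ! ri = F4_roots ! n \<and> i' = i \<and> j' = j then t ^ k else 0) =
      (\<Sum>e\<leftarrow>sel_col (sel_row n es) j. if fst e = i then t powi snd e else 0)"
    if "set es \<subseteq> set chev_entries" for es
    using that
  proof (induction es)
    case (Cons e es)
    obtain ri i' j' k where e: "e = (ri, i', j', k)" by (cases e)
    have "ri < 48" using Cons.prems e entry_okD(1) by auto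
    then show ?case
      using Cons by (cases "ri = n"; cases "j' = j") (auto simp: e root_eq)
  qed simp
  have "u_el (F4_roots ! n) t $$ (i, j) = (if i = j then 1 else 0) +
      (\<Sum>(ri, i', j', k)\<leftarrow>chev_entries. if F4_roots ! ri = F4_roots ! n \<and> i' = i \<and> j' = j then t ^ k else 0)"
    unfolding u_el_def using assms by (subst index_mat) auto
  then show ?thesis
    unfolding ucol_def by (simp only: main[OF subset_refl])
qed

lemma sum_list_delta_sum:
  "(\<And>e. e \<in> set V \<Longrightarrow> fst e < m) \<Longrightarrow>
    (\<Sum>l<m. f l * (\<Sum>e\<leftarrow>V. if fst e = l then g e else 0)) = (\<Sum>e\<leftarrow>V. f (fst e) * g e)"
  for f :: "nat \<Rightarrow> 'a::comm_ring_1"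
proof (induction V)
  case (Cons e V)
  have "(\<Sum>l<m. f l * (if fst e = l then g e else 0)) = f (fst e) * g e"
    using Cons.prems[of e] by (subst sum.remove[of _ "fst e"]) auto
  then show ?case using Cons by (simp add: distrib_left sum.distrib)
qed simp

definition colv :: "(nat \<times> 'a::field) list \<Rightarrow> nat \<Rightarrow> 'a" where
  "colv V i = (\<Sum>e\<leftarrow>V. if fst e = i then snd e else 0)"

text \<open>The counterpart of \<open>act\<close> with field elements as coefficients and without
  cancellation. It mediates between the symbolic evaluation and multiplication of matrices.\<close>

definition acts :: "nat \<Rightarrow> 'a \<Rightarrow> (nat \<times> 'a::field) list \<Rightarrow> (nat \<times> 'a) list" where
  "acts n t V = concat (map (\<lambda>e. e # map (\<lambda>x. (fst x, t powi snd x * snd e)) (ucol n (fst e))) V)"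

lemma colv_Nil [simp]: "colv [] i = 0"
  by (simp add: colv_def)

lemma colv_Cons [simp]: "colv (e # V) i = (if fst e = i then snd e else 0) + colv V i"
  by (simp add: colv_def)

lemma colv_append [simp]: "colv (V @ V') i = colv V i + colv V' i"
  by (induction V) (auto simp: algebra_simps)

lemma colv_outside: "(\<And>e. e \<in> set V \<Longrightarrow> fst e \<noteq> i) \<Longrightarrow> colv V i = 0"
  by (induction V) auto

lemma acts_bounded:
  "(\<And>e. e \<in> set V \<Longrightarrow> fst e < 52) \<Longrightarrow> e \<in> set (acts n t V) \<Longrightarrow> fst e < 52"
  by (auto simp: acts_def dest: ucolD(2))

lemma mult_entry:
  assumes "A \<in> M52" "B \<in> M52" "i < 52" "j < 52"
  shows "(A * B) $$ (i, j) = (\<Sum>l<52. A $$ (i, l) * B $$ (l, j))"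
  using assms by (simp add: scalar_prod_def atLeast0LessThan)

lemma u_mult_colv:
  assumes n: "n < 48" and B: "B \<in> M52" and i: "i < 52" and j: "j < 52"
    and V: "\<And>e. e \<in> set V \<Longrightarrow> fst e < 52" and BV: "\<And>l. l < 52 \<Longrightarrow> B $$ (l, j) = colv V l"
  shows "(u_el (F4_roots ! n) t * B) $$ (i, j) = colv (acts n t V) i"
proof -
  have "(u_el (F4_roots ! n) t * B) $$ (i, j) = (\<Sum>l<52. u_el (F4_roots ! n) t $$ (i, l) * colv V l)"
    using mult_entry[OF u_el_carrier B i j, of "F4_roots ! n" t] by (simp add: BV)
  also have "\<dots> = (\<Sum>e\<leftarrow>V. u_el (F4_roots ! n) t $$ (i, fst e) * snd e)"
    unfolding colv_def by (rule sum_list_delta_sum) (rule V)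
  also have "\<dots> = colv (acts n t V) i"
    using V
  proof (induction V)
    case (Cons e V)
    have "colv (map (\<lambda>x. (fst x, t powi snd x * c)) C) i =
        (\<Sum>e\<leftarrow>C. if fst e = i then t powi snd e else 0) * c" for C c
      by (induction C) (auto simp: algebra_simps)
    then show ?case
      using Cons n i by (simp add: acts_def u_entry distrib_right)
  qed (simp add: acts_def)
  finally show ?thesis .
qed

lemma char2_add_self: "CHAR('a::field) = 2 \<Longrightarrow> x + x = (0::'a)"
  by (metis mult_2 mult_zero_left of_nat_CHAR of_nat_numeral)

definition mval :: "'a::field \<Rightarrow> 'a \<Rightarrow> letter \<Rightarrow> nat \<times> 'a" where
  "mval x y e = (fst e, x powi fst (snd e) * y powi snd (snd e))"

lemma colv_tog:
  assumes "CHAR('a::field) = 2"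
  shows "colv (map (mval (x::'a) y) (tog e V)) i = colv [mval x y e] i + colv (map (mval x y) V) i"
proof (induction V)
  case (Cons v V)
  show ?case
  proof (cases "e = v")
    case True
    have "c + (c + d) = (d::'a)" for c d
      using char2_add_self[OF assms, of c] by (simp add: add.assoc[symmetric])
    then show ?thesis using True by simp
  qed (use Cons in \<open>simp add: algebra_simps\<close>)
qed simp

lemma colv_togs:
  assumes "CHAR('a::field) = 2"
  shows "colv (map (mval (x::'a) y) (togs V W)) i = colv (map (mval x y) V) i + colv (map (mval x y) W) i"
  by (induction V arbitrary: W) (auto simp: colv_tog[OF assms] algebra_simps)

lemma colv_shift:
  assumes "CHAR('a::field) = 2" "x \<noteq> 0" "y \<noteq> 0"
  shows "colv (map (mval (x::'a) y) (shift a b c d C acc)) i =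
    colv (map (\<lambda>e. (fst e, (x powi a * y powi b) powi snd e * (x powi c * y powi d))) C) i + colv (map (mval x y) acc) i"
proof (induction C arbitrary: acc)
  case (Cons e C)
  have "x powi (c + snd e * a) * y powi (d + snd e * b) = (x powi a * y powi b) powi snd e * (x powi c * y powi d)"
    using assms(2,3) by (simp add: power_int_add power_int_mult_distrib power_int_mult[symmetric] mult_ac)
  then show ?case
    by (simp add: Cons colv_tog[OF assms(1)]) (simp add: mval_def add_ac)
qed simp

lemma colv_act:
  assumes "CHAR('a::field) = 2" "x \<noteq> 0" "y \<noteq> 0"
  shows "colv (map (mval (x::'a) y) (act n a b V acc)) i =
    colv (acts n (x powi a * y powi b) (map (mval x y) V)) i + colv (map (mval x y) acc) i"
proof (induction V arbitrary: acc)
  case (Cons e V)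
  show ?case
    by (simp add: Cons colv_shift[OF assms] colv_tog[OF assms(1)] acts_def)
      (simp add: mval_def algebra_simps)
qed (simp add: acts_def)

primrec word :: "'a::field \<Rightarrow> 'a \<Rightarrow> letter list \<Rightarrow> 'a mat" where
  "word x y [] = 1\<^sub>m 52"
| "word x y (w # ws) = u_el (F4_roots ! fst w) (snd (mval x y w)) * word x y ws"

lemma word_carrier [simp]: "word x y ws \<in> M52"
  by (induction ws) (simp_all del: carrier_matI add: mult_carrier_mat[OF u_el_carrier])

lemma word_entry:
  assumes "CHAR('a::field) = 2" "x \<noteq> 0" "y \<noteq> 0" and "\<And>w. w \<in> set ws \<Longrightarrow> fst w < 48" and j: "j < 52" and "i < 52"
  shows "word (x::'a) y ws $$ (i, j) = colv (map (mval x y) (run ws [(j, 0, 0)])) i"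
  using assms(4,6)
proof (induction ws arbitrary: i)
  case (Cons w ws)
  \<comment> \<open>Row indices in \<open>run\<close> are not known to be below 52. Terms outside
    that range have empty columns and contribute to no row of the matrix, so they may be filtered
    away.\<close>
  define V where "V = filter (\<lambda>e. fst e < 52) (map (mval x y) (run ws [(j, 0, 0)]))"
  have filt: "colv (filter (\<lambda>e. fst e < 52) W) l = colv W l" if "l < 52" for l and W :: "(nat \<times> 'a) list"
    using that by (induction W) auto
  have acts_filt: "colv (acts n t (filter (\<lambda>e. fst e < 52) W)) l = colv (acts n t W) l" if "l < 52" for n t l and W :: "(nat \<times> 'a) list"
  proof (induction W)
    case (Cons e W)
    have "ucol n (fst e) = []" if "\<not> fst e < 52"
      using that ucolD(3)[of "fst x" "snd x" n "fst e" for x] by (cases "ucol n (fst e)") auto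
    then show ?case using Cons \<open>l < 52\<close> by (auto simp: acts_def)
  qed (simp add: acts_def)
  have "word x y (w # ws) $$ (i, j) = colv (acts (fst w) (snd (mval x y w)) V) i"
    unfolding word.simps
    by (rule u_mult_colv) (use Cons j in \<open>auto simp: V_def filt\<close>)
  also have "\<dots> = colv (acts (fst w) (snd (mval x y w)) (map (mval x y) (run ws [(j, 0, 0)]))) i"
    using Cons.prems by (simp add: V_def acts_filt)
  also have "\<dots> = colv (map (mval x y) (run (w # ws) [(j, 0, 0)])) i"
    by (simp add: colv_act[OF assms(1-3)] mval_def)
  finally show ?case .
qed (use j in \<open>auto simp: mval_def\<close>)

lemma eq_of_add_eq_0: "CHAR('a::field) = 2 \<Longrightarrow> a + b = 0 \<Longrightarrow> a = (b::'a)"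
  by (metis add.assoc add.right_neutral char2_add_self)

text \<open>An empty toggled list says that two columns have sum zero, which is equality in
  characteristic 2. The parameters must be nonzero because exponents may be negative.\<close>

lemma same_sound:
  assumes "same ws ws'" "list_all (\<lambda>w. fst w < 48) ws" "list_all (\<lambda>w. fst w < 48) ws'"
    and "CHAR('a::field) = 2" "x \<noteq> 0" "y \<noteq> 0"
  shows "word (x::'a) y ws = word x y ws'"
proof (rule eq_matI)
  fix i j assume "i < dim_row (word x y ws')" "j < dim_col (word x y ws')"
  then have ij: "i < 52" "j < 52" using word_carrier[of x y ws'] by auto
  have "togs (run ws [(j, 0, 0)]) (run ws' [(j, 0, 0)]) = []"
    using assms(1) ij by (simp add: same_def list_all_iff idx52)
  then have "word x y ws $$ (i, j) + word x y ws' $$ (i, j) = 0"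
    using assms ij colv_togs[of x y "run ws [(j, 0, 0)]" "run ws' [(j, 0, 0)]" i]
    by (simp add: word_entry list_all_iff)
  then show "word x y ws $$ (i, j) = word x y ws' $$ (i, j)"
    by (rule eq_of_add_eq_0[OF assms(4)])
qed (use carrier_matD[OF word_carrier[of x y ws]] carrier_matD[OF word_carrier[of x y ws']] in auto)

section \<open>Roots and reflections\<close>

text \<open>Four times the usual inner product, as coordinates are doubled: a short root has value 4
  with itself and a long root 8.\<close>

definition ip :: "root4 \<Rightarrow> root4 \<Rightarrow> int" where
  "ip r s = (case r of (a, b, c, d) \<Rightarrow> case s of (a', b', c', d') \<Rightarrow> a * a' + b * b' + c * c' + d * d')"

definition refl :: "root4 \<Rightarrow> root4 \<Rightarrow> root4" where
  "refl a q = radd q (rscale (- ((2 * ip q a) div ip a a)) a)"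

definition simple_roots :: "root4 list" where
  "simple_roots = [alpha1, alpha2, alpha3, alpha4]"

text \<open>The commutator factors u_q(t^i x^j) of u_r(t) and u_s(x); in characteristic 2 two
  orthogonal short roots contribute nothing.\<close>
definition comm_list :: "root4 \<Rightarrow> root4 \<Rightarrow> (root4 \<times> nat \<times> nat) list" where
  "comm_list r s =
    (if F4_long r = F4_long s then
       (if ip r s = (if F4_long r then -4 else -2) then [(radd r s, 1, 1)] else [])
     else if ip r s \<noteq> -4 then []
     else if F4_long r then [(radd r s, 1, 1), (radd r (rscale 2 s), 1, 2)]
     else [(radd r s, 1, 1), (radd (rscale 2 r) s, 2, 1)])"

definition neg_index :: "nat list" where
  "neg_index = [3, 2, 1, 0, 7, 6, 5, 4, 11, 10, 9, 8, 15, 14, 13, 12, 19, 18, 17, 16, 23, 22, 21, 20, 25, 24, 27, 26, 29, 28, 31, 30, 47, 46, 45, 44, 43, 42, 41, 40, 39, 38, 37, 36, 35, 34, 33, 32]"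

lemma neg_index: "map (\<lambda>n. rneg (F4_roots ! n)) idx48 = map ((!) F4_roots) neg_index"
  unfolding idx48_def neg_index_def by (simp only: list.map roots_nth rneg_def prod.case minus_zero minus_minus)

text \<open>The reflections as permutations of the root indices; the last branch serves e4, which
  has index 30.\<close>

definition refl_index :: "nat \<Rightarrow> nat list" where
  "refl_index a =
    (if a = 46 then [22, 1, 2, 21, 18, 5, 6, 17, 8, 15, 12, 11, 10, 13, 14, 9, 16, 7, 4, 19, 20, 3, 0, 23, 38, 41, 42, 37, 44, 35, 32, 47, 30, 46, 34, 29, 36, 27, 24, 39, 40, 25, 26, 43, 28, 45, 33, 31]
     else if a = 28 then [0, 1, 2, 3, 5, 4, 7, 6, 8, 9, 10, 11, 13, 12, 15, 14, 16, 17, 18, 19, 22, 23, 20, 21, 24, 25, 26, 27, 29, 28, 30, 31, 34, 35, 32, 33, 38, 39, 36, 37, 42, 43, 40, 41, 46, 47, 44, 45]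
     else if a = 13 then [4, 5, 6, 7, 0, 1, 2, 3, 8, 9, 10, 11, 12, 14, 13, 15, 20, 21, 22, 23, 16, 17, 18, 19, 24, 25, 28, 29, 26, 27, 30, 31, 32, 33, 36, 37, 34, 35, 38, 39, 40, 41, 44, 45, 42, 43, 46, 47]
     else if a = 1 then [0, 2, 1, 3, 12, 13, 14, 15, 16, 17, 18, 19, 4, 5, 6, 7, 8, 9, 10, 11, 20, 21, 22, 23, 26, 27, 24, 25, 28, 29, 30, 31, 32, 33, 34, 35, 40, 41, 42, 43, 36, 37, 38, 39, 44, 45, 46, 47]
     else [0, 1, 2, 3, 4, 5, 6, 7, 9, 8, 11, 10, 12, 13, 14, 15, 17, 16, 19, 18, 21, 20, 23, 22, 24, 25, 26, 27, 28, 29, 31, 30, 33, 32, 35, 34, 37, 36, 39, 38, 41, 40, 43, 42, 45, 44, 47, 46])"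

text \<open>Here a' is the index of the negative of root a, so three of the letters spell n_a(1).
  The parameter x stays unchanged because signs disappear in characteristic 2.\<close>

definition refl_ok :: "nat \<Rightarrow> nat \<Rightarrow> bool" where
  "refl_ok a a' \<longleftrightarrow> list_all (\<lambda>p. same [(a, 0, 0), (a', 0, 0), (a, 0, 0), (fst p, 1, 0)]
       [(snd p, 1, 0), (a, 0, 0), (a', 0, 0), (a, 0, 0)]) (zip idx48 (refl_index a))"

lemmas expand_rules = idx48_def neg_index_def zip_Cons_Cons zip_Nil list.pred_inject num_rules if_True if_False

lemmas same_rules = same_def idx52_def run_rules

lemma refl_ok_46: "refl_ok 46 33"
  by (simp only: refl_ok_def refl_index_def expand_rules) (simp only: same_rules)

lemma refl_ok_28: "refl_ok 28 29"
  by (simp only: refl_ok_def refl_index_def expand_rules) (simp only: same_rules)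

lemma refl_ok_13: "refl_ok 13 14"
  by (simp only: refl_ok_def refl_index_def expand_rules) (simp only: same_rules)

lemma refl_ok_1: "refl_ok 1 2"
  by (simp only: refl_ok_def refl_index_def expand_rules) (simp only: same_rules)

lemma refl_ok_30: "refl_ok 30 31"
  by (simp only: refl_ok_def refl_index_def expand_rules) (simp only: same_rules)

text \<open>The sum x + y is no monomial, so additivity cannot be put as an equality of words. But
  only the exponents 1 and 2 occur and squaring is additive, so the matrix of x + y is the sum of
  those of x and y and the identity. The test compares the product with this sum.\<close>

definition additive_index :: "nat \<Rightarrow> bool" where
  "additive_index n \<longleftrightarrow> list_all (\<lambda>j. togs (run [(n, 1, 0), (n, 0, 1)] [(j, 0, 0)])
     (togs (run [(n, 1, 0)] [(j, 0, 0)]) (togs (run [(n, 0, 1)] [(j, 0, 0)]) [(j, 0, 0)])) = []) idx52"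

lemma additive_index: "list_all additive_index idx48"
  by (simp only: expand_rules) (simp only: additive_index_def idx52_def run_rules)

text \<open>The commutators of alpha2 with all roots except its negative, which has index 29. One
  short and one long root suffice, as reflections carry the relations to the others;
  \<open>comm_long\<close> is the table for alpha3.\<close>

definition comm_short :: "(nat \<times> letter list) list" where
  "comm_short = [(0, []), (1, []), (2, []), (3, []), (4, []), (5, [(24, 1, 1), (4, 2, 1)]), (6, []), (7, [(25, 1, 1), (6, 2, 1)]), (8, []), (9, []), (10, []), (11, []), (12, []), (13, [(26, 1, 1), (12, 2, 1)]), (14, []), (15, [(27, 1, 1), (14, 2, 1)]), (16, []), (17, []), (18, []), (19, []), (20, []), (21, []), (22, [(30, 1, 1), (20, 2, 1)]), (23, [(31, 1, 1), (21, 2, 1)]), (24, []), (25, []), (26, []), (27, []), (28, []), (30, []), (31, []), (32, []), (33, []), (34, [(32, 1, 1)]), (35, [(33, 1, 1)]), (36, []), (37, []), (38, [(36, 1, 1)]), (39, [(37, 1, 1)]), (40, []), (41, []), (42, [(40, 1, 1)]), (43, [(41, 1, 1)]), (44, []), (45, []), (46, [(44, 1, 1)]), (47, [(45, 1, 1)])]"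

lemma comm_short_ok: "list_all (\<lambda>p. same [(28, 1, 0), (fst p, 0, 1), (28, 1, 0)] ((fst p, 0, 1) # snd p)) comm_short"
  by (simp only: comm_short_def expand_rules) (simp only: same_rules)

text \<open>The exponents are the Cartan integers of the listed roots with respect to alpha2. They
  are even on long roots, which later keeps parameters in K.\<close>

definition torus_short :: "(nat \<times> int) list" where
  "torus_short = [(0, 0), (1, 0), (2, 0), (3, 0), (4, 2), (5, -2), (6, 2), (7, -2), (8, 0), (9, 0), (10, 0), (11, 0), (12, 2), (13, -2), (14, 2), (15, -2), (16, 0), (17, 0), (18, 0), (19, 0), (20, 2), (21, 2), (22, -2), (23, -2), (24, 0), (25, 0), (26, 0), (27, 0), (28, 2), (29, -2), (30, 0), (31, 0), (32, 1), (33, 1), (34, -1), (35, -1), (36, 1), (37, 1), (38, -1), (39, -1), (40, 1), (41, 1), (42, -1), (43, -1), (44, 1), (45, 1), (46, -1), (47, -1)]"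

lemma torus_short_ok: "list_all (\<lambda>p. same
    [(28, 1, 0), (29, -1, 0), (28, 1, 0), (28, 0, 0), (29, 0, 0), (28, 0, 0), (fst p, 0, 1)]
    [(fst p, snd p, 1), (28, 1, 0), (29, -1, 0), (28, 1, 0), (28, 0, 0), (29, 0, 0), (28, 0, 0)]) torus_short"
  by (simp only: torus_short_def expand_rules) (simp only: same_rules)

text \<open>In terms of \<open>n_el\<close>, the root alpha2 and its negative give the same element
  n(1).\<close>

lemma braid_short: "same [(28, 0, 0), (29, 0, 0), (28, 0, 0)] [(29, 0, 0), (28, 0, 0), (29, 0, 0)]"
  by (simp only: same_rules)

definition comm_long :: "(nat \<times> letter list) list" where
  "comm_long = [(0, []), (1, [(5, 1, 1)]), (2, []), (3, [(7, 1, 1)]), (4, [(0, 1, 1)]), (5, []), (6, [(2, 1, 1)]), (7, []), (8, []), (9, []), (10, []), (11, []), (12, []), (13, []), (15, []), (16, []), (17, []), (18, [(22, 1, 1)]), (19, [(23, 1, 1)]), (20, [(16, 1, 1)]), (21, [(17, 1, 1)]), (22, []), (23, []), (24, []), (25, []), (26, []), (27, [(29, 1, 1), (15, 1, 2)]), (28, [(26, 1, 1), (12, 1, 2)]), (29, []), (30, []), (31, []), (32, []), (33, []), (34, []), (35, []), (36, [(34, 1, 1), (8, 1, 2)]), (37, [(35, 1, 1), (9, 1, 2)]), (38, []), (39, []), (40, []), (41, []), (42, []), (43, []), (44, [(42, 1, 1), (10, 1, 2)]), (45, [(43, 1, 1), (11, 1, 2)]), (46, []), (47, [])]"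

lemma comm_long_ok: "list_all (\<lambda>p. same [(13, 1, 0), (fst p, 0, 1), (13, 1, 0)] ((fst p, 0, 1) # snd p)) comm_long"
  by (simp only: comm_long_def expand_rules) (simp only: same_rules)

definition torus_long :: "(nat \<times> int) list" where
  "torus_long = [(0, 1), (1, -1), (2, 1), (3, -1), (4, -1), (5, 1), (6, -1), (7, 1), (8, 0), (9, 0), (10, 0), (11, 0), (12, 0), (13, 2), (14, -2), (15, 0), (16, 1), (17, 1), (18, -1), (19, -1), (20, -1), (21, -1), (22, 1), (23, 1), (24, 0), (25, 0), (26, 1), (27, -1), (28, -1), (29, 1), (30, 0), (31, 0), (32, 0), (33, 0), (34, 1), (35, 1), (36, -1), (37, -1), (38, 0), (39, 0), (40, 0), (41, 0), (42, 1), (43, 1), (44, -1), (45, -1), (46, 0), (47, 0)]"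

lemma torus_long_ok: "list_all (\<lambda>p. same
    [(13, 1, 0), (14, -1, 0), (13, 1, 0), (13, 0, 0), (14, 0, 0), (13, 0, 0), (fst p, 0, 1)]
    [(fst p, snd p, 1), (13, 1, 0), (14, -1, 0), (13, 1, 0), (13, 0, 0), (14, 0, 0), (13, 0, 0)]) torus_long"
  by (simp only: torus_long_def expand_rules) (simp only: same_rules)

lemma braid_long: "same [(13, 0, 0), (14, 0, 0), (13, 0, 0)] [(14, 0, 0), (13, 0, 0), (14, 0, 0)]"
  by (simp only: same_rules)

text \<open>The product n_r(x) n_r(y) is diagonal: every column has a single term, in its own row.
  The scalar is left open.\<close>

definition diag_index :: "nat \<times> nat \<Rightarrow> bool" where
  "diag_index p \<longleftrightarrow> list_all (\<lambda>j. map fst (run [(fst p, 1, 0), (snd p, -1, 0), (fst p, 1, 0),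
     (fst p, 0, 1), (snd p, 0, -1), (fst p, 0, 1)] [(j, 0, 0)]) = [j]) idx52"

lemma diag_index: "list_all diag_index (zip idx48 neg_index)"
  by (simp only: expand_rules) (simp only: diag_index_def idx52_def list.map list.inject run_rules)

text \<open>Row r and column -r of the two sides of the braid relation between u_r(x) and u_-r(y).
  The entries are x^4 y^2 and x^2, so this relation forces x y = 1.\<close>

definition opposite_index :: "nat \<times> nat \<Rightarrow> bool" where
  "opposite_index p \<longleftrightarrow>
     sel_col (run [(fst p, 1, 0), (snd p, 0, 1), (fst p, 1, 0)] [(snd p, 0, 0)]) (fst p) = [(4, 2)] \<and>
     sel_col (run [(snd p, 0, 1), (fst p, 1, 0), (snd p, 0, 1)] [(snd p, 0, 0)]) (fst p) = [(2, 0)]"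

lemma opposite_index: "list_all opposite_index (zip idx48 neg_index)"
  by (simp only: expand_rules) (simp only: opposite_index_def sel_col.simps cons_if.simps list.inject run_rules)

section \<open>Coset representatives of the parabolic subgroup\<close>

definition opp :: "nat \<Rightarrow> nat" where
  "opp n = neg_index ! n"

lemma opp_map: "map opp idx48 = neg_index"
proof -
  have "length neg_index = 48" by (simp add: neg_index_def)
  then show ?thesis using map_nth[of neg_index] by (simp only: idx48 opp_def[abs_def])
qed

lemmas opp_eval = opp_map[unfolded idx48_def neg_index_def list.map list.inject simp_thms]

primrec nword :: "nat list \<Rightarrow> letter list" where
  "nword [] = []"
| "nword (a # ws) = (a, 0, 0) # (opp a, 0, 0) # (a, 0, 0) # nword ws"

text \<open>Words v @ w in the simple reflections, one for each short root; v lies in the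
  parabolic subgroup of J and w is one of five double coset representatives.\<close>
definition reps :: "(nat list \<times> nat list) list" where
  "reps = [([], []), ([], [46]), ([28], [46]), ([13, 28], [46]), ([28, 13, 28], [46]), ([1, 13, 28], [46]), ([1, 28, 13, 28], [46]), ([13, 1, 28, 13, 28], [46]), ([28, 13, 1, 28, 13, 28], [46]), ([], [46, 28, 13, 28, 46]), ([1], [46, 28, 13, 28, 46]), ([13, 1], [46, 28, 13, 28, 46]), ([28, 13, 1], [46, 28, 13, 28, 46]), ([13, 28, 13, 1], [46, 28, 13, 28, 46]), ([1, 13, 28, 13, 1], [46, 28, 13, 28, 46]), ([], [46, 28, 13, 1, 46, 28, 13, 28, 46]), ([28], [46, 28, 13, 1, 46, 28, 13, 28, 46]), ([13], [46, 28, 13, 1, 46, 28, 13, 28, 46]), ([28, 13], [46, 28, 13, 1, 46, 28, 13, 28, 46]), ([1, 13], [46, 28, 13, 1, 46, 28, 13, 28, 46]), ([1, 28, 13], [46, 28, 13, 1, 46, 28, 13, 28, 46]), ([13, 1, 28, 13], [46, 28, 13, 1, 46, 28, 13, 28, 46]), ([28, 13, 1, 28, 13], [46, 28, 13, 1, 46, 28, 13, 28, 46]), ([], [46, 28, 13, 1, 28, 13, 46, 28, 13, 1, 46, 28, 13, 28, 46])]"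

definition rep :: "nat \<Rightarrow> nat list" where
  "rep k = fst (reps ! k) @ snd (reps ! k)"

lemma rep_map: "map rep [0, 1, 2, 3, 4, 5, 6, 7, 8, 9, 10, 11, 12, 13, 14, 15, 16, 17, 18, 19, 20, 21, 22, 23] = map (\<lambda>p. fst p @ snd p) reps"
proof -
  have "[0..<24] = [0, 1, 2, 3, 4, 5, 6, 7, 8, 9, 10, 11, 12, 13, 14, 15, 16, 17, 18, 19, 20, 21, 22, 23]"
    by (simp add: upt_rec)
  moreover have "map rep [0..<length reps] = map (\<lambda>p. fst p @ snd p) reps"
    by (rule nth_equalityI) (simp_all add: rep_def)
  moreover have "length reps = 24" by (simp add: reps_def)
  ultimately show ?thesis by (simp only:)
qed

lemmas rep_eval = rep_map[unfolded reps_def list.map list.inject simp_thms fst_conv snd_conv append.simps]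

text \<open>A step (k, i, k', x) says that the reflection i times word k is word k' times x.\<close>
definition rep_steps :: "(nat \<times> nat \<times> nat \<times> nat list) list" where
  "rep_steps = [(0, 46, 1, []), (0, 28, 0, [28]), (0, 13, 0, [13]), (0, 1, 0, [1]), (1, 46, 0, []), (1, 28, 2, []), (1, 13, 1, [13]), (1, 1, 1, [1]), (2, 46, 2, [28]), (2, 28, 1, []), (2, 13, 3, []), (2, 1, 2, [1]), (3, 46, 3, [28]), (3, 28, 4, []), (3, 13, 2, []), (3, 1, 5, []), (4, 46, 9, []), (4, 28, 3, []), (4, 13, 4, [13]), (4, 1, 6, []), (5, 46, 5, [28]), (5, 28, 6, []), (5, 13, 5, [1]), (5, 1, 3, []), (6, 46, 10, []), (6, 28, 5, []), (6, 13, 7, []), (6, 1, 4, []), (7, 46, 11, []), (7, 28, 8, []), (7, 13, 6, []), (7, 1, 7, [13]), (8, 46, 16, []), (8, 28, 7, []), (8, 13, 8, [1]), (8, 1, 8, [13]), (9, 46, 4, []), (9, 28, 9, [28]), (9, 13, 9, [13]), (9, 1, 10, []), (10, 46, 6, []), (10, 28, 10, [28]), (10, 13, 11, []), (10, 1, 9, []), (11, 46, 7, []), (11, 28, 12, []), (11, 13, 10, []), (11, 1, 11, [13]), (12, 46, 15, []), (12, 28, 11, []), (12, 13, 13, []), (12, 1, 12, [13]), (13, 46, 17, []), (13, 28, 13, [28]), (13, 13, 12, []), (13, 1, 14, []), (14, 46, 19, []), (14, 28, 14, [28]), (14, 13, 14, [13]), (14, 1, 13, []), (15, 46, 12, []),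 (15, 28, 16, []), (15, 13, 17, []), (15, 1, 15, [13]), (16, 46, 8, []), (16, 28, 15, []), (16, 13, 16, [1]), (16, 1, 16, [13]), (17, 46, 13, []), (17, 28, 18, []), (17, 13, 15, []), (17, 1, 19, []), (18, 46, 18, [28]), (18, 28, 17, []), (18, 13, 18, [1]), (18, 1, 20, []), (19, 46, 14, []), (19, 28, 20, []), (19, 13, 19, [13]), (19, 1, 17, []), (20, 46, 20, [28]), (20, 28, 19, []), (20, 13, 21, []), (20, 1, 18, []), (21, 46, 21, [28]), (21, 28, 22, []), (21, 13, 20, []), (21, 1, 21, [1]), (22, 46, 23, []), (22, 28, 21, []), (22, 13, 22, [13]), (22, 1, 22, [1]), (23, 46, 22, []), (23, 28, 23, [28]), (23, 13, 23, [13]), (23, 1, 23, [1])]"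

lemma rep_steps_ok: "list_all (\<lambda>s. same (nword (fst (snd s) # rep (fst s)))
    (nword (rep (fst (snd (snd s))) @ snd (snd (snd s))))) rep_steps"
  by (simp only: rep_steps_def list.pred_inject fst_conv snd_conv simp_thms)
    (simp only: nword.simps rep_eval opp_eval append.simps same_rules)

text \<open>The longest representative is the reflection in e4 as a matrix and not just modulo the
  torus, so the last double coset is that of n_e4 itself.\<close>

lemma rep_last: "same (nword (snd (last reps))) (nword [30])"
  by (simp only: reps_def last.simps list.distinct simp_thms if_False if_True snd_conv nword.simps opp_eval same_rules)

section \<open>Relations between root elements\<close>

lemma mult52 [simp]: "A \<in> M52 \<Longrightarrow> B \<in> M52 \<Longrightarrow> A * B \<in> M52"
  by (rule mult_carrier_mat)

lemma assoc52: "A \<in> M52 \<Longrightarrow> B \<in> M52 \<Longrightarrow> C \<in> M52 \<Longrightarrow> A * B * C = A * (B * C)"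
  by (rule assoc_mult_mat)

lemma one52 [simp]:
  "1\<^sub>m 52 \<in> M52" "A \<in> M52 \<Longrightarrow> 1\<^sub>m 52 * A = A" "A \<in> M52 \<Longrightarrow> A * 1\<^sub>m 52 = A"
  by auto

lemma Phi_nth: "F4_Phi = (!) F4_roots ` {..<48}"
  using arg_cong[OF map_nth[of F4_roots], of set]
  by (simp add: F4_Phi_def atLeast0LessThan del: upt_rec_numeral map_nth)

lemma Phi_cases:
  assumes "r \<in> F4_Phi" obtains n where "n < 48" "r = F4_roots ! n"
  using assms by (auto simp: Phi_nth)

lemma nth_Phi [simp]: "n < 48 \<Longrightarrow> F4_roots ! n \<in> F4_Phi"
  by (simp add: Phi_nth)

lemma roots_simple:
  "alpha1 = F4_roots ! 46" "alpha2 = F4_roots ! 28" "alpha3 = F4_roots ! 13" "alpha4 = F4_roots ! 1" "e4 = F4_roots ! 30"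
  by (simp_all only: alpha1_def alpha2_def alpha3_def alpha4_def e4_def roots_nth)

lemma simple_Phi: "a \<in> set simple_roots \<Longrightarrow> a \<in> F4_Phi"
  by (auto simp: simple_roots_def roots_simple)

lemma e4_Phi [simp]: "e4 \<in> F4_Phi"
  by (simp add: roots_simple)

lemma rneg_rneg [simp]: "rneg (rneg r) = r"
  by (cases r) (simp add: rneg_def)

lemma opp_nth: "n < 48 \<Longrightarrow> rneg (F4_roots ! n) = F4_roots ! opp n" and opp_less: "n < 48 \<Longrightarrow> opp n < 48"
proof -
  assume n: "n < 48"
  have len: "length neg_index = 48" by (simp add: neg_index_def)
  have "map (\<lambda>n. rneg (F4_roots ! n)) idx48 ! n = map ((!) F4_roots) neg_index ! n"
    by (simp only: neg_index)
  then show "rneg (F4_roots ! n) = F4_roots ! opp n"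
    using n len by (simp add: idx48 opp_def del: upt_rec_numeral)
  have "list_all (\<lambda>x. x < 48) neg_index" by (simp add: neg_index_def)
  then show "opp n < 48" using n len by (simp add: opp_def list_all_length)
qed

lemma rneg_Phi [simp]: "r \<in> F4_Phi \<Longrightarrow> rneg r \<in> F4_Phi"
  by (metis Phi_cases opp_nth opp_less nth_Phi)

text \<open>Congruence of the doubled coordinates modulo 2 makes reflections linear despite
  the integer division in their definition.\<close>
definition even_tuple :: "root4 \<Rightarrow> bool" where
  "even_tuple r = (case r of (a, b, c, d) \<Rightarrow> even (a - b) \<and> even (b - c) \<and> even (c - d))"

lemma even_tuple_Phi: "r \<in> F4_Phi \<Longrightarrow> even_tuple r"
proof -
  have "list_all even_tuple F4_roots" by (simp add: F4_roots_def even_tuple_def)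
  then show "r \<in> F4_Phi \<Longrightarrow> even_tuple r" by (simp add: F4_Phi_def list_all_iff)
qed

lemma even_tuple_radd: "even_tuple r \<Longrightarrow> even_tuple s \<Longrightarrow> even_tuple (radd r s)"
  by (cases r; cases s) (auto simp: even_tuple_def radd_def)

lemma even_tuple_rscale: "even_tuple r \<Longrightarrow> even_tuple (rscale n r)"
  by (cases r) (auto simp: even_tuple_def rscale_def right_diff_distrib[symmetric])

lemma ip_radd [simp]: "ip (radd r s) q = ip r q + ip s q" "ip q (radd r s) = ip q r + ip q s"
  by (cases r; cases s; cases q; simp add: ip_def radd_def algebra_simps)+

lemma ip_rscale [simp]: "ip (rscale n r) q = n * ip r q" "ip q (rscale n r) = n * ip q r"
  by (cases r; cases q; simp add: ip_def rscale_def algebra_simps)+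

lemma ip_commute: "ip r s = ip s r"
  by (cases r; cases s) (simp add: ip_def algebra_simps)

lemma rneg_rscale: "rneg r = rscale (-1) r"
  by (cases r) (simp add: rneg_def rscale_def)

lemma long_ip: "F4_long r \<longleftrightarrow> ip r r = 8"
  by (cases r) (simp add: F4_long_def ip_def)

definition refl_roots :: "root4 set" where
  "refl_roots = insert e4 (set simple_roots)"

lemma refl_rootsE:
  assumes "a \<in> refl_roots"
  obtains "a = e4" | "a = alpha1" | "a = alpha2" | "a = alpha3" | "a = alpha4"
  using assms by (auto simp: refl_roots_def simple_roots_def)

lemma refl_roots_Phi: "a \<in> refl_roots \<Longrightarrow> a \<in> F4_Phi"
  by (auto simp: refl_roots_def simple_Phi)

lemma refl_coeff:
  assumes "a \<in> refl_roots" "even_tuple r"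
  shows "2 * ip r a = ((2 * ip r a) div ip a a) * ip a a" "ip a a \<noteq> 0"
proof -
  obtain x y z w where r: "r = (x, y, z, w)" by (cases r)
  have ev: "even (x - y)" "even (y - z)" "even (z - w)"
    using assms(2) by (auto simp: r even_tuple_def)
  \<comment> \<open>This parity serves alpha1, whose product with r is w - (x + y + z).\<close>
  have ev': "even (w - (x + y + z))" using ev by auto
  have "ip a a dvd 2 * ip r a \<and> ip a a \<noteq> 0"
    using assms(1)
    by (rule refl_rootsE) (use ev ev' in \<open>auto simp: r ip_def e4_def alpha1_def alpha2_def alpha3_def alpha4_def elim!: dvdE\<close>, presburger+)
  then show "2 * ip r a = ((2 * ip r a) div ip a a) * ip a a" "ip a a \<noteq> 0"
    by auto
qed

lemma refl_unique:
  assumes "ip a a \<noteq> 0" "2 * ip r a = k * ip a a"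
  shows "refl a r = radd r (rscale (- k) a)"
  using assms by (simp add: refl_def)

lemma refl_obtain:
  assumes "a \<in> refl_roots" "even_tuple r"
  obtains k where "2 * ip r a = k * ip a a" "refl a r = radd r (rscale (- k) a)"
  using refl_coeff[OF assms] by (metis refl_def)

lemma tuple_simps:
  "radd (a, b, c, d) (a', b', c', d') = (a + a', b + b', c + c', d + d')"
  "rscale n (a, b, c, d) = (n * a, n * b, n * c, n * d)"
  by (simp_all add: radd_def rscale_def)

lemma refl_radd:
  assumes "a \<in> refl_roots" "even_tuple r" "even_tuple s"
  shows "refl a (radd r s) = radd (refl a r) (refl a s)"
proof -
  obtain k where k: "2 * ip r a = k * ip a a" "refl a r = radd r (rscale (- k) a)"
    using refl_obtain[OF assms(1,2)] by blast
  obtain l where l: "2 * ip s a = l * ip a a" "refl a s = radd s (rscale (- l) a)"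
    using refl_obtain[OF assms(1,3)] by blast
  have "refl a (radd r s) = radd (radd r s) (rscale (- (k + l)) a)"
    using k(1) l(1) refl_coeff(2)[OF assms(1,2)] by (intro refl_unique) (simp_all add: algebra_simps)
  then show ?thesis
    unfolding k(2) l(2) by (cases r; cases s; cases a) (simp add: tuple_simps algebra_simps)
qed

lemma refl_rscale:
  assumes "a \<in> refl_roots" "even_tuple r"
  shows "refl a (rscale n r) = rscale n (refl a r)"
proof -
  obtain k where k: "2 * ip r a = k * ip a a" "refl a r = radd r (rscale (- k) a)"
    using refl_obtain[OF assms] by blast
  have "refl a (rscale n r) = radd (rscale n r) (rscale (- (n * k)) a)"
    using k(1) refl_coeff(2)[OF assms] by (intro refl_unique) (simp_all add: algebra_simps)
  then show ?thesis
    unfolding k(2) by (cases r; cases a) (simp add: tuple_simps algebra_simps)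
qed

lemma refl_rneg: "a \<in> refl_roots \<Longrightarrow> even_tuple r \<Longrightarrow> refl a (rneg r) = rneg (refl a r)"
  by (simp add: rneg_rscale refl_rscale)

lemma ip_refl:
  assumes "a \<in> refl_roots" "even_tuple r" "even_tuple s"
  shows "ip (refl a r) (refl a s) = ip r s"
proof -
  obtain k where k: "2 * ip r a = k * ip a a" "refl a r = radd r (rscale (- k) a)"
    using refl_obtain[OF assms(1,2)] by blast
  obtain l where l: "2 * ip s a = l * ip a a" "refl a s = radd s (rscale (- l) a)"
    using refl_obtain[OF assms(1,3)] by blast
  have "2 * ip (refl a r) (refl a s) =
      2 * ip r s - l * (2 * ip r a) - k * (2 * ip s a) + 2 * (k * l * ip a a)"
    unfolding k(2) l(2) by (simp add: algebra_simps ip_commute[of a s])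
  also have "\<dots> = 2 * ip r s" unfolding k(1) l(1) by (simp add: algebra_simps)
  finally show ?thesis by simp
qed

lemma refl_refl:
  assumes "a \<in> refl_roots" "even_tuple r"
  shows "refl a (refl a r) = r"
proof -
  obtain k where k: "2 * ip r a = k * ip a a" "refl a r = radd r (rscale (- k) a)"
    using refl_obtain[OF assms] by blast
  have "refl a (refl a r) = radd (refl a r) (rscale (- (- k)) a)"
    using k refl_coeff(2)[OF assms] by (intro refl_unique) (simp_all add: algebra_simps)
  then show ?thesis unfolding k(2) by (cases r; cases a) (simp add: tuple_simps)
qed

lemma even_tuple_refl:
  assumes "a \<in> refl_roots" "even_tuple r" shows "even_tuple (refl a r)"
  by (rule refl_obtain[OF assms]) (simp add: assms even_tuple_radd even_tuple_rscale even_tuple_Phi refl_roots_Phi)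

lemma long_refl: "a \<in> refl_roots \<Longrightarrow> even_tuple r \<Longrightarrow> F4_long (refl a r) = F4_long r"
  by (simp add: long_ip ip_refl)

lemma comm_list_refl:
  assumes "a \<in> refl_roots" "even_tuple r" "even_tuple s"
  shows "comm_list (refl a r) (refl a s) = map (\<lambda>(q, ij). (refl a q, ij)) (comm_list r s)"
  using assms by (simp add: comm_list_def long_refl ip_refl refl_radd refl_rscale even_tuple_rscale)

text \<open>Every root is reached from the simple roots alpha2 (short) and alpha3 (long); a triple
  (a, n, m) says that the reflection in root a takes root n to root m.\<close>
definition root_chain :: "(nat \<times> nat \<times> nat) list" where
  "root_chain = [(1, 19, 11), (46, 47, 31), (13, 23, 19), (1, 16, 8), (28, 45, 47), (46, 32, 30), (28, 21, 23), (13, 20, 16), (13, 43, 45), (28, 34, 32), (13, 17, 21), (28, 22, 20), (1, 39, 43), (13, 36, 34), (13, 7, 3), (1, 9, 17), (13, 18, 22), (1, 37, 41), (28, 37, 39), (1, 40, 36), (13, 6, 2), (1, 15, 7), (46, 15, 9), (13, 4, 0), (1, 10, 18), (1, 27, 25), (13, 35, 37), (1, 42, 38), (28, 42, 40), (46, 46, 33), (13, 5, 1), (1, 14, 6), (28, 14, 15), (1, 12, 4), (46, 12, 10), (1, 26, 24), (13, 29, 27), (46, 29, 35), (13, 44, 42), (28, 44, 46), (1, 13, 5), (13, 13, 14), (28, 13, 12), (13, 28, 26), (28, 28, 29), (46, 28, 44)]"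

text \<open>The list is read from its end: the source of a step is a base root or the target of a
  step further down the list.\<close>

primrec chain_ok :: "(nat \<times> nat \<times> nat) list \<Rightarrow> bool" where
  "chain_ok [] \<longleftrightarrow> True"
| "chain_ok (s # ss) \<longleftrightarrow> fst (snd s) \<in> {28, 13} \<union> (snd \<circ> snd) ` set ss \<and> fst s \<in> {46, 28, 13, 1} \<and>
     refl (F4_roots ! fst s) (F4_roots ! fst (snd s)) = F4_roots ! snd (snd s) \<and>
     fst (snd s) < 48 \<and> chain_ok ss"

lemma chain_ok: "chain_ok root_chain"
  unfolding root_chain_def by (simp add: roots_nth[simplified] refl_def ip_def radd_def rscale_def)

text \<open>The Weyl group has one orbit on the short roots and one on the long roots. In the
  induction step of the relations below, the known relation is conjugated by \<open>nn a\<close>,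
  and \<open>nn a\<close> is then cancelled.\<close>

lemma root_induct [consumes 1, case_names short long refl]:
  assumes r: "r \<in> F4_Phi" and base: "P alpha2" "P alpha3"
    and step: "\<And>a r. a \<in> set simple_roots \<Longrightarrow> r \<in> F4_Phi \<Longrightarrow> P r \<Longrightarrow> P (refl a r)"
  shows "P r"
proof -
  have ind: "P (F4_roots ! n)" if "chain_ok ss" "n \<in> {28, 13} \<union> (snd \<circ> snd) ` set ss" for ss n
    using that
  proof (induction ss arbitrary: n)
    case Nil
    then show ?case using base by (auto simp: roots_simple)
  next
    case (Cons s ss)
    show ?case
    proof (cases "n = snd (snd s)")
      case True
      have "P (refl (F4_roots ! fst s) (F4_roots ! fst (snd s)))"
        using Cons by (intro step) (auto simp: simple_roots_def roots_simple)
      then show ?thesis using Cons.prems True by simp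
    next
      case False
      then show ?thesis using Cons by auto
    qed
  qed
  have "list_all (\<lambda>n. n \<in> {28, 13} \<union> (snd \<circ> snd) ` set root_chain) idx48"
    by (simp add: idx48_def root_chain_def)
  then have "n \<in> {28, 13} \<union> (snd \<circ> snd) ` set root_chain" if "n < 48" for n
    using that by (simp add: list_all_iff idx48)
  then show ?thesis using ind[OF chain_ok] r by (auto elim!: Phi_cases)
qed

definition prodl :: "'a::field mat list \<Rightarrow> 'a mat" where
  "prodl As = foldr (*) As (1\<^sub>m 52)"

lemma prodl_simps [simp]: "prodl [] = 1\<^sub>m 52" "prodl (A # As) = A * prodl As"
  by (simp_all add: prodl_def)

lemma prodl_carrier [simp]: "set As \<subseteq> M52 \<Longrightarrow> prodl As \<in> M52"
  by (induction As) auto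

lemma n_el_carrier [simp]: "n_el r t \<in> M52"
  by (simp add: n_el_def)

lemma word_nth: "word x y ws = prodl (map (\<lambda>w. u_el (F4_roots ! fst w) (x powi fst (snd w) * y powi snd (snd w))) ws)"
  by (induction ws) (simp_all add: mval_def)

lemma u_el_0 [simp]:
  assumes "r \<in> F4_Phi" shows "u_el r (0 :: 'a::field) = 1\<^sub>m 52"
proof (rule eq_matI)
  obtain n where n: "n < 48" "r = F4_roots ! n" using assms by (rule Phi_cases)
  fix i j assume "i < dim_row (1\<^sub>m 52)" "j < dim_col (1\<^sub>m 52)"
  then have ij: "i < 52" "j < 52" by auto
  have z: "(\<Sum>e\<leftarrow>C. if fst e = i then 0 powi snd e else 0) = (0::'a)" if "set C \<subseteq> set (ucol n j)" for C
    using that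
  proof (induction C)
    case (Cons e C)
    then have "snd e = 1 \<or> snd e = 2" using ucolD(5)[of "fst e" "snd e" n j] by auto
    then show ?case using Cons by auto
  qed simp
  show "u_el r (0 :: 'a) $$ (i, j) = 1\<^sub>m 52 $$ (i, j)"
    unfolding n(2) u_entry[OF n(1) ij] z[OF subset_refl] using ij by simp
qed auto

locale char2 =
  fixes ty :: "'a::field itself"
  assumes char2: "CHAR('a) = 2"
begin

abbreviation u :: "root4 \<Rightarrow> 'a \<Rightarrow> 'a mat" where
  "u \<equiv> u_el"

abbreviation nn :: "root4 \<Rightarrow> 'a mat" where
  "nn r \<equiv> n_el r 1"

lemma add_self [simp]: "x + x = (0::'a)"
  by (rule char2_add_self[OF char2])

lemma two_eq_0 [simp]: "(2::'a) = 0"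
  by (metis add_self one_add_one)

lemma minus_eq [simp]: "- x = (x::'a)"
  by (rule eq_of_add_eq_0[OF char2]) simp

lemma add_self_left [simp]: "x + (x + y) = (y::'a)"
  by (simp add: add.assoc[symmetric])

lemma add_eq_0: "a + b = 0 \<longleftrightarrow> a = (b::'a)"
  using eq_of_add_eq_0[OF char2] by auto

lemma u_add:
  assumes "r \<in> F4_Phi" shows "u r t * u r s = u r (t + s)"
\<comment> \<open>Words are evaluated at nonzero parameters only, so zero is treated apart. The same
  split recurs in the relations below.\<close>
proof (cases "t = 0 \<or> s = 0")
  case True
  then show ?thesis using assms by auto
next
  case False
  obtain n where n: "n < 48" "r = F4_roots ! n" using assms by (rule Phi_cases)
  show ?thesis
  proof (rule eq_matI)
    fix i j assume "i < dim_row (u r (t + s))" "j < dim_col (u r (t + s))"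
    then have ij: "i < 52" "j < 52" by auto
    let ?e = "\<lambda>ws. colv (map (mval t s) (run ws [(j, 0, 0)])) i"
    have "additive_index n" using additive_index n by (simp add: list_all_iff idx48)
    then have "togs (run [(n, 1, 0), (n, 0, 1)] [(j, 0, 0)])
       (togs (run [(n, 1, 0)] [(j, 0, 0)]) (togs (run [(n, 0, 1)] [(j, 0, 0)]) [(j, 0, 0)])) = []"
      using ij by (simp only: additive_index_def list_all_iff idx52) auto
    from arg_cong[OF this, of "\<lambda>V. colv (map (mval t s) V) i"]
    have "?e [(n, 1, 0), (n, 0, 1)] + (?e [(n, 1, 0)] + (?e [(n, 0, 1)] + colv (map (mval t s) [(j, 0, 0)]) i)) = 0"
      unfolding colv_togs[OF char2] by simp
    then have "word t s [(n, 1, 0), (n, 0, 1)] $$ (i, j) + (word t s [(n, 1, 0)] $$ (i, j) +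
        (word t s [(n, 0, 1)] $$ (i, j) + (if i = j then 1 else 0))) = 0"
      using False n ij by (subst (1 2 3) word_entry[OF char2]) (auto simp: mval_def)
    then have main: "(u r t * u r s) $$ (i, j) = u r t $$ (i, j) + (u r s $$ (i, j) + (if i = j then 1 else 0))"
      by (simp add: n word_nth add_eq_0)
    have z: "(\<Sum>e\<leftarrow>C. if fst e = i then (t + s) powi snd e else 0) =
        (\<Sum>e\<leftarrow>C. if fst e = i then t powi snd e else 0) + (\<Sum>e\<leftarrow>C. if fst e = i then s powi snd e else 0)"
      if "set C \<subseteq> set (ucol n j)" for C
      using that
    proof (induction C)
      case (Cons e C)
      then have "snd e = 1 \<or> snd e = 2" using ucolD(5)[of "fst e" "snd e" n j] by auto
      moreover have "(t + s)\<^sup>2 = t\<^sup>2 + s\<^sup>2"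
        by (simp add: power2_sum)
      ultimately show ?case using Cons by (auto simp: algebra_simps)
    qed simp
    show "(u r t * u r s) $$ (i, j) = u r (t + s) $$ (i, j)"
      unfolding main unfolding n(2) u_entry[OF n(1) ij] z[OF subset_refl] by (simp add: add_ac)
  qed auto
qed

lemma u_sq [simp]: "r \<in> F4_Phi \<Longrightarrow> u r t * u r t = 1\<^sub>m 52"
  by (simp add: u_add)

lemma u_cancel [simp]: "r \<in> F4_Phi \<Longrightarrow> A \<in> M52 \<Longrightarrow> u r t * (u r t * A) = A"
  by (simp add: assoc52[symmetric])

lemma n_sq [simp]: "r \<in> F4_Phi \<Longrightarrow> n_el r t * n_el r t = 1\<^sub>m 52" for t :: 'a
  by (simp add: n_el_def assoc52)

lemma n_cancel [simp]: "r \<in> F4_Phi \<Longrightarrow> A \<in> M52 \<Longrightarrow> n_el r t * (n_el r t * A) = A" for t :: 'a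
  by (simp add: assoc52[symmetric])

lemma nn_index:
  assumes ok: "refl_ok a (opp a)" and a: "a < 48" and n: "n < 48"
    and map: "map (\<lambda>n. refl (F4_roots ! a) (F4_roots ! n)) idx48 = map ((!) F4_roots) (refl_index a)"
    and lt: "list_all (\<lambda>n. n < 48) (refl_index a)"
  shows "nn (F4_roots ! a) * u (F4_roots ! n) t = u (refl (F4_roots ! a) (F4_roots ! n)) t * nn (F4_roots ! a)"
    and "refl (F4_roots ! a) (F4_roots ! n) \<in> F4_Phi"
proof -
  define m where "m = refl_index a ! n"
  have len: "length (refl_index a) = 48"
    using arg_cong[OF map, of length] by (simp add: idx48 del: upt_rec_numeral)
  have m: "m < 48" using lt n len by (simp add: m_def list_all_length)
  have "map (\<lambda>n. refl (F4_roots ! a) (F4_roots ! n)) idx48 ! n = map ((!) F4_roots) (refl_index a) ! n"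
    by (simp only: map)
  then have refl: "refl (F4_roots ! a) (F4_roots ! n) = F4_roots ! m"
    using n len by (simp add: idx48 m_def del: upt_rec_numeral)
  then show "refl (F4_roots ! a) (F4_roots ! n) \<in> F4_Phi" using m by simp
  show "nn (F4_roots ! a) * u (F4_roots ! n) t = u (refl (F4_roots ! a) (F4_roots ! n)) t * nn (F4_roots ! a)"
  proof (cases "t = 0")
    case True
    then show ?thesis using n a m by (simp add: refl)
  next
    case False
    have "(n, m) \<in> set (zip idx48 (refl_index a))"
      using n len by (auto simp: set_zip idx48 m_def simp del: upt_rec_numeral intro!: exI[of _ n])
    then have "same [(a, 0, 0), (opp a, 0, 0), (a, 0, 0), (n, 1, 0)] [(m, 1, 0), (a, 0, 0), (opp a, 0, 0), (a, 0, 0)]"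
      using ok by (auto simp: refl_ok_def list_all_iff)
    from same_sound[OF this _ _ char2 False, of 1] n a m opp_less[of a]
    have "word t 1 [(a, 0, 0), (opp a, 0, 0), (a, 0, 0), (n, 1, 0)] = word t 1 [(m, 1, 0), (a, 0, 0), (opp a, 0, 0), (a, 0, 0)]"
      by simp
    then show ?thesis using a by (simp add: word_nth n_el_def opp_nth assoc52 refl)
  qed
qed

lemma
  assumes "a \<in> refl_roots" "r \<in> F4_Phi"
  shows nn_u: "nn a * u r t = u (refl a r) t * nn a" and refl_Phi: "refl a r \<in> F4_Phi"
proof -
  have opp: "opp 46 = 33" "opp 28 = 29" "opp 13 = 14" "opp 1 = 2" "opp 30 = 31"
    by (simp_all only: opp_eval)
  obtain b where b: "a = F4_roots ! b" "b \<in> {46, 28, 13, 1, 30}"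
    using assms(1) by (auto simp: refl_roots_def simple_roots_def roots_simple)
  have ok: "refl_ok b (opp b)"
    using b(2) by (auto simp only: insert_iff empty_iff opp refl_ok_46 refl_ok_28 refl_ok_13 refl_ok_1 refl_ok_30)
  have map: "list_all (\<lambda>b. map (\<lambda>n. refl (F4_roots ! b) (F4_roots ! n)) idx48 = map ((!) F4_roots) (refl_index b)) [46, 28, 13, 1, 30]"
    by (simp only: refl_index_def expand_rules list.map roots_nth)
      (simp add: refl_def ip_def radd_def rscale_def)
  have lt: "list_all (\<lambda>b. list_all (\<lambda>n. n < 48) (refl_index b)) [46, 28, 13, 1, 30]"
    by (simp add: refl_index_def)
  obtain n where n: "n < 48" "r = F4_roots ! n" using assms(2) by (rule Phi_cases)
  have "b < 48" using b(2) by auto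
  note * = nn_index[OF ok this n(1)]
  show "nn a * u r t = u (refl a r) t * nn a" "refl a r \<in> F4_Phi"
    unfolding b(1) n(2) by (rule *; use map lt b(2) in \<open>auto simp: list_all_iff\<close>)+
qed

lemma nn_n:
  fixes t :: 'a
  assumes "a \<in> refl_roots" "r \<in> F4_Phi"
  shows "nn a * n_el r t = n_el (refl a r) t * nn a"
proof -
  have "nn a * (u s t * A) = u (refl a s) t * (nn a * A)" if "s \<in> F4_Phi" "A \<in> M52" for s t A
    using that nn_u[OF assms(1) that(1)] by (simp add: assoc52[symmetric])
  then show ?thesis
    using assms nn_u[OF assms(1)] refl_rneg[OF assms(1) even_tuple_Phi[OF assms(2)]]
    by (simp add: n_el_def assoc52)
qed

lemma nn_swap: "a \<in> refl_roots \<Longrightarrow> r \<in> F4_Phi \<Longrightarrow> A \<in> M52 \<Longrightarrow> nn a * (u r t * A) = u (refl a r) t * (nn a * A)"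
  using nn_u[of a r t] by (simp add: assoc52[symmetric])

lemma nn_n_swap: "a \<in> refl_roots \<Longrightarrow> r \<in> F4_Phi \<Longrightarrow> A \<in> M52 \<Longrightarrow> nn a * (n_el r t * A) = n_el (refl a r) t * (nn a * A)" for t :: 'a
  using nn_n[of a r t] by (simp add: assoc52[symmetric])

lemma nn_cancel_left:
  assumes "a \<in> refl_roots" "A \<in> M52" "B \<in> M52" "nn a * A = nn a * B"
  shows "A = B"
proof -
  have "A = nn a * (nn a * A)" using assms(1,2) refl_roots_Phi by simp
  also have "\<dots> = B" unfolding assms(4) using assms(1,3) refl_roots_Phi by simp
  finally show ?thesis .
qed

lemma nn_cancel_right:
  assumes "a \<in> refl_roots" "A \<in> M52" "B \<in> M52" "A * nn a = B * nn a"
  shows "A = B"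
proof -
  have "A = A * nn a * nn a" using assms(1,2) refl_roots_Phi by (simp add: assoc52)
  also have "\<dots> = B" unfolding assms(4) using assms(1,3) refl_roots_Phi by (simp add: assoc52)
  finally show ?thesis .
qed

lemma simple_refl: "a \<in> set simple_roots \<Longrightarrow> a \<in> refl_roots"
  by (simp add: refl_roots_def)

end

lemma comm_list_pos:
  "(q, i, j) \<in> set (comm_list r s) \<Longrightarrow> 0 < i \<and> 0 < j \<and> q = radd (rscale (int i) r) (rscale (int j) s)"
  by (cases r; cases s) (auto simp: comm_list_def tuple_simps split: if_splits)

context char2
begin

definition comm_word :: "root4 \<Rightarrow> root4 \<Rightarrow> 'a \<Rightarrow> 'a \<Rightarrow> 'a mat" where
  "comm_word r s t x = prodl (map (\<lambda>(q, i, j). u q (t ^ i * x ^ j)) (comm_list r s))"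

text \<open>Root elements are involutions, so the left side is the conjugate of u_s(x) by u_r(t),
  the form that normality proofs ask for.\<close>

definition comm_ok :: "root4 \<Rightarrow> root4 \<Rightarrow> bool" where
  "comm_ok r s \<longleftrightarrow> fst ` set (comm_list r s) \<subseteq> F4_Phi \<and>
     (\<forall>t x. u r t * (u s x * u r t) = u s x * comm_word r s t x)"

lemma comm_word_carrier [simp]: "comm_word r s t x \<in> M52"
  unfolding comm_word_def by (rule prodl_carrier) auto

lemma prodl_one: "(\<And>A. A \<in> set As \<Longrightarrow> A = 1\<^sub>m 52) \<Longrightarrow> prodl As = (1\<^sub>m 52 :: 'a mat)"
proof (induction As)
  case (Cons A As)
  have "A = 1\<^sub>m 52" "prodl As = 1\<^sub>m 52" using Cons by simp_all
  then show ?case by simp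
qed simp

lemma comm_index:
  assumes ok: "list_all (\<lambda>p. same [(a, 1, 0), (fst p, 0, 1), (a, 1, 0)] ((fst p, 0, 1) # snd p)) data"
    and data: "list_all (\<lambda>p. list_all (\<lambda>w. fst w < 48 \<and> 0 \<le> fst (snd w) \<and> 0 \<le> snd (snd w)) (snd p) \<and>
      comm_list (F4_roots ! a) (F4_roots ! fst p) =
        map (\<lambda>w. (F4_roots ! fst w, nat (fst (snd w)), nat (snd (snd w)))) (snd p)) data"
    and cover: "map fst data = filter (\<lambda>n. n \<noteq> opp a) idx48" and a: "a < 48"
    and s: "s \<in> F4_Phi" "s \<noteq> rneg (F4_roots ! a)"
  shows "comm_ok (F4_roots ! a) s"
proof -
  obtain n where n: "n < 48" "s = F4_roots ! n" using s(1) by (rule Phi_cases)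
  have "n \<in> set (map fst data)"
    using n s(2) a unfolding cover by (auto simp: idx48 opp_nth simp del: upt_rec_numeral)
  then obtain ws where ws: "(n, ws) \<in> set data" by auto
  have same: "same [(a, 1, 0), (n, 0, 1), (a, 1, 0)] ((n, 0, 1) # ws)"
    using bspec[OF ok[unfolded list_all_iff] ws] by (simp only: fst_conv snd_conv)
  have D: "list_all (\<lambda>w. fst w < 48 \<and> 0 \<le> fst (snd w) \<and> 0 \<le> snd (snd w)) ws \<and>
      comm_list (F4_roots ! a) (F4_roots ! n) = map (\<lambda>w. (F4_roots ! fst w, nat (fst (snd w)), nat (snd (snd w)))) ws"
    using bspec[OF data[unfolded list_all_iff] ws] unfolding list_all_iff fst_conv snd_conv .
  have w: "fst w < 48" "0 \<le> fst (snd w)" "0 \<le> snd (snd w)" if "w \<in> set ws" for w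
    using D that by (simp_all add: list_all_iff)
  have cl: "comm_list (F4_roots ! a) s = map (\<lambda>w. (F4_roots ! fst w, nat (fst (snd w)), nat (snd (snd w)))) ws"
    using D n by simp
  have sub: "fst ` set (comm_list (F4_roots ! a) s) \<subseteq> F4_Phi"
    unfolding cl using w(1) by auto
  moreover have "u (F4_roots ! a) t * (u s x * u (F4_roots ! a) t) = u s x * comm_word (F4_roots ! a) s t x" for t x
  proof (cases "t = 0 \<or> x = 0")
    case True
    have "comm_word (F4_roots ! a) s t x = 1\<^sub>m 52"
      unfolding comm_word_def
    proof (rule prodl_one)
      fix A assume "A \<in> set (map (\<lambda>(q, i, j). u q (t ^ i * x ^ j)) (comm_list (F4_roots ! a) s))"
      then obtain q i j where q: "(q, i, j) \<in> set (comm_list (F4_roots ! a) s)" "A = u q (t ^ i * x ^ j)" by auto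
      moreover have "q \<in> F4_Phi" using q(1) sub by force
      moreover have "t ^ i * x ^ j = 0" using comm_list_pos[OF q(1)] True by (auto simp: zero_power)
      ultimately show "A = 1\<^sub>m 52" by simp
    qed
    then show ?thesis using True a s(1) by auto
  next
    case False
    have "word t x [(a, 1, 0), (n, 0, 1), (a, 1, 0)] = word t x ((n, 0, 1) # ws)"
      using same_sound[OF same _ _ char2, of t x] False n a w(1) by (simp add: list_all_iff)
    moreover have "comm_word (F4_roots ! a) s t x = word t x ws"
      unfolding comm_word_def cl word_nth map_map o_def
      using w by (intro arg_cong[of _ _ prodl]) (auto simp: power_int_def)
    ultimately show ?thesis using n by (simp add: word_nth)
  qed
  ultimately show ?thesis by (simp add: comm_ok_def)
qed

lemma nn_prodl:
  assumes "a \<in> refl_roots" "fst ` set xs \<subseteq> F4_Phi"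
  shows "nn a * prodl (map (\<lambda>(q, i, j). u q (f i j)) xs) = prodl (map (\<lambda>(q, i, j). u (refl a q) (f i j)) xs) * nn a"
  using assms(2)
proof (induction xs)
  case (Cons x xs)
  obtain q i j where x: "x = (q, i, j)" by (cases x)
  have c: "prodl (map (\<lambda>(q, i, j). u (g q) (f i j)) xs) \<in> M52" for g
    by (rule prodl_carrier) auto
  show ?case
    using Cons x c[of id] c[of "refl a"] assms(1) by (simp add: nn_swap assoc52)
qed simp

lemma opp_values: "opp 28 = 29" "opp 13 = 14"
  by (simp_all only: opp_eval)

lemma comm_ok: "r \<in> F4_Phi \<Longrightarrow> s \<in> F4_Phi \<Longrightarrow> s \<noteq> rneg r \<Longrightarrow> comm_ok r s"
proof (induction r arbitrary: s rule: root_induct)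
  case short
  have data: "list_all (\<lambda>p. list_all (\<lambda>w. fst w < 48 \<and> 0 \<le> fst (snd w) \<and> 0 \<le> snd (snd w)) (snd p) \<and>
      comm_list (F4_roots ! 28) (F4_roots ! fst p) =
        map (\<lambda>w. (F4_roots ! fst w, nat (fst (snd w)), nat (snd (snd w)))) (snd p)) comm_short"
    by (simp only: comm_short_def list.pred_inject fst_conv snd_conv list.map roots_nth)
      (simp add: comm_list_def F4_long_def ip_def radd_def rscale_def)
  have cover: "map fst comm_short = filter (\<lambda>n. n \<noteq> opp 28) idx48"
    by (simp add: comm_short_def idx48_def opp_values)
  show ?case
    using short unfolding roots_simple by (intro comm_index[OF comm_short_ok data cover]) simp_all
next
  case long
  have data: "list_all (\<lambda>p. list_all (\<lambda>w. fst w < 48 \<and> 0 \<le> fst (snd w) \<and> 0 \<le> snd (snd w)) (snd p) \<and>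
      comm_list (F4_roots ! 13) (F4_roots ! fst p) =
        map (\<lambda>w. (F4_roots ! fst w, nat (fst (snd w)), nat (snd (snd w)))) (snd p)) comm_long"
    by (simp only: comm_long_def list.pred_inject fst_conv snd_conv list.map roots_nth)
      (simp add: comm_list_def F4_long_def ip_def radd_def rscale_def)
  have cover: "map fst comm_long = filter (\<lambda>n. n \<noteq> opp 13) idx48"
    by (simp add: comm_long_def idx48_def opp_values)
  show ?case
    using long unfolding roots_simple by (intro comm_index[OF comm_long_ok data cover]) simp_all
next
  case (refl a r)
  have a: "a \<in> refl_roots" using refl by (simp add: simple_refl)
  have ev: "even_tuple r" "even_tuple s" using refl even_tuple_Phi by auto
  \<comment> \<open>Conjugation by \<open>nn a\<close> takes the relation between r and s' to the
    wanted one between \<open>refl a r\<close> and s.\<close>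
  define s' where "s' = refl a s"
  have s': "s' \<in> F4_Phi" "refl a s' = s" "even_tuple s'"
    using refl a ev by (simp_all add: s'_def refl_Phi refl_refl even_tuple_refl)
  have "s' \<noteq> rneg r"
    using refl.prems(2) s'(2) refl_rneg[OF a ev(1)] by auto
  then have ok: "comm_ok r s'" using refl.IH s'(1) by simp
  have cl: "comm_list (refl a r) s = map (\<lambda>(q, ij). (refl a q, ij)) (comm_list r s')"
    using comm_list_refl[OF a ev(1) s'(3)] s'(2) by simp
  have sub: "fst ` set (comm_list r s') \<subseteq> F4_Phi" using ok by (simp add: comm_ok_def)
  have "u (refl a r) t * (u s x * u (refl a r) t) = u s x * comm_word (refl a r) s t x" for t x
  proof -
    have "nn a * comm_word r s' t x = comm_word (refl a r) s t x * nn a"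
      unfolding comm_word_def cl using nn_prodl[OF a sub, of "\<lambda>i j. t ^ i * x ^ j"]
      by (simp add: o_def case_prod_unfold)
    note main = this
    have "(u (refl a r) t * (u s x * u (refl a r) t)) * nn a = nn a * (u r t * (u s' x * u r t))"
      by (simp add: nn_swap[OF a] nn_u[OF a] refl.hyps(2) s'(1,2) assoc52)
    also have "u r t * (u s' x * u r t) = u s' x * comm_word r s' t x"
      using ok by (simp add: comm_ok_def)
    also have "nn a * \<dots> = (u s x * comm_word (refl a r) s t x) * nn a"
      by (simp add: nn_swap[OF a] s'(1,2) main assoc52)
    finally show ?thesis by (rule nn_cancel_right[OF a, rotated 2]) simp_all
  qed
  moreover have "fst ` set (comm_list (refl a r) s) \<subseteq> F4_Phi"
    unfolding cl using sub refl_Phi[OF a] by fastforce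
  ultimately show ?case by (simp add: comm_ok_def)
qed

definition torus_el :: "root4 \<Rightarrow> 'a \<Rightarrow> 'a mat" where
  "torus_el r t = n_el r t * nn r"

lemma torus_el_carrier [simp]: "torus_el r t \<in> M52"
  by (simp add: torus_el_def)

text \<open>The parity condition covers the critical case: t in L belongs to a short root r and acts
  on a long root s, whose parameters must stay in K. Even powers of t lie in K.\<close>

definition torus_ok :: "root4 \<Rightarrow> root4 \<Rightarrow> bool" where
  "torus_ok r s \<longleftrightarrow> (\<exists>m::int. (\<not> F4_long r \<and> F4_long s \<longrightarrow> even m) \<and>
     (\<forall>t x. t \<noteq> 0 \<longrightarrow> torus_el r t * u s x = u s (t powi m * x) * torus_el r t))"

lemma torus_index:
  assumes ok: "list_all (\<lambda>p. same [(a, 1, 0), (opp a, -1, 0), (a, 1, 0), (a, 0, 0), (opp a, 0, 0), (a, 0, 0), (fst p, 0, 1)]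
      [(fst p, snd p, 1), (a, 1, 0), (opp a, -1, 0), (a, 1, 0), (a, 0, 0), (opp a, 0, 0), (a, 0, 0)]) data"
    and data: "list_all (\<lambda>p. \<not> F4_long (F4_roots ! a) \<and> F4_long (F4_roots ! fst p) \<longrightarrow> even (snd p)) data"
    and cover: "map fst data = idx48" and a: "a < 48" and s: "s \<in> F4_Phi"
  shows "torus_ok (F4_roots ! a) s"
proof -
  obtain n where n: "n < 48" "s = F4_roots ! n" using s by (rule Phi_cases)
  have "n \<in> set (map fst data)" using n unfolding cover by (simp add: idx48 del: upt_rec_numeral)
  then obtain m where m: "(n, m) \<in> set data" by auto
  have "torus_el (F4_roots ! a) t * u s x = u s (t powi m * x) * torus_el (F4_roots ! a) t" if t: "t \<noteq> 0" for t x
  proof (cases "x = 0")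
    case False
    have "same [(a, 1, 0), (opp a, -1, 0), (a, 1, 0), (a, 0, 0), (opp a, 0, 0), (a, 0, 0), (n, 0, 1)]
      [(n, m, 1), (a, 1, 0), (opp a, -1, 0), (a, 1, 0), (a, 0, 0), (opp a, 0, 0), (a, 0, 0)]"
      using bspec[OF ok[unfolded list_all_iff] m] by (simp only: fst_conv snd_conv)
    from same_sound[OF this _ _ char2 t False] show ?thesis
      using n a opp_less[of a] by (simp add: word_nth torus_el_def n_el_def opp_nth assoc52 power_int_minus)
  qed (use s in simp)
  moreover have "\<not> F4_long (F4_roots ! a) \<and> F4_long s \<longrightarrow> even m"
    using data m n by (auto simp: list_all_iff)
  ultimately show ?thesis unfolding torus_ok_def by blast
qed

lemma torus_ok: "r \<in> F4_Phi \<Longrightarrow> s \<in> F4_Phi \<Longrightarrow> torus_ok r s"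
proof (induction r arbitrary: s rule: root_induct)
  case short
  have data: "list_all (\<lambda>p. \<not> F4_long (F4_roots ! 28) \<and> F4_long (F4_roots ! fst p) \<longrightarrow> even (snd p)) torus_short"
    by (simp only: torus_short_def list.pred_inject fst_conv snd_conv roots_nth) (simp add: F4_long_def)
  have cover: "map fst torus_short = idx48"
    by (simp add: torus_short_def idx48_def)
  show ?case
    using short unfolding roots_simple
    by (intro torus_index[where a = 28, unfolded opp_values, OF torus_short_ok data cover]) simp_all
next
  case long
  have data: "list_all (\<lambda>p. \<not> F4_long (F4_roots ! 13) \<and> F4_long (F4_roots ! fst p) \<longrightarrow> even (snd p)) torus_long"
    by (simp only: torus_long_def list.pred_inject fst_conv snd_conv roots_nth) (simp add: F4_long_def)
  have cover: "map fst torus_long = idx48"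
    by (simp add: torus_long_def idx48_def)
  show ?case
    using long unfolding roots_simple
    by (intro torus_index[where a = 13, unfolded opp_values, OF torus_long_ok data cover]) simp_all
next
  case (refl a r)
  have a: "a \<in> refl_roots" using refl by (simp add: simple_refl)
  define s' where "s' = refl a s"
  have s': "s' \<in> F4_Phi" "refl a s' = s" "F4_long s' = F4_long s"
    using refl a even_tuple_Phi by (simp_all add: s'_def refl_Phi refl_refl long_refl)
  have lr: "F4_long (refl a r) = F4_long r" using refl a even_tuple_Phi by (simp add: long_refl)
  obtain m where m: "\<not> F4_long r \<and> F4_long s' \<longrightarrow> even m"
    "\<And>t x. t \<noteq> 0 \<Longrightarrow> torus_el r t * u s' x = u s' (t powi m * x) * torus_el r t"
    using refl.IH[OF s'(1)] unfolding torus_ok_def by blast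
  have "torus_el (refl a r) t * u s x = u s (t powi m * x) * torus_el (refl a r) t" if "t \<noteq> 0" for t x
  proof -
    have "(torus_el (refl a r) t * u s x) * nn a = nn a * (torus_el r t * u s' x)"
      by (simp add: torus_el_def nn_n_swap[OF a] nn_u[OF a] refl.hyps(2) s'(1,2) assoc52)
    also have "torus_el r t * u s' x = u s' (t powi m * x) * torus_el r t"
      by (rule m(2)[OF that])
    also have "nn a * \<dots> = (u s (t powi m * x) * torus_el (refl a r) t) * nn a"
      by (simp add: torus_el_def nn_swap[OF a] nn_n_swap[OF a] nn_n[OF a] refl.hyps(2) s'(1,2) assoc52)
    finally show ?thesis by (rule nn_cancel_right[OF a, rotated 2]) simp_all
  qed
  then show ?case using m(1) lr s'(3) unfolding torus_ok_def by blast
qed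

lemma nn_rneg: "r \<in> F4_Phi \<Longrightarrow> nn (rneg r) = nn r"
proof (induction r rule: root_induct)
  case short
  from same_sound[OF braid_short _ _ char2, of 1 1] show ?case
    unfolding n_el_def rneg_rneg roots_simple by (simp add: word_nth opp_nth opp_values assoc52)
next
  case long
  from same_sound[OF braid_long _ _ char2, of 1 1] show ?case
    unfolding n_el_def rneg_rneg roots_simple by (simp add: word_nth opp_nth opp_values assoc52)
next
  case (refl a r)
  have a: "a \<in> refl_roots" using refl by (simp add: simple_refl)
  have "nn (rneg (refl a r)) * nn a = nn a * nn (rneg r)"
    by (simp add: nn_n[OF a] refl.hyps(2) refl_rneg[OF a even_tuple_Phi[OF refl.hyps(2)]])
  also have "\<dots> = nn (refl a r) * nn a"
    by (simp add: nn_n[OF a] refl.hyps(2) refl.IH)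
  finally show ?case by (rule nn_cancel_right[OF a, rotated 2]) simp_all
qed

lemma torus_diag:
  fixes t t' :: 'a
  assumes "r \<in> F4_Phi" "t \<noteq> 0" "t' \<noteq> 0" "i < 52" "j < 52" "i \<noteq> j"
  shows "(n_el r t * n_el r t') $$ (i, j) = 0"
proof -
  obtain n where n: "n < 48" "r = F4_roots ! n" using assms(1) by (rule Phi_cases)
  have len: "length neg_index = 48" by (simp add: neg_index_def)
  have "(n, opp n) \<in> set (zip idx48 neg_index)"
    using n len by (auto simp: set_zip idx48 opp_def simp del: upt_rec_numeral intro!: exI[of _ n])
  then have "diag_index (n, opp n)" using diag_index by (auto simp: list_all_iff)
  then have run: "map fst (run [(n, 1, 0), (opp n, -1, 0), (n, 1, 0), (n, 0, 1), (opp n, 0, -1), (n, 0, 1)] [(j, 0, 0)]) = [j]"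
    using assms(5) by (auto simp: diag_index_def list_all_iff idx52 simp del: run.simps)
  have el: "n_el r t * n_el r t' = word t t' [(n, 1, 0), (opp n, -1, 0), (n, 1, 0), (n, 0, 1), (opp n, 0, -1), (n, 0, 1)]"
    using n by (simp add: word_nth n_el_def opp_nth assoc52 power_int_minus)
  have zero: "colv (map (mval t t') V) i = 0" if "map fst V = [j]" for V
    using that assms(6) by (auto simp: mval_def)
  show ?thesis
    unfolding el
    by (subst word_entry[OF char2 assms(2,3) _ assms(5,4)]) (use n opp_less[of n] zero[OF run] in \<open>auto simp del: run.simps\<close>)
qed

lemma colv_sel_col:
  "colv (map (mval x y) V) i = (\<Sum>e\<leftarrow>sel_col V i. x powi fst e * y powi snd e)" for x :: 'a
proof (induction V)
  case (Cons e V)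
  then show ?case by (cases "fst e = i") (auto simp: mval_def)
qed simp

lemma opposite_params:
  assumes "r \<in> F4_Phi" "x \<noteq> 0" "y \<noteq> 0"
    and eq: "u r x * (u (rneg r) y * u r x) = u (rneg r) y * (u r x * u (rneg r) y)"
  shows "x * y = 1"
proof -
  obtain n where n: "n < 48" "r = F4_roots ! n" using assms(1) by (rule Phi_cases)
  have len: "length neg_index = 48" by (simp add: neg_index_def)
  have "(n, opp n) \<in> set (zip idx48 neg_index)"
    using n len by (auto simp: set_zip idx48 opp_def simp del: upt_rec_numeral intro!: exI[of _ n])
  then have "opposite_index (n, opp n)" using opposite_index by (auto simp: list_all_iff)
  then have sel: "sel_col (run [(n, 1, 0), (opp n, 0, 1), (n, 1, 0)] [(opp n, 0, 0)]) n = [(4, 2)]"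
    "sel_col (run [(opp n, 0, 1), (n, 1, 0), (opp n, 0, 1)] [(opp n, 0, 0)]) n = [(2, 0)]"
    by (simp_all add: opposite_index_def del: run.simps)
  have "word x y [(n, 1, 0), (opp n, 0, 1), (n, 1, 0)] = word x y [(opp n, 0, 1), (n, 1, 0), (opp n, 0, 1)]"
    using eq n by (simp add: word_nth opp_nth)
  then have "colv (map (mval x y) (run [(n, 1, 0), (opp n, 0, 1), (n, 1, 0)] [(opp n, 0, 0)])) n =
      colv (map (mval x y) (run [(opp n, 0, 1), (n, 1, 0), (opp n, 0, 1)] [(opp n, 0, 0)])) n"
    using n opp_less[of n] by (subst (1 2) word_entry[OF char2 assms(2,3), symmetric]) auto
  then have "x powi 4 * y powi 2 = x powi 2"
    unfolding colv_sel_col sel by simp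
  then have "x ^ 4 * y ^ 2 = x ^ 2" by (simp add: power_int_def)
  then have "x ^ 2 * ((x * y) ^ 2) = x ^ 2 * 1" by (simp add: power_mult_distrib algebra_simps flip: power_add)
  then have "(x * y) ^ 2 = 1" using assms(2) by (subst (asm) mult_cancel_left) auto
  \<comment> \<open>In characteristic 2 the square of x y + 1 is (x y)^2 + 1, so 1 has no other
    square root than itself.\<close>
  then have "(x * y + 1) ^ 2 = 0" by (simp add: power2_sum)
  then show ?thesis by (simp add: add_eq_0)
qed

section \<open>Words in the simple reflections as matrices\<close>

definition nprod :: "nat list \<Rightarrow> 'a mat" where
  "nprod ws = prodl (map (\<lambda>a. nn (F4_roots ! a)) ws)"

lemma nprod_simps [simp]: "nprod [] = 1\<^sub>m 52" "nprod (a # ws) = nn (F4_roots ! a) * nprod ws"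
  by (simp_all add: nprod_def)

lemma nprod_carrier [simp]: "nprod ws \<in> M52"
  unfolding nprod_def by (rule prodl_carrier) auto

lemma nprod_append: "nprod (ws @ ws') = nprod ws * nprod ws'"
  by (induction ws) (simp_all add: assoc52)

lemma word_nword: "list_all (\<lambda>a. a < 48) ws \<Longrightarrow> word 1 1 (nword ws) = nprod ws"
  by (induction ws) (simp_all add: mval_def n_el_def opp_nth assoc52)

lemma nword_bound: "list_all (\<lambda>a. a < 48) ws \<Longrightarrow> list_all (\<lambda>w. fst w < 48) (nword ws)"
  by (induction ws) (simp_all add: opp_less)

lemma nprod_same:
  assumes "same (nword ws) (nword ws')" "list_all (\<lambda>a. a < 48) ws" "list_all (\<lambda>a. a < 48) ws'"
  shows "nprod ws = nprod ws'"
  using same_sound[OF assms(1) nword_bound nword_bound char2, of 1 1] assms(2,3) by (simp add: word_nword)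

lemma rep_last': "nprod (snd (last reps)) = nn e4"
proof -
  have "nprod (snd (last reps)) = nprod [30]"
    by (rule nprod_same[OF rep_last]) (simp_all add: reps_def)
  then show ?thesis by (simp add: roots_simple)
qed

lemma rep_simple: "k < 24 \<Longrightarrow> set (rep k) \<subseteq> {46, 28, 13, 1}"
proof -
  have "list_all (\<lambda>p. set (fst p @ snd p) \<subseteq> {46, 28, 13, 1}) reps" "length reps = 24"
    by (simp_all add: reps_def)
  then show "k < 24 \<Longrightarrow> set (rep k) \<subseteq> {46, 28, 13, 1}"
    by (simp add: rep_def list_all_length)
qed

lemma rep_step:
  assumes "k < 24" "i \<in> {46, 28, 13, 1}"
  obtains k' ws where "k' < 24" "set ws \<subseteq> {28, 13, 1}" "nn (F4_roots ! i) * nprod (rep k) = nprod (rep k') * nprod ws"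
proof -
  \<comment> \<open>The table lists every pair of a representative and a simple reflection, so there
    is a step for k and i.\<close>
  have "map (\<lambda>s. (fst s, fst (snd s))) rep_steps = List.product [0,1,2,3,4,5,6,7,8,9,10,11,12,13,14,15,16,17,18,19,20,21,22,23] [46, 28, 13, 1]"
    by (simp add: rep_steps_def)
  moreover have "(k, i) \<in> set (List.product [0,1,2,3,4,5,6,7,8,9,10,11,12,13,14,15,16,17,18,19,20,21,22,23] [46, 28, 13, 1])"
  proof -
    have "[0,1,2,3,4,5,6,7,8,9,10,11,12,13,14,15,16,17,18,19,20,21,22,23] = [0..<24]" by (simp add: upt_rec)
    then show ?thesis using assms by (simp only: set_product) auto
  qed
  ultimately have "(k, i) \<in> (\<lambda>s. (fst s, fst (snd s))) ` set rep_steps"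
    by (metis set_map)
  then obtain k' ws where s: "(k, i, k', ws) \<in> set rep_steps" by auto
  have "list_all (\<lambda>s. fst (snd (snd s)) < 24 \<and> set (snd (snd (snd s))) \<subseteq> {28, 13, 1}) rep_steps"
    by (simp add: rep_steps_def)
  then have "fst (snd (snd s)) < 24 \<and> set (snd (snd (snd s))) \<subseteq> {28, 13, 1}" if "s \<in> set rep_steps" for s
    using that by (simp only: list_all_iff)
  from this[OF s] have k': "k' < 24" "set ws \<subseteq> {28, 13, 1}" by simp_all
  have "same (nword (i # rep k)) (nword (rep k' @ ws))"
    using rep_steps_ok s by (force simp: list_all_iff)
  then have "nprod (i # rep k) = nprod (rep k' @ ws)"
    using assms(2) rep_simple[OF assms(1)] rep_simple[OF k'(1)] k'(2)
    by (intro nprod_same) (auto simp: list_all_iff)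
  then show ?thesis using that k' by (simp add: nprod_append)
qed

text \<open>The letters act from the front, so this is the inverse of the Weyl element of the word.
  It is what a root undergoes when its root element is moved to the right past
  \<open>nprod ws\<close>.\<close>

primrec word_inv :: "nat list \<Rightarrow> root4 \<Rightarrow> root4" where
  "word_inv [] r = r"
| "word_inv (a # ws) r = word_inv ws (refl (F4_roots ! a) r)"

abbreviation simple_word :: "nat list \<Rightarrow> bool" where
  "simple_word ws \<equiv> set ws \<subseteq> {46, 28, 13, 1}"

lemma index_refl: "a \<in> {46, 28, 13, 1} \<Longrightarrow> F4_roots ! a \<in> refl_roots"
  by (auto simp: refl_roots_def simple_roots_def roots_simple)

lemma word_inv_Phi: "simple_word ws \<Longrightarrow> r \<in> F4_Phi \<Longrightarrow> word_inv ws r \<in> F4_Phi"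
proof (induction ws arbitrary: r)
  case (Cons a ws)
  have a: "F4_roots ! a \<in> refl_roots" using Cons.prems by (intro index_refl) auto
  show ?case using Cons refl_Phi[OF a] by simp
qed simp

lemma word_inv_ip:
  "simple_word ws \<Longrightarrow> r \<in> F4_Phi \<Longrightarrow> s \<in> F4_Phi \<Longrightarrow> ip (word_inv ws r) (word_inv ws s) = ip r s"
proof (induction ws arbitrary: r s)
  case (Cons a ws)
  have a: "F4_roots ! a \<in> refl_roots" using Cons.prems by (intro index_refl) auto
  show ?case
    using Cons a even_tuple_Phi by (simp add: refl_Phi ip_refl)
qed simp

lemma word_inv_long: "simple_word ws \<Longrightarrow> r \<in> F4_Phi \<Longrightarrow> F4_long (word_inv ws r) = F4_long r"
  by (simp add: long_ip word_inv_ip)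

lemma word_inv_rneg: "simple_word ws \<Longrightarrow> r \<in> F4_Phi \<Longrightarrow> word_inv ws (rneg r) = rneg (word_inv ws r)"
proof (induction ws arbitrary: r)
  case (Cons a ws)
  have a: "F4_roots ! a \<in> refl_roots" using Cons.prems by (intro index_refl) auto
  show ?case using Cons a even_tuple_Phi by (simp add: refl_Phi refl_rneg)
qed simp

lemma u_nprod: "simple_word ws \<Longrightarrow> r \<in> F4_Phi \<Longrightarrow> u r t * nprod ws = nprod ws * u (word_inv ws r) t"
proof (induction ws arbitrary: r)
  case (Cons a ws)
  let ?a = "F4_roots ! a"
  have a: "?a \<in> refl_roots" using Cons.prems by (intro index_refl) auto
  have "u r t * nn ?a = nn ?a * u (refl ?a r) t"
    using nn_u[OF a refl_Phi[OF a], of r t] refl_refl[OF a even_tuple_Phi] Cons.prems by simp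
  then have "u r t * (nn ?a * nprod ws) = nn ?a * (u (refl ?a r) t * nprod ws)"
    by (simp add: assoc52[symmetric])
  also have "u (refl ?a r) t * nprod ws = nprod ws * u (word_inv (a # ws) r) t"
    using Cons a by (simp add: refl_Phi)
  finally show ?case by (simp add: assoc52)
qed simp

lemma n_nprod: "simple_word ws \<Longrightarrow> r \<in> F4_Phi \<Longrightarrow> n_el r t * nprod ws = nprod ws * n_el (word_inv ws r) t" for t :: 'a
proof -
  assume ws: "simple_word ws" and r: "r \<in> F4_Phi"
  have "u s x * (nprod ws * A) = nprod ws * (u (word_inv ws s) x * A)" if "s \<in> F4_Phi" "A \<in> M52" for s x A
    using u_nprod[OF ws that(1)] that(2) by (simp add: assoc52[symmetric])
  then show ?thesis
    using ws r by (simp add: n_el_def assoc52 u_nprod word_inv_rneg)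
qed

end

section \<open>Groups of invertible matrices\<close>

definition GL52 :: "'a::field mat set" where
  "GL52 = {A \<in> M52. \<exists>B\<in>M52. A * B = 1\<^sub>m 52 \<and> B * A = 1\<^sub>m 52}"

definition ginv :: "'a::field mat \<Rightarrow> 'a mat" where
  "ginv A = (SOME B. B \<in> M52 \<and> A * B = 1\<^sub>m 52 \<and> B * A = 1\<^sub>m 52)"

lemma GL_M [simp]: "A \<in> GL52 \<Longrightarrow> A \<in> M52"
  by (simp add: GL52_def)

lemma ginv_props: "A \<in> GL52 \<Longrightarrow> ginv A \<in> M52 \<and> A * ginv A = 1\<^sub>m 52 \<and> ginv A * A = 1\<^sub>m 52"
  unfolding ginv_def by (rule someI_ex) (unfold GL52_def, blast)

lemma ginv_simps [simp]:
  assumes "A \<in> GL52" shows "ginv A \<in> M52" "A * ginv A = 1\<^sub>m 52" "ginv A * A = 1\<^sub>m 52"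
  using ginv_props[OF assms] by simp_all

lemma ginv_GL [simp]: "A \<in> GL52 \<Longrightarrow> ginv A \<in> GL52"
  using ginv_props[of A] GL_M[of A] unfolding GL52_def by blast

lemma ginv_cancel [simp]:
  assumes "A \<in> GL52" "X \<in> M52" shows "A * (ginv A * X) = X" "ginv A * (A * X) = X"
  using assms by (simp_all add: assoc52[symmetric])

lemma ginv_unique:
  assumes "A \<in> M52" "B \<in> M52" "A * B = 1\<^sub>m 52"
  shows "A \<in> GL52" "B \<in> GL52" "ginv A = B" "ginv B = A"
proof -
  have BA: "B * A = 1\<^sub>m 52" by (rule mat_mult_left_right_inverse[OF assms])
  then show GL: "A \<in> GL52" "B \<in> GL52" using assms unfolding GL52_def by blast+
  have "ginv A * (A * B) = ginv A" unfolding assms(3) using GL by simp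
  then show "ginv A = B" using GL assms(2) by simp
  have "ginv B * (B * A) = ginv B" unfolding BA using GL by simp
  then show "ginv B = A" using GL assms(1) by simp
qed

lemma GL_mult [simp]:
  assumes "A \<in> GL52" "B \<in> GL52" shows "A * B \<in> GL52" "ginv (A * B) = ginv B * ginv A"
proof -
  have "A * B * (ginv B * ginv A) = 1\<^sub>m 52" using assms by (simp add: assoc52)
  then show "A * B \<in> GL52" "ginv (A * B) = ginv B * ginv A"
    using ginv_unique[of "A * B" "ginv B * ginv A"] assms by simp_all
qed

lemma GL_one [simp]: "1\<^sub>m 52 \<in> GL52" "ginv (1\<^sub>m 52) = 1\<^sub>m 52"
  by (rule ginv_unique[of "1\<^sub>m 52" "1\<^sub>m 52"]; simp)+

lemma ginv_ginv [simp]: "A \<in> GL52 \<Longrightarrow> ginv (ginv A) = A"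
  by (rule ginv_unique(4)[of A]) simp_all

lemma GL_cancel_left: "A \<in> GL52 \<Longrightarrow> X \<in> M52 \<Longrightarrow> Y \<in> M52 \<Longrightarrow> A * X = A * Y \<Longrightarrow> X = Y"
  by (metis ginv_cancel(2))

lemma grp_gen_GL:
  assumes "S \<subseteq> GL52" shows "grp_gen S \<subseteq> GL52"
proof
  fix A assume "A \<in> grp_gen S"
  then show "A \<in> GL52"
  proof induction
    case (gen_inv A B)
    then show ?case using ginv_unique(2)[of A B] by simp
  qed (use assms in auto)
qed

lemma grp_gen_ginv: "S \<subseteq> GL52 \<Longrightarrow> A \<in> grp_gen S \<Longrightarrow> ginv A \<in> grp_gen S"
  using subsetD[OF grp_gen_GL[of S], of A] by (intro grp_gen.gen_inv[of A S "ginv A"]) simp_all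

lemma grp_gen_least:
  assumes "S \<subseteq> grp_gen T" shows "grp_gen S \<subseteq> grp_gen T"
proof
  fix A assume "A \<in> grp_gen S"
  then show "A \<in> grp_gen T"
    by induction (use assms in \<open>auto intro: grp_gen.intros\<close>)
qed

lemma grp_gen_mono: "S \<subseteq> T \<Longrightarrow> grp_gen S \<subseteq> grp_gen T"
  by (rule grp_gen_least) (auto intro: grp_gen.gen_incl)

lemma grp_gen_conj:
  assumes y: "y \<in> GL52" and S: "S \<subseteq> GL52" and gen: "\<And>A. A \<in> S \<Longrightarrow> y * A * ginv y \<in> grp_gen T"
    and A: "A \<in> grp_gen S"
  shows "y * A * ginv y \<in> grp_gen T"
  using A
proof induction
  case gen_one
  then show ?case using y by (simp add: grp_gen.gen_one)
next
  case (gen_mult A B)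
  have "A \<in> GL52" "B \<in> GL52" using gen_mult grp_gen_GL[OF S] by auto
  then have "y * (A * B) * ginv y = (y * A * ginv y) * (y * B * ginv y)"
    using y by (simp add: assoc52)
  then show ?case using gen_mult by (simp add: grp_gen.gen_mult)
next
  case (gen_inv A B)
  have "A \<in> GL52" using gen_inv grp_gen_GL[OF S] by auto
  moreover have "A * (B * ginv y) = ginv y"
    using gen_inv y calculation by (simp add: assoc52[symmetric])
  ultimately have "(y * A * ginv y) * (y * B * ginv y) = 1\<^sub>m 52"
    using gen_inv y by (simp add: assoc52)
  then show ?case using gen_inv y by (intro grp_gen.gen_inv[OF gen_inv.IH]) simp_all
qed (rule gen)

text \<open>The induction shows that left multiplication by A and by its inverse both preserve P.
  This condition is symmetric in A and its inverse and therefore passes through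
  \<open>gen_inv\<close> as well as \<open>gen_mult\<close>.\<close>

lemma grp_gen_induct_left [consumes 3, case_names one mult]:
  assumes S: "S \<subseteq> GL52" and inv: "\<forall>A\<in>S. ginv A \<in> S" and A: "A \<in> grp_gen S"
    and one: "P (1\<^sub>m 52)" and step: "\<And>A B. A \<in> S \<Longrightarrow> B \<in> grp_gen S \<Longrightarrow> P B \<Longrightarrow> P (A * B)"
  shows "P A"
proof -
  note GL = subsetD[OF grp_gen_GL[OF S]]
  have "\<forall>B\<in>grp_gen S. P B \<longrightarrow> P (A * B) \<and> P (ginv A * B)"
    using A
  proof induction
    case gen_one
    then show ?case using GL by auto
  next
    case (gen_incl A)
    then show ?case using step inv by auto
  next
    case (gen_mult A B)
    show ?case
    proof (intro ballI impI)
      fix C assume C: "C \<in> grp_gen S" "P C"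
      have "A * B * C = A * (B * C)" "ginv (A * B) * C = ginv B * (ginv A * C)"
        using gen_mult GL C by (simp_all add: assoc52)
      moreover have "B * C \<in> grp_gen S" "ginv A * C \<in> grp_gen S"
        using gen_mult C grp_gen_ginv[OF S] by (auto intro: grp_gen.gen_mult)
      ultimately show "P (A * B * C) \<and> P (ginv (A * B) * C)"
        using gen_mult.IH C by auto
    qed
  next
    case (gen_inv A B)
    have "B = ginv A" "ginv B = A"
      using ginv_unique[of A B] gen_inv GL by auto
    then show ?case using gen_inv.IH by simp
  qed
  then show ?thesis using one A GL grp_gen.gen_one by fastforce
qed

lemma prodl_grp_gen: "set As \<subseteq> grp_gen S \<Longrightarrow> prodl As \<in> grp_gen S"
  by (induction As) (auto intro: grp_gen.gen_one grp_gen.gen_mult)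

section \<open>Heights and levels\<close>

text \<open>The doubled e4-coordinate: 2 on the seven roots of Z, 1 on the other roots of U_J, 0 on
  Phi_J.\<close>

definition level :: "root4 \<Rightarrow> int" where
  "level r = (case r of (a, b, c, d) \<Rightarrow> d)"

text \<open>Twice the height with respect to the simple roots.\<close>
definition height :: "root4 \<Rightarrow> int" where
  "height r = (case r of (a, b, c, d) \<Rightarrow> 3 * a + 2 * b + c + 8 * d)"

lemma level_simps [simp]:
  "level (radd r s) = level r + level s" "level (rscale n r) = n * level r" "level (rneg r) = - level r"
  by (cases r; cases s; simp add: level_def radd_def rscale_def rneg_def)+

lemma height_simps [simp]:
  "height (radd r s) = height r + height s" "height (rscale n r) = n * height r" "height (rneg r) = - height r"
  by (cases r; cases s; simp add: height_def radd_def rscale_def rneg_def algebra_simps)+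

lemma level_bound: "r \<in> F4_Phi \<Longrightarrow> level r \<le> 2 \<and> (0 < height r \<longrightarrow> 0 \<le> level r)"
proof -
  have "list_all (\<lambda>r. level r \<le> 2 \<and> (0 < height r \<longrightarrow> 0 \<le> level r)) F4_roots"
    by (simp add: F4_roots_def level_def height_def)
  then show "r \<in> F4_Phi \<Longrightarrow> level r \<le> 2 \<and> (0 < height r \<longrightarrow> 0 \<le> level r)"
    unfolding F4_Phi_def list_all_iff by blast
qed

lemma simple_height: "a \<in> set simple_roots \<Longrightarrow> 0 < height a"
  by (auto simp: simple_roots_def height_def alpha1_def alpha2_def alpha3_def alpha4_def)

lemma refl_height:
  assumes "a \<in> set simple_roots" "r \<in> F4_Phi" "0 < height r" "r \<noteq> a"
  shows "0 < height (refl a r)" "refl a r \<noteq> a"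
proof -
  have "list_all (\<lambda>r. 0 < height r \<and> r \<noteq> alpha1 \<longrightarrow> 0 < height (refl alpha1 r) \<and> refl alpha1 r \<noteq> alpha1) F4_roots"
    by (simp add: F4_roots_def height_def refl_def ip_def radd_def rscale_def alpha1_def)
  moreover have "list_all (\<lambda>r. 0 < height r \<and> r \<noteq> alpha2 \<longrightarrow> 0 < height (refl alpha2 r) \<and> refl alpha2 r \<noteq> alpha2) F4_roots"
    by (simp add: F4_roots_def height_def refl_def ip_def radd_def rscale_def alpha2_def)
  moreover have "list_all (\<lambda>r. 0 < height r \<and> r \<noteq> alpha3 \<longrightarrow> 0 < height (refl alpha3 r) \<and> refl alpha3 r \<noteq> alpha3) F4_roots"
    by (simp add: F4_roots_def height_def refl_def ip_def radd_def rscale_def alpha3_def)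
  moreover have "list_all (\<lambda>r. 0 < height r \<and> r \<noteq> alpha4 \<longrightarrow> 0 < height (refl alpha4 r) \<and> refl alpha4 r \<noteq> alpha4) F4_roots"
    by (simp add: F4_roots_def height_def refl_def ip_def radd_def rscale_def alpha4_def)
  ultimately have "\<forall>a\<in>set simple_roots. \<forall>r\<in>F4_Phi. 0 < height r \<and> r \<noteq> a \<longrightarrow> 0 < height (refl a r) \<and> refl a r \<noteq> a"
    unfolding F4_Phi_def list_all_iff simple_roots_def by simp
  then show "0 < height (refl a r)" "refl a r \<noteq> a"
    using assms by blast+
qed

lemma refl_self: "a \<in> refl_roots \<Longrightarrow> refl a a = rneg a"
  by (cases a) (auto simp: refl_def radd_def rscale_def rneg_def ip_def elim!: refl_rootsE simp: e4_def alpha1_def alpha2_def alpha3_def alpha4_def)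

lemma pos_not_PhiJ: "F4_pos r \<and> \<not> in_PhiJ r \<longleftrightarrow> r \<in> F4_Phi \<and> 0 < level r"
proof
  assume "F4_pos r \<and> \<not> in_PhiJ r"
  then show "r \<in> F4_Phi \<and> 0 < level r"
    by (auto simp: F4_pos_def in_PhiJ_def level_def tuple_simps alpha1_def alpha2_def alpha3_def alpha4_def)
next
  assume r: "r \<in> F4_Phi \<and> 0 < level r"
  obtain a b c d where abcd: "r = (a, b, c, d)" by (cases r)
  \<comment> \<open>The coefficients solve the triangular system that expresses r by simple roots: d
    determines that of alpha1, then a that of alpha4, b that of alpha3 and c that of alpha2.\<close>
  let ?f = "\<lambda>a b c d. 0 \<le> d \<and> 0 \<le> (a + b + c + 3 * d) div 2 \<and> 0 \<le> (a + b + 2 * d) div 2 \<and> 0 \<le> (a + d) div 2 \<and>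
    (a, b, c, d) = radd (rscale d alpha1) (radd (rscale ((a + b + c + 3 * d) div 2) alpha2)
      (radd (rscale ((a + b + 2 * d) div 2) alpha3) (rscale ((a + d) div 2) alpha4)))"
  have "list_all (\<lambda>(a, b, c, d). 0 < d \<longrightarrow> ?f a b c d) F4_roots"
    by (simp add: F4_roots_def tuple_simps alpha1_def alpha2_def alpha3_def alpha4_def)
  then have "?f a b c d"
    using r abcd by (auto simp: F4_Phi_def list_all_iff level_def)
  then have "F4_pos r" using r abcd unfolding F4_pos_def by blast
  then show "F4_pos r \<and> \<not> in_PhiJ r" using r abcd by (auto simp: in_PhiJ_def level_def)
qed

lemma sigma_root_Phi: "r \<in> F4_Phi \<Longrightarrow> sigma_root r \<in> F4_Phi"
proof -
  have "list_all (\<lambda>r. sigma_root r \<in> set F4_roots) F4_roots"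
    by (simp add: F4_roots_def sigma_root_def)
  then show "r \<in> F4_Phi \<Longrightarrow> sigma_root r \<in> F4_Phi" by (simp only: F4_Phi_def list_all_iff)
qed

lemma level_sigma_root [simp]: "level (sigma_root r) = level r"
  by (cases r) (simp add: level_def sigma_root_def)

text \<open>The negative of \<open>w_e4 r\<close> is \<open>sigma_root r\<close>, which has the same
  level as r. So w_e4 makes every root of U_J negative, and the group for u' involves all of
  them.\<close>

lemma w_e4_roots: "{r. F4_pos r \<and> \<not> in_PhiJ r \<and> F4_neg (w_e4 r)} = {r \<in> F4_Phi. 0 < level r}"
proof -
  have "rneg (w_e4 r) = sigma_root r" for r
    by (cases r) (simp add: rneg_def w_e4_def sigma_root_def)
  then have "F4_neg (w_e4 r)" if "r \<in> F4_Phi" "0 < level r" for r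
    using pos_not_PhiJ[of "sigma_root r"] that sigma_root_Phi by (simp add: F4_neg_def)
  then show ?thesis using pos_not_PhiJ by blast
qed

lemma root_length: "r \<in> F4_Phi \<Longrightarrow> ip r r = 4 \<or> ip r r = 8"
proof -
  have "list_all (\<lambda>r. ip r r = 4 \<or> ip r r = 8) F4_roots" by (simp add: F4_roots_def ip_def)
  then show "r \<in> F4_Phi \<Longrightarrow> ip r r = 4 \<or> ip r r = 8" unfolding F4_Phi_def list_all_iff by blast
qed

section \<open>The mixed group and its parabolic subgroup\<close>

lemma subfield_power: "is_subfield F \<Longrightarrow> x \<in> F \<Longrightarrow> x ^ n \<in> F"
  by (induction n) (simp_all add: is_subfield_def)

lemma subfield_powi: "is_subfield F \<Longrightarrow> x \<in> F \<Longrightarrow> x powi n \<in> F"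
  by (cases "x = 0") (auto simp: power_int_def is_subfield_def intro!: subfield_power)

locale mixed = char2 ty for ty :: "'a::field itself" +
  fixes K L :: "'a set"
  assumes K: "is_subfield K" and L: "is_subfield L" and KL: "K \<subseteq> L" and LK: "\<And>x. x \<in> L \<Longrightarrow> x ^ 2 \<in> K"
begin

definition adm :: "root4 \<Rightarrow> 'a set" where
  "adm r = (if F4_long r then K else L)"

lemma adm_subfield: "is_subfield (adm r)"
  using K L by (simp add: adm_def)

lemma adm_simps [simp]: "0 \<in> adm r" "1 \<in> adm r"
  using adm_subfield[of r] by (simp_all add: is_subfield_def)

lemma adm_closed:
  "x \<in> adm r \<Longrightarrow> y \<in> adm r \<Longrightarrow> x + y \<in> adm r" "x \<in> adm r \<Longrightarrow> y \<in> adm r \<Longrightarrow> x * y \<in> adm r"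
  "x \<in> adm r \<Longrightarrow> x \<noteq> 0 \<Longrightarrow> inverse x \<in> adm r"
  using adm_subfield[of r] by (simp_all add: is_subfield_def)

lemma adm_L: "x \<in> adm r \<Longrightarrow> x \<in> L"
  using KL by (auto simp: adm_def split: if_splits)

lemma adm_rneg: "adm (rneg r) = adm r"
  by (simp add: adm_def long_ip rneg_rscale)

lemma u_GL [simp]: "r \<in> F4_Phi \<Longrightarrow> u r t \<in> GL52" "r \<in> F4_Phi \<Longrightarrow> ginv (u r t) = u r t"
  using ginv_unique[of "u r t" "u r t"] by simp_all

lemma n_GL [simp]: "r \<in> F4_Phi \<Longrightarrow> n_el r t \<in> GL52" "r \<in> F4_Phi \<Longrightarrow> ginv (n_el r t) = n_el r t" for t :: 'a
  using ginv_unique[of "n_el r t" "n_el r t"] by simp_all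

definition Ugen :: "root4 set \<Rightarrow> 'a mat set" where
  "Ugen R = (\<Union>r\<in>R. U_root K L r)"

definition XX :: "root4 set \<Rightarrow> 'a mat set" where
  "XX R = grp_gen (Ugen R)"

lemma Ugen_iff: "A \<in> Ugen R \<longleftrightarrow> (\<exists>r\<in>R. \<exists>t\<in>adm r. A = u r t)"
  by (auto simp: Ugen_def U_root_def adm_def)

lemma Ugen_GL: "R \<subseteq> F4_Phi \<Longrightarrow> Ugen R \<subseteq> GL52"
  by (auto simp only: Ugen_iff subset_iff u_GL)

lemma Ugen_ginv:
  assumes "R \<subseteq> F4_Phi" shows "\<forall>A\<in>Ugen R. ginv A \<in> Ugen R"
proof
  fix A assume A: "A \<in> Ugen R"
  then obtain r t where r: "r \<in> R" "A = u r t" unfolding Ugen_iff by blast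
  have "r \<in> F4_Phi" using r(1) assms by blast
  then have "ginv A = A" using r(2) by simp
  then show "ginv A \<in> Ugen R" using A by simp
qed

lemma u_XX: "r \<in> R \<Longrightarrow> t \<in> adm r \<Longrightarrow> u r t \<in> XX R"
  unfolding XX_def by (rule grp_gen.gen_incl) (auto simp only: Ugen_iff)

lemma XX_mono: "R \<subseteq> R' \<Longrightarrow> XX R \<subseteq> XX R'"
  unfolding XX_def by (rule grp_gen_mono) (auto simp: Ugen_def)

lemma XX_GL: "R \<subseteq> F4_Phi \<Longrightarrow> XX R \<subseteq> GL52"
  unfolding XX_def by (intro grp_gen_GL Ugen_GL)

lemma F4_mixed_XX: "F4_mixed K L = XX F4_Phi"
  by (simp add: F4_mixed_def XX_def Ugen_def)

text \<open>The mixed group depends on this. A long root that arises from a long r and a short s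
  carries the parameter t x^2, which lies in K because squares from L do. Orthogonal short roots,
  whose sum is long, would spoil this, but they commute in characteristic 2.\<close>

lemma comm_adm:
  assumes "(q, i, j) \<in> set (comm_list r s)" "t \<in> adm r" "x \<in> adm s" "r \<in> F4_Phi" "s \<in> F4_Phi"
  shows "t ^ i * x ^ j \<in> adm q"
proof -
  have LKt: "t ^ 2 \<in> K" "x ^ 2 \<in> K" using assms adm_L LK by auto
  have mult: "y * z \<in> F" if "is_subfield F" "y \<in> F" "z \<in> F" for F and y z :: 'a
    using that by (simp add: is_subfield_def)
  have t: "t \<in> (if F4_long r then K else L)" "t \<in> L" and x: "x \<in> (if F4_long s then K else L)" "x \<in> L"
    using assms adm_L by (auto simp: adm_def)
  have c: "ip s r = ip r s" by (rule ip_commute)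
  show ?thesis
    using assms(1) t x LKt mult[OF K] mult[OF L] c root_length[OF assms(4)] root_length[OF assms(5)]
    unfolding adm_def comm_list_def
    by (auto simp: long_ip power2_eq_square split: if_splits)
qed

lemma XX_norm:
  assumes r: "r \<in> F4_Phi" "t \<in> adm r" and R: "R \<subseteq> F4_Phi"
    and cl: "\<And>s. s \<in> R \<Longrightarrow> s \<noteq> rneg r"
      "\<And>s q i j. s \<in> R \<Longrightarrow> (q, i, j) \<in> set (comm_list r s) \<Longrightarrow> q \<in> F4_Phi \<Longrightarrow> q \<in> R"
    and A: "A \<in> XX R"
  shows "u r t * A * u r t \<in> XX R"
proof -
  have "u r t * A * ginv (u r t) \<in> grp_gen (Ugen R)"
  proof (rule grp_gen_conj[OF u_GL(1)[OF r(1)] Ugen_GL[OF R]])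
    show "A \<in> grp_gen (Ugen R)" using A by (simp add: XX_def)
    fix B assume "B \<in> Ugen R"
    then obtain s x where s: "s \<in> R" "x \<in> adm s" "B = u s x" by (auto simp only: Ugen_iff)
    have ok: "comm_ok r s" using s(1) R r cl(1) by (intro comm_ok) auto
    have "comm_word r s t x \<in> grp_gen (Ugen R)"
      unfolding comm_word_def
    proof (rule prodl_grp_gen, rule subsetI)
      fix C assume "C \<in> set (map (\<lambda>(q, i, j). u q (t ^ i * x ^ j)) (comm_list r s))"
      then obtain q i j where q: "(q, i, j) \<in> set (comm_list r s)" "C = u q (t ^ i * x ^ j)" by auto
      have "q \<in> F4_Phi" using ok q(1) unfolding comm_ok_def by force
      then show "C \<in> grp_gen (Ugen R)"
        using u_XX[OF cl(2)[OF s(1) q(1)] comm_adm[OF q(1) r(2) s(2) r(1) subsetD[OF R s(1)]]] q(2) by (simp add: XX_def)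
    qed
    moreover have "u s x \<in> grp_gen (Ugen R)" using u_XX[OF s(1,2)] by (simp add: XX_def)
    ultimately have "u s x * comm_word r s t x \<in> grp_gen (Ugen R)" by (rule grp_gen.gen_mult[rotated])
    then show "u r t * B * ginv (u r t) \<in> grp_gen (Ugen R)"
      using ok r(1) unfolding comm_ok_def s(3) by (simp add: assoc52)
  qed
  then show ?thesis using r(1) by (simp add: XX_def)
qed

text \<open>These generators, rather than the elements h_r(t), are closed under inversion.\<close>
definition Tgen :: "'a mat set" where
  "Tgen = {n_el r t * n_el r t' | r t t'. r \<in> F4_Phi \<and> t \<in> adm r \<and> t \<noteq> 0 \<and> t' \<in> adm r \<and> t' \<noteq> 0}"

lemma Tgen_GL: "Tgen \<subseteq> GL52"
  by (auto simp only: Tgen_def subset_iff mem_Collect_eq n_GL GL_mult)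

lemma TgenE:
  assumes "h \<in> Tgen"
  obtains r t t' where "h = n_el r t * n_el r t'" "r \<in> F4_Phi" "t \<in> adm r" "t \<noteq> 0" "t' \<in> adm r" "t' \<noteq> 0"
  using assms unfolding Tgen_def by blast

lemma Tgen_ginv: "A \<in> Tgen \<Longrightarrow> ginv A \<in> Tgen"
  unfolding Tgen_def mem_Collect_eq by (metis n_GL GL_mult(2))

lemma Tgen_u:
  assumes "h \<in> Tgen" "s \<in> F4_Phi"
  obtains \<chi> where "\<chi> \<in> adm s" "\<chi> \<noteq> 0" "\<And>x. h * u s x = u s (\<chi> * x) * h"
proof -
  obtain r t t' where h: "h = n_el r t * n_el r t'" and r: "r \<in> F4_Phi" and t: "t \<in> adm r" "t \<noteq> 0" "t' \<in> adm r" "t' \<noteq> 0"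
    using TgenE[OF assms(1)] by blast
  obtain m :: int where m: "\<not> F4_long r \<and> F4_long s \<longrightarrow> even m"
      "\<And>t x. t \<noteq> 0 \<Longrightarrow> torus_el r t * u s x = u s (t powi m * x) * torus_el r t"
    using torus_ok[OF r assms(2)] unfolding torus_ok_def by blast
  have adm: "y powi m \<in> adm s" if "y \<in> adm r" for y
  proof (cases "F4_long s")
    case True
    show ?thesis
    proof (cases "F4_long r")
      case False
      then obtain k where k: "m = 2 * k" using m(1) True by auto
      have "y powi m = (y ^ 2) powi k" unfolding k by (simp add: power_int_mult)
      then show ?thesis using LK[OF adm_L[OF that]] subfield_powi[OF K] True by (simp add: adm_def)
    qed (use that True subfield_powi[OF K] in \<open>simp add: adm_def\<close>)
  qed (use adm_L[OF that] subfield_powi[OF L] in \<open>simp add: adm_def\<close>)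
  let ?T = "torus_el r t" and ?T' = "torus_el r t'"
  have GL: "?T \<in> GL52" "?T' \<in> GL52" using r by (simp_all add: torus_el_def)
  \<comment> \<open>As \<open>nn r\<close> is an involution, h is a quotient of two elements h_r,
    whose action on u_s is known.\<close>
  have hT: "h = ?T * ginv ?T'"
    using r by (simp add: h torus_el_def assoc52)
  have T': "ginv ?T' * u s x = u s (t' powi (- m) * x) * ginv ?T'" for x
  proof -
    let ?y = "t' powi (- m) * x"
    have y: "t' powi m * ?y = x" using t(4) by (simp add: power_int_minus)
    have "?T' * (u s ?y * ginv ?T') = ?T' * u s ?y * ginv ?T'" using GL by (simp add: assoc52)
    also have "\<dots> = u s x" unfolding m(2)[OF t(4)] y using GL by (simp add: assoc52)
    finally have "?T' * (u s ?y * ginv ?T') = u s x" .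
    from arg_cong[OF this, of "\<lambda>X. ginv ?T' * X"] show ?thesis using GL by simp
  qed
  define \<chi> where "\<chi> = t powi m * t' powi (- m)"
  have "\<chi> = t powi m * inverse (t' powi m)" by (simp add: \<chi>_def power_int_minus)
  then have "\<chi> \<in> adm s" "\<chi> \<noteq> 0"
    using adm_closed(2)[OF adm[OF t(1)] adm_closed(3)[OF adm[OF t(3)]]] t(2,4) by simp_all
  moreover have "h * u s x = u s (\<chi> * x) * h" for x
  proof -
    have "h * u s x = ?T * (u s (t' powi (- m) * x) * ginv ?T')"
      unfolding hT using GL T'[of x] by (simp add: assoc52)
    also have "\<dots> = (?T * u s (t' powi (- m) * x)) * ginv ?T'" using GL by (simp add: assoc52)
    also have "\<dots> = u s (\<chi> * x) * h" unfolding m(2)[OF t(2)] hT \<chi>_def using GL by (simp add: assoc52 mult.assoc)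
    finally show ?thesis .
  qed
  ultimately show ?thesis using that by blast
qed

lemma Tgen_nprod:
  assumes "h \<in> Tgen" "simple_word ws"
  obtains h' where "h' \<in> Tgen" "h * nprod ws = nprod ws * h'"
proof -
  obtain r t t' where h: "h = n_el r t * n_el r t'" and r: "r \<in> F4_Phi" and t: "t \<in> adm r" "t \<noteq> 0" "t' \<in> adm r" "t' \<noteq> 0"
    using TgenE[OF assms(1)] by blast
  let ?r = "word_inv ws r"
  have "h * nprod ws = nprod ws * (n_el ?r t * n_el ?r t')"
  proof -
    have n: "n_el r x * nprod ws = nprod ws * n_el ?r x" for x
      by (rule n_nprod[OF assms(2) r])
    have "h * nprod ws = n_el r t * (n_el r t' * nprod ws)" by (simp add: h assoc52)
    also have "\<dots> = n_el r t * nprod ws * n_el ?r t'" unfolding n[of t'] by (simp add: assoc52)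
    also have "\<dots> = nprod ws * (n_el ?r t * n_el ?r t')" unfolding n by (simp add: assoc52)
    finally show ?thesis .
  qed
  moreover have "n_el ?r t * n_el ?r t' \<in> Tgen"
    unfolding Tgen_def mem_Collect_eq using t word_inv_Phi[OF assms(2) r] word_inv_long[OF assms(2) r]
    by (intro exI[of _ ?r] exI[of _ t] exI[of _ t']) (simp add: adm_def)
  ultimately show ?thesis using that by blast
qed

lemma Tgen_norm:
  assumes "h \<in> Tgen" "R \<subseteq> F4_Phi" "A \<in> XX R"
  shows "h * A * ginv h \<in> XX R"
  unfolding XX_def
proof (rule grp_gen_conj[OF _ Ugen_GL[OF assms(2)]])
  have h: "h \<in> GL52" using assms(1) Tgen_GL by auto
  then show "h \<in> GL52" .
  show "A \<in> grp_gen (Ugen R)" using assms(3) by (simp add: XX_def)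
  fix B assume "B \<in> Ugen R"
  then obtain s x where s: "s \<in> R" "x \<in> adm s" "B = u s x" by (auto simp only: Ugen_iff)
  obtain \<chi> where \<chi>: "\<chi> \<in> adm s" "\<And>x. h * u s x = u s (\<chi> * x) * h"
    using Tgen_u[OF assms(1)] s(1) assms(2) by blast
  have "h * B * ginv h = u s (\<chi> * x)" using h by (simp add: s(3) \<chi>(2) assoc52)
  then show "h * B * ginv h \<in> grp_gen (Ugen R)"
    using u_XX[OF s(1), of "\<chi> * x"] adm_closed(2)[OF \<chi>(1) s(2)] by (simp add: XX_def)
qed

text \<open>These groups are generated by root groups with admissible parameters and by
  \<open>Tgen\<close>. They lie in the groups of the theorem, which are cut out of groups over L,
  and these inclusions suffice: the factors u and l are found in the smaller groups, and an element
  outside \<open>P_J\<close> is outside \<open>Pm\<close>.\<close>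

definition Um :: "'a mat set" where "Um = XX {r \<in> F4_Phi. 0 < level r}"
definition Zm :: "'a mat set" where "Zm = XX {r \<in> F4_Phi. level r = 2}"
definition Lgen :: "'a mat set" where "Lgen = Tgen \<union> Ugen {r \<in> F4_Phi. level r = 0}"
definition Lm :: "'a mat set" where "Lm = grp_gen Lgen"
definition Pgen :: "'a mat set" where "Pgen = Tgen \<union> Ugen {r \<in> F4_Phi. 0 \<le> level r}"
definition Pm :: "'a mat set" where "Pm = grp_gen Pgen"

lemma Lgen_GL: "Lgen \<subseteq> GL52" and Pgen_GL: "Pgen \<subseteq> GL52"
  using Tgen_GL Ugen_GL[of "{r \<in> F4_Phi. level r = 0}"] Ugen_GL[of "{r \<in> F4_Phi. 0 \<le> level r}"]
  by (auto simp only: Lgen_def Pgen_def)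

lemma Lgen_ginv: "\<forall>A\<in>Lgen. ginv A \<in> Lgen"
  using Tgen_ginv Ugen_ginv[of "{r \<in> F4_Phi. level r = 0}"] by (auto simp only: Lgen_def)

lemma Pgen_ginv: "\<forall>A\<in>Pgen. ginv A \<in> Pgen"
  using Tgen_ginv Ugen_ginv[of "{r \<in> F4_Phi. 0 \<le> level r}"] by (auto simp only: Pgen_def)

lemma Um_GL: "Um \<subseteq> GL52" and Zm_GL: "Zm \<subseteq> GL52" and Lm_GL: "Lm \<subseteq> GL52" and Pm_GL: "Pm \<subseteq> GL52"
  unfolding Um_def Zm_def Lm_def Pm_def by (intro XX_GL grp_gen_GL Lgen_GL Pgen_GL; blast)+

lemma Lm_Pm: "Lm \<subseteq> Pm"
  unfolding Lm_def Pm_def Lgen_def Pgen_def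
  by (intro grp_gen_mono Un_mono) (auto simp: Ugen_def)

lemma Um_Pm: "Um \<subseteq> Pm"
  unfolding Um_def XX_def Pm_def Pgen_def
  by (intro grp_gen_mono) (auto simp: Ugen_def)

lemma n_mixed:
  assumes "r \<in> F4_Phi" "t \<in> adm r" "t \<noteq> 0" "r \<in> R" "rneg r \<in> R"
  shows "n_el r t \<in> XX R"
proof -
  have "u r t \<in> XX R" "u (rneg r) (inverse t) \<in> XX R"
    using assms by (auto intro!: u_XX adm_closed simp: adm_rneg)
  then show ?thesis unfolding n_el_def XX_def by (intro grp_gen.gen_mult)
qed

lemma Tgen_mixed: "Tgen \<subseteq> XX F4_Phi"
proof
  fix A assume "A \<in> Tgen"
  then obtain r t t' where "A = n_el r t * n_el r t'" and r: "r \<in> F4_Phi" and t: "t \<in> adm r" "t \<noteq> 0" "t' \<in> adm r" "t' \<noteq> 0"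
    using TgenE by blast
  then show "A \<in> XX F4_Phi"
    using n_mixed[OF r _ _ r rneg_Phi[OF r]] by (auto simp only: XX_def intro: grp_gen.gen_mult)
qed

lemma Pm_mixed: "Pm \<subseteq> XX F4_Phi"
  unfolding Pm_def XX_def
proof (rule grp_gen_least)
  have "Ugen {r \<in> F4_Phi. 0 \<le> level r} \<subseteq> grp_gen (Ugen F4_Phi)"
    by (auto simp: Ugen_def intro: grp_gen.gen_incl)
  then show "Pgen \<subseteq> grp_gen (Ugen F4_Phi)"
    using Tgen_mixed by (simp add: Pgen_def XX_def)
qed

lemma Um_norm_gen:
  assumes "A \<in> Pgen" "B \<in> Um" shows "A * B * ginv A \<in> Um"
proof -
  consider "A \<in> Tgen" | r t where "r \<in> F4_Phi" "0 \<le> level r" "t \<in> adm r" "A = u r t"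
    using assms(1) unfolding Pgen_def Un_iff Ugen_iff by blast
  then show ?thesis
  proof cases
    case 1
    then show ?thesis using assms(2) unfolding Um_def by (intro Tgen_norm) auto
  next
    case 2
    have "u r t * B * u r t \<in> Um"
      unfolding Um_def
    proof (rule XX_norm[OF 2(1,3) _ _ _ assms(2)[unfolded Um_def]])
      show "s \<noteq> rneg r" if "s \<in> {r \<in> F4_Phi. 0 < level r}" for s
        using that 2(2) by auto
      show "q \<in> {r \<in> F4_Phi. 0 < level r}"
        if "s \<in> {r \<in> F4_Phi. 0 < level r}" "(q, i, j) \<in> set (comm_list r s)" "q \<in> F4_Phi" for s q i j
      proof -
        have "level q = int i * level r + int j * level s" "0 < j"
          using comm_list_pos[OF that(2)] by simp_all
        then show ?thesis using that 2(2) by (simp add: add_nonneg_pos)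
      qed
    qed auto
    then show ?thesis using 2 by simp
  qed
qed

lemma Zm_norm_gen:
  assumes "A \<in> Pgen" "B \<in> Zm" shows "A * B * ginv A \<in> Zm"
proof -
  consider "A \<in> Tgen" | r t where "r \<in> F4_Phi" "0 \<le> level r" "t \<in> adm r" "A = u r t"
    using assms(1) unfolding Pgen_def Un_iff Ugen_iff by blast
  then show ?thesis
  proof cases
    case 1
    then show ?thesis using assms(2) unfolding Zm_def by (intro Tgen_norm) auto
  next
    case 2
    have "u r t * B * u r t \<in> Zm"
      unfolding Zm_def
    proof (rule XX_norm[OF 2(1,3) _ _ _ assms(2)[unfolded Zm_def]])
      show "s \<noteq> rneg r" if "s \<in> {r \<in> F4_Phi. level r = 2}" for s
        using that 2(2) by auto
      show "q \<in> {r \<in> F4_Phi. level r = 2}"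
        if "s \<in> {r \<in> F4_Phi. level r = 2}" "(q, i, j) \<in> set (comm_list r s)" "q \<in> F4_Phi" for s q i j
      proof -
        have "level q = int i * level r + int j * 2" "0 < j"
          using comm_list_pos[OF that(2)] that(1) by simp_all
        then have "2 \<le> level q" using 2(2) by (simp add: add_increasing)
        then show ?thesis using that level_bound[OF that(3)] by simp
      qed
    qed auto
    then show ?thesis using 2 by simp
  qed
qed

lemma Pm_norm:
  assumes gen: "\<And>A B. A \<in> Pgen \<Longrightarrow> B \<in> N \<Longrightarrow> A * B * ginv A \<in> N" and N: "N \<subseteq> GL52"
    and p: "p \<in> Pm" and B: "B \<in> N"
  shows "p * B * ginv p \<in> N"
  using Pgen_GL Pgen_ginv p[unfolded Pm_def] B
proof (induction arbitrary: B rule: grp_gen_induct_left)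
  case one
  then show ?case using N by (simp add: subset_iff)
next
  case (mult A C)
  have GL: "A \<in> GL52" "C \<in> GL52" "B \<in> GL52"
    using mult Pgen_GL grp_gen_GL[OF Pgen_GL] N by auto
  have "A * C * B * ginv (A * C) = A * (C * B * ginv C) * ginv A"
    using GL by (simp add: assoc52)
  then show ?case using gen[OF mult(1) mult.IH[OF mult.prems]] by simp
qed

lemma Zm_norm: "p \<in> Pm \<Longrightarrow> z \<in> Zm \<Longrightarrow> p * z * ginv p \<in> Zm"
  by (rule Pm_norm[OF Zm_norm_gen Zm_GL])

text \<open>A generator added on the left either belongs to the factor in \<open>Um\<close> or is
  moved past it by conjugation.\<close>

lemma Pm_decomp:
  assumes "p \<in> Pm"
  obtains x l where "x \<in> Um" "l \<in> Lm" "p = x * l"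
proof -
  have "\<exists>x\<in>Um. \<exists>l\<in>Lm. p = x * l"
    using Pgen_GL Pgen_ginv assms[unfolded Pm_def]
  proof (induction rule: grp_gen_induct_left)
    case one
    then show ?case unfolding Um_def XX_def Lm_def by (intro bexI[of _ "1\<^sub>m 52"]) (simp_all add: grp_gen.gen_one)
  next
    case (mult A B)
    then obtain x l where xl: "x \<in> Um" "l \<in> Lm" "B = x * l" by blast
    have GL: "A \<in> GL52" "x \<in> GL52" "l \<in> GL52" using mult xl Pgen_GL Um_GL Lm_GL by auto
    have conj: "A * x * ginv A \<in> Um" using Um_norm_gen mult(1) xl(1) by blast
    consider "A \<in> Lgen" | "A \<in> Um"
    proof -
      have "A \<in> Tgen \<or> (\<exists>r t. r \<in> F4_Phi \<and> 0 \<le> level r \<and> t \<in> adm r \<and> A = u r t)"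
        using mult(1) unfolding Pgen_def Un_iff Ugen_iff by blast
      then have "A \<in> Lgen \<or> A \<in> Um"
      proof (elim disjE exE conjE)
        fix r t assume r: "r \<in> F4_Phi" "0 \<le> level r" "t \<in> adm r" "A = u r t"
        show ?thesis
        proof (cases "level r = 0")
          case True
          then show ?thesis using r unfolding Lgen_def Un_iff Ugen_iff by blast
        next
          case False
          then show ?thesis using r u_XX[of r "{r \<in> F4_Phi. 0 < level r}" t] by (simp add: Um_def)
        qed
      qed (simp add: Lgen_def)
      then show ?thesis using that by blast
    qed
    then show ?case
    proof cases
      case 1
      have "A * B = (A * x * ginv A) * (A * l)" using GL xl by (simp add: assoc52)
      moreover have "A * l \<in> Lm" using xl(2) unfolding Lm_def by (rule grp_gen.gen_mult[OF grp_gen.gen_incl[OF 1]])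
      ultimately show ?thesis using conj by blast
    next
      case 2
      have "A * B = (A * x) * l" using GL xl by (simp add: assoc52)
      moreover have "A * x \<in> Um" using 2 xl unfolding Um_def XX_def by (intro grp_gen.gen_mult)
      ultimately show ?thesis using xl by blast
    qed
  qed
  then show ?thesis using that by blast
qed

section \<open>Bruhat decomposition\<close>

definition Up :: "'a mat set" where
  "Up = XX {r \<in> F4_Phi. 0 < height r}"

lemma Up_Pm: "Up \<subseteq> Pm"
proof -
  have "{r \<in> F4_Phi. 0 < height r} \<subseteq> {r \<in> F4_Phi. 0 \<le> level r}" using level_bound by blast
  then show ?thesis unfolding Up_def XX_def Pm_def Pgen_def
    by (intro grp_gen_mono) (auto simp: Ugen_def)
qed

text \<open>Commutators of a with the other positive roots involve only positive roots different
  from a, so the factors u_a can be collected on the right.\<close>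

lemma Up_split:
  assumes a: "a \<in> set simple_roots" and A: "A \<in> Up"
  obtains B t where "B \<in> XX {r \<in> F4_Phi. 0 < height r \<and> r \<noteq> a}" "t \<in> adm a" "A = B * u a t"
proof -
  let ?R = "{r \<in> F4_Phi. 0 < height r \<and> r \<noteq> a}" and ?R' = "{r \<in> F4_Phi. 0 < height r}"
  have aP: "a \<in> F4_Phi" "0 < height a" using a simple_Phi simple_height by auto
  have R': "?R' \<subseteq> F4_Phi" by blast
  have "\<exists>B\<in>XX ?R. \<exists>t\<in>adm a. A = B * u a t"
    using Ugen_GL[OF R'] Ugen_ginv[OF R'] A[unfolded Up_def XX_def]
  proof (induction rule: grp_gen_induct_left)
    case one
    show ?case using aP unfolding XX_def
      by (intro bexI[of _ "1\<^sub>m 52"] bexI[of _ 0]) (simp_all add: grp_gen.gen_one)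
  next
    case (mult A C)
    then obtain B t where B: "B \<in> XX ?R" "t \<in> adm a" "C = B * u a t" by blast
    obtain r x where r: "r \<in> F4_Phi" "0 < height r" "x \<in> adm r" "A = u r x"
      using mult(1) unfolding Ugen_iff by blast
    have GL: "B \<in> GL52" using B(1) XX_GL[of ?R] by auto
    show ?case
    proof (cases "r = a")
      case True
      have "u a x * B * u a x \<in> XX ?R"
      proof (rule XX_norm[OF aP(1) _ _ _ _ B(1)])
        show "x \<in> adm a" using r True by simp
        show "s \<noteq> rneg a" if "s \<in> ?R" for s using that aP(2) by auto
        show "q \<in> ?R" if "s \<in> ?R" "(q, i, j) \<in> set (comm_list a s)" "q \<in> F4_Phi" for s q i j
        proof -
          have q: "0 < i" "0 < j" "q = radd (rscale (int i) a) (rscale (int j) s)"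
            using comm_list_pos[OF that(2)] by simp_all
          have "int i * height a \<ge> 1 * height a" using q(1) aP(2) by (intro mult_right_mono) auto
          moreover have "0 < int j * height s" using q(2) that(1) by simp
          ultimately have "height a < height q" using q(3) by simp
          then show ?thesis using that(3) aP(2) by auto
        qed
      qed auto
      moreover have "A * C = (u a x * B * u a x) * u a (x + t)"
        using GL B(3) r(4) True aP u_add[OF aP(1), of x t, symmetric] by (simp add: assoc52)
      moreover have "x + t \<in> adm a" using r(3) True B(2) by (simp add: adm_closed)
      ultimately show ?thesis by blast
    next
      case False
      have "A * C = (A * B) * u a t" using GL B(3) r(4) by (simp add: assoc52)
      moreover have "A * B \<in> XX ?R"
        using B(1) u_XX[of r ?R x] r False unfolding XX_def by (auto intro: grp_gen.gen_mult)
      ultimately show ?thesis using B(2) by blast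
    qed
  qed
  then show ?thesis using that by blast
qed

text \<open>The union of the 24 cells U w P. It turns out to be stable under left multiplication by
  every root element, so it contains the whole mixed group.\<close>

definition Cells :: "'a mat set" where
  "Cells = {y * nprod (rep k) * p | y k p. y \<in> Up \<and> k < 24 \<and> p \<in> Pm}"

lemma CellsI: "y \<in> Up \<Longrightarrow> k < 24 \<Longrightarrow> p \<in> Pm \<Longrightarrow> y * nprod (rep k) * p \<in> Cells"
  unfolding Cells_def by blast

lemma Up_GL: "Up \<subseteq> GL52"
  unfolding Up_def by (rule XX_GL) blast

lemma Up_Cells:
  assumes "y \<in> Up" "g \<in> Cells" shows "y * g \<in> Cells"
proof -
  obtain z k p where g: "z \<in> Up" "k < 24" "p \<in> Pm" "g = z * nprod (rep k) * p"
    using assms(2) unfolding Cells_def by blast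
  have "y * g = (y * z) * nprod (rep k) * p"
    using assms(1) g Up_GL Pm_GL by (simp add: subset_iff assoc52)
  moreover have "y * z \<in> Up" using assms(1) g(1) unfolding Up_def XX_def by (rule grp_gen.gen_mult)
  ultimately show ?thesis using CellsI g by simp
qed

lemma one_Up: "1\<^sub>m 52 \<in> Up" and one_Pm: "1\<^sub>m 52 \<in> Pm"
  by (simp_all add: Up_def XX_def Pm_def grp_gen.gen_one)

lemma Pm_mult: "p \<in> Pm \<Longrightarrow> p' \<in> Pm \<Longrightarrow> p * p' \<in> Pm"
  unfolding Pm_def by (rule grp_gen.gen_mult)

lemma Lm_mult: "p \<in> Lm \<Longrightarrow> p' \<in> Lm \<Longrightarrow> p * p' \<in> Lm"
  unfolding Lm_def by (rule grp_gen.gen_mult)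

lemma u_Pm: "r \<in> F4_Phi \<Longrightarrow> 0 \<le> level r \<Longrightarrow> t \<in> adm r \<Longrightarrow> u r t \<in> Pm"
  unfolding Pm_def Pgen_def by (rule grp_gen.gen_incl) (unfold Un_iff Ugen_iff, blast)

lemma nprod_Lm: "set ws \<subseteq> {28, 13, 1} \<Longrightarrow> nprod ws \<in> Lm"
proof (induction ws)
  case Nil
  then show ?case by (simp add: Lm_def grp_gen.gen_one)
next
  case (Cons a ws)
  let ?a = "F4_roots ! a"
  have a: "?a \<in> F4_Phi" "level ?a = 0"
    using Cons.prems nth_Phi[of a] by (auto simp: roots_nth[simplified] level_def simp del: nth_Phi)
  have "nn ?a \<in> XX {r \<in> F4_Phi. level r = 0}"
    using a by (intro n_mixed) simp_all
  then have "nn ?a \<in> Lm"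
    unfolding XX_def Lm_def Lgen_def using grp_gen_mono[of "Ugen {r \<in> F4_Phi. level r = 0}" "Tgen \<union> Ugen {r \<in> F4_Phi. level r = 0}"] by blast
  then show ?case using Cons by (simp add: Lm_mult)
qed

lemma rep_step_cell:
  assumes a: "a \<in> set simple_roots" and k: "k < 24" and p: "p \<in> Pm"
  shows "nn a * (nprod (rep k) * p) \<in> Cells"
proof -
  obtain i where i: "i \<in> {46, 28, 13, 1}" "a = F4_roots ! i"
    using a by (auto simp: simple_roots_def roots_simple)
  obtain k' ws where k': "k' < 24" "set ws \<subseteq> {28, 13, 1}" "nn a * nprod (rep k) = nprod (rep k') * nprod ws"
    using rep_step[OF k i(1)] unfolding i(2) by blast
  have P: "nprod ws * p \<in> Pm" using nprod_Lm[OF k'(2)] Lm_Pm p by (intro Pm_mult) auto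
  have "nn a * (nprod (rep k) * p) = nn a * nprod (rep k) * p" using p Pm_GL by (simp add: subset_iff assoc52)
  also have "\<dots> = 1\<^sub>m 52 * nprod (rep k') * (nprod ws * p)"
    unfolding k'(3) using p Pm_GL by (simp add: subset_iff assoc52)
  finally show ?thesis using CellsI[OF one_Up k'(1) P] by simp
qed

text \<open>The classical rank-one argument. By \<open>Up_split\<close> only u_a(t) stands between
  n_a and the representative w, as n_a carries the rest of U into U. If w^-1(a) has nonnegative
  level, u_a(t) passes through w into P. Otherwise n_a is absorbed by the rank-one identity for
  u_-a(t), and the cell stays the same.\<close>

lemma nn_Cells:
  assumes a: "a \<in> set simple_roots" and g: "g \<in> Cells"
  shows "nn a * g \<in> Cells"
proof -
  obtain y k p where y: "y \<in> Up" "k < 24" "p \<in> Pm" "g = y * nprod (rep k) * p"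
    using g unfolding Cells_def by blast
  obtain B t where B: "B \<in> XX {r \<in> F4_Phi. 0 < height r \<and> r \<noteq> a}" "t \<in> adm a" "y = B * u a t"
    using Up_split[OF a y(1)] by blast
  have aP: "a \<in> F4_Phi" "0 < height a" "a \<in> refl_roots" using a simple_Phi simple_height simple_refl by auto
  have GL: "B \<in> GL52" "p \<in> GL52" "nn a \<in> GL52"
    using B(1) XX_GL[of "{r \<in> F4_Phi. 0 < height r \<and> r \<noteq> a}"] y(3) Pm_GL aP by auto
  have conj: "nn a * B * nn a \<in> Up"
  proof -
    have "nn a * B * ginv (nn a) \<in> grp_gen (Ugen {r \<in> F4_Phi. 0 < height r})"
    proof (rule grp_gen_conj[OF GL(3) Ugen_GL])
      show "{r \<in> F4_Phi. 0 < height r \<and> r \<noteq> a} \<subseteq> F4_Phi" by blast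
      show "B \<in> grp_gen (Ugen {r \<in> F4_Phi. 0 < height r \<and> r \<noteq> a})" using B(1) by (simp add: XX_def)
      fix C assume "C \<in> Ugen {r \<in> F4_Phi. 0 < height r \<and> r \<noteq> a}"
      then obtain r x where r: "r \<in> F4_Phi" "0 < height r" "r \<noteq> a" "x \<in> adm r" "C = u r x"
        unfolding Ugen_iff by blast
      have "nn a * C * ginv (nn a) = u (refl a r) x"
        using aP r(1) by (simp add: r(5) nn_u assoc52)
      moreover have "u (refl a r) x \<in> XX {r \<in> F4_Phi. 0 < height r}"
        using r aP refl_height[OF a r(1-3)] refl_Phi[OF aP(3) r(1)] long_refl[OF aP(3) even_tuple_Phi[OF r(1)]]
        by (intro u_XX) (simp_all add: adm_def)
      ultimately show "nn a * C * ginv (nn a) \<in> grp_gen (Ugen {r \<in> F4_Phi. 0 < height r})"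
        by (simp add: XX_def)
    qed
    then show ?thesis using aP by (simp add: Up_def XX_def)
  qed
  let ?N = "nprod (rep k)"
  have sw: "simple_word (rep k)" by (rule rep_simple[OF y(2)])
  let ?r = "word_inv (rep k) a"
  have r: "?r \<in> F4_Phi" "adm ?r = adm a"
    using word_inv_Phi[OF sw aP(1)] word_inv_long[OF sw aP(1)] by (simp_all add: adm_def)
  have main: "nn a * (u a t * (?N * p)) \<in> Cells"
  proof (cases "t = 0 \<or> 0 \<le> level ?r")
    case True
    have "\<exists>p'\<in>Pm. u a t * (?N * p) = ?N * p'"
    proof (cases "t = 0")
      case True
      then show ?thesis using y(3) GL aP by (intro bexI[of _ p]) simp_all
    next
      case False
      have "u a t * (?N * p) = u a t * ?N * p" using GL by (simp add: assoc52)
      also have "\<dots> = ?N * (u ?r t * p)" unfolding u_nprod[OF sw aP(1)] using GL by (simp add: assoc52)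
      finally show ?thesis
        using False True y(3) r B(2) by (intro bexI[of _ "u ?r t * p"]) (auto intro!: Pm_mult u_Pm)
    qed
    then show ?thesis using rep_step_cell[OF a y(2)] by auto
  next
    case False
    define s where "s = inverse t"
    have s: "s \<in> adm a" "s \<noteq> 0" "inverse s = t" using False B(2) by (simp_all add: s_def adm_closed)
    have neg: "rneg a \<in> F4_Phi" using aP by simp
    have ra: "refl a (rneg a) = a"
      using refl_self[OF aP(3)] refl_refl[OF aP(3) even_tuple_Phi[OF aP(1)]] by simp
    define h where "h = n_el a s * nn a"
    have h: "h \<in> Tgen" unfolding h_def Tgen_def mem_Collect_eq
      using s aP by (intro exI[of _ a] exI[of _ s] exI[of _ 1]) simp
    obtain h' where h': "h' \<in> Tgen" "h * ?N = ?N * h'" using Tgen_nprod[OF h sw] by blast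
    have hGL: "h \<in> GL52" "h' \<in> GL52" using h h'(1) Tgen_GL by auto
    \<comment> \<open>The Bruhat decomposition in the rank-one group of a, with s the inverse of
      t.\<close>
    have ut: "u (rneg a) t = u a s * (h * (nn a * u a s))"
      using aP s by (simp add: h_def n_el_def[of a s] assoc52)
    have "nn a * (u a t * (?N * p)) = u (rneg a) t * (nn a * (?N * p))"
      using GL aP by (simp add: nn_swap refl_self)
    also have "\<dots> = u a s * (h * (u (rneg a) s * (?N * p)))"
      using GL aP hGL by (simp add: ut assoc52 nn_swap refl_self)
    also have "u (rneg a) s * (?N * p) = ?N * (u (rneg ?r) s * p)"
    proof -
      have "u (rneg a) s * (?N * p) = u (rneg a) s * ?N * p" using GL by (simp add: assoc52)
      then show ?thesis
        unfolding u_nprod[OF sw neg] word_inv_rneg[OF sw aP(1)] using GL by (simp add: assoc52)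
    qed
    also have "h * (?N * (u (rneg ?r) s * p)) = ?N * (h' * (u (rneg ?r) s * p))"
    proof -
      have "h * (?N * (u (rneg ?r) s * p)) = h * ?N * (u (rneg ?r) s * p)" using GL hGL by (simp add: assoc52)
      then show ?thesis unfolding h'(2) using GL hGL by (simp add: assoc52)
    qed
    also have "u a s * (?N * (h' * (u (rneg ?r) s * p))) = u a s * ?N * (h' * (u (rneg ?r) s * p))"
      using GL hGL by (simp add: assoc52)
    finally have eq: "nn a * (u a t * (?N * p)) = u a s * ?N * (h' * (u (rneg ?r) s * p))" .
    have "h' \<in> Pm" using h'(1) unfolding Pm_def Pgen_def by (intro grp_gen.gen_incl) simp
    moreover have "u (rneg ?r) s \<in> Pm" using False r s by (intro u_Pm) (simp_all add: adm_rneg)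
    moreover have "u a s \<in> Up" unfolding Up_def using aP s by (intro u_XX) simp_all
    ultimately show ?thesis unfolding eq using y(2,3) by (intro CellsI Pm_mult)
  qed
  have "nn a * g = (nn a * B * nn a) * (nn a * (u a t * (?N * p)))"
    using GL aP by (simp add: y(4) B(3) assoc52)
  then show ?thesis using Up_Cells[OF conj main] by simp
qed

text \<open>A root element for \<open>refl a r\<close> is the conjugate by \<open>nn a\<close> of
  one for r, and \<open>nn a\<close> preserves \<open>Cells\<close>.\<close>

lemma u_Cells: "r \<in> F4_Phi \<Longrightarrow> \<forall>t\<in>adm r. \<forall>g\<in>Cells. u r t * g \<in> Cells"
proof (induction r rule: root_induct)
  case short
  have "alpha2 \<in> {r \<in> F4_Phi. 0 < height r}"
    using simple_Phi simple_height by (simp add: simple_roots_def)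
  then have "u alpha2 t \<in> Up" if "t \<in> adm alpha2" for t
    using u_XX[OF _ that] by (simp add: Up_def)
  then show ?case using Up_Cells by simp
next
  case long
  have "alpha3 \<in> {r \<in> F4_Phi. 0 < height r}"
    using simple_Phi simple_height by (simp add: simple_roots_def)
  then have "u alpha3 t \<in> Up" if "t \<in> adm alpha3" for t
    using u_XX[OF _ that] by (simp add: Up_def)
  then show ?case using Up_Cells by simp
next
  case (refl a r)
  have a: "a \<in> refl_roots" using refl by (simp add: simple_refl)
  have adm: "adm (refl a r) = adm r"
    using long_refl[OF a even_tuple_Phi[OF refl.hyps(2)]] by (simp add: adm_def)
  show ?case
  proof (intro ballI)
    fix t g assume t: "t \<in> adm (refl a r)" and g: "g \<in> Cells"
    have gM: "g \<in> M52" using g Up_GL Pm_GL unfolding Cells_def by (auto simp: subset_iff)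
    have "u (refl a r) t * g = nn a * (u r t * (nn a * g))"
      using gM a refl_roots_Phi[OF a] refl.hyps(2) by (simp add: nn_swap)
    then show "u (refl a r) t * g \<in> Cells"
      using nn_Cells[OF refl.hyps(1)] refl.IH t g unfolding adm by simp
  qed
qed

definition cell_words :: "nat list set" where
  "cell_words = set (map snd reps)"

lemma bruhat:
  assumes "g \<in> XX F4_Phi"
  obtains p w p' where "p \<in> Pm" "w \<in> cell_words" "p' \<in> Pm" "g = p * nprod w * p'"
proof -
  have "g \<in> Cells"
    using Ugen_GL[OF subset_refl] Ugen_ginv[OF subset_refl] assms[unfolded XX_def]
  proof (induction rule: grp_gen_induct_left)
    case one
    have "rep 0 = []" by (simp only: rep_eval)
    then show ?case using CellsI[OF one_Up _ one_Pm, of 0] by simp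
  next
    case (mult A B)
    then show ?case using u_Cells unfolding Ugen_iff by blast
  qed
  then obtain y k p where y: "y \<in> Up" "k < 24" "p \<in> Pm" "g = y * nprod (rep k) * p"
    unfolding Cells_def by blast
  have len: "length reps = 24" by (simp add: reps_def)
  have "list_all (\<lambda>p. set (fst p) \<subseteq> {28, 13, 1}) reps" by (simp add: reps_def)
  then have "set (fst (reps ! k)) \<subseteq> {28, 13, 1}" using y(2) len by (simp only: list_all_length)
  then have "nprod (fst (reps ! k)) \<in> Pm" using nprod_Lm Lm_Pm by blast
  then have "y * nprod (fst (reps ! k)) \<in> Pm" using y(1) Up_Pm Pm_mult by blast
  moreover have "snd (reps ! k) \<in> cell_words" using y(2) len by (simp add: cell_words_def)
  moreover have "g = (y * nprod (fst (reps ! k))) * nprod (snd (reps ! k)) * p"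
    using y Up_GL Pm_GL by (simp add: rep_def nprod_append subset_iff assoc52)
  ultimately show ?thesis using that y(3) by blast
qed

end

section \<open>Weights of matrix entries\<close>

definition wt :: "root4 \<Rightarrow> nat \<Rightarrow> int" where
  "wt v i = ip (weight i) v"

text \<open>The difference from the identity raises weights along v by at least c, whereas
  \<open>noninc\<close> forbids raising them at all. For positive c a matrix with both properties is
  the identity; this separates factors of positive, zero and negative level.\<close>

definition unip :: "root4 \<Rightarrow> int \<Rightarrow> 'a::field mat \<Rightarrow> bool" where
  "unip v c A \<longleftrightarrow> A \<in> M52 \<and> (\<forall>i<52. \<forall>j<52. wt v i < wt v j + c \<longrightarrow> A $$ (i, j) = (if i = j then 1 else 0))"

definition noninc :: "root4 \<Rightarrow> 'a::field mat \<Rightarrow> bool" where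
  "noninc v A \<longleftrightarrow> A \<in> M52 \<and> (\<forall>i<52. \<forall>j<52. wt v j < wt v i \<longrightarrow> A $$ (i, j) = 0)"

lemma unip_one: "0 < c \<Longrightarrow> unip v c (1\<^sub>m 52)"
  by (simp add: unip_def)

lemma unip_mult:
  assumes "unip v c A" "unip v c B" "0 < c" shows "unip v c (A * B)"
  unfolding unip_def
proof (intro conjI allI impI)
  have M: "A \<in> M52" "B \<in> M52" using assms by (simp_all add: unip_def)
  then show "A * B \<in> M52" by simp
  fix i j :: nat assume i: "i < 52" and j: "j < 52" and ij: "wt v i < wt v j + c"
  have A: "A $$ (i', j') = (if i' = j' then 1 else 0)" if "i' < 52" "j' < 52" "wt v i' < wt v j' + c" for i' j'
    using assms(1) that by (simp add: unip_def)
  have B: "B $$ (i', j') = (if i' = j' then 1 else 0)" if "i' < 52" "j' < 52" "wt v i' < wt v j' + c" for i' j'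
    using assms(2) that by (simp add: unip_def)
  have "A $$ (i, l) * B $$ (l, j) = (if l = i then if i = j then 1 else 0 else 0)" if l: "l < 52" for l
  proof (cases "l = i")
    case True
    then show ?thesis using A[OF i i] B[OF i j ij] assms(3) by simp
  next
    case False
    show ?thesis
    proof (cases "wt v i < wt v l + c")
      case True
      then show ?thesis using A[OF i l] False by simp
    next
      case lc: False
      then have "B $$ (l, j) = (if l = j then 1 else 0)" using B[OF l j] ij assms(3) by simp
      moreover have "A $$ (i, l) = 0" if "l = j" using A[OF i j ij] that False by simp
      ultimately show ?thesis using False by auto
    qed
  qed
  then have "(\<Sum>l<52. A $$ (i, l) * B $$ (l, j)) = (\<Sum>l<52. if l = i then if i = j then 1 else 0 else 0)"
    by (intro sum.cong) simp_all
  also have "\<dots> = (if i = j then 1 else 0)" using i by simp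
  finally show "(A * B) $$ (i, j) = (if i = j then 1 else 0)"
    using mult_entry[OF M i j] by simp
qed

lemma noninc_mult:
  assumes "noninc v A" "noninc v B" shows "noninc v (A * B)"
  unfolding noninc_def
proof (intro conjI allI impI)
  have M: "A \<in> M52" "B \<in> M52" using assms by (simp_all add: noninc_def)
  then show "A * B \<in> M52" by simp
  fix i j :: nat assume i: "i < 52" and j: "j < 52" and ij: "wt v j < wt v i"
  have "A $$ (i, l) * B $$ (l, j) = 0" if l: "l < 52" for l
  proof (cases "wt v l < wt v i")
    case True
    then show ?thesis using assms(1) i l by (simp add: noninc_def)
  next
    case False
    then show ?thesis using assms(2) ij j l by (simp add: noninc_def)
  qed
  then show "(A * B) $$ (i, j) = 0" unfolding mult_entry[OF M i j] by (intro sum.neutral ballI) simp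
qed

lemma noninc_one: "noninc v (1\<^sub>m 52)"
  by (auto simp: noninc_def)

lemma unip_noninc_one:
  assumes "unip v c A" "noninc v A" "0 < c" shows "A = 1\<^sub>m 52"
proof (rule eq_matI)
  have "A \<in> M52" using assms by (simp add: unip_def)
  then show "dim_row A = dim_row (1\<^sub>m 52)" "dim_col A = dim_col (1\<^sub>m 52)" by auto
  fix i j assume "i < dim_row (1\<^sub>m 52 :: 'a mat)" "j < dim_col (1\<^sub>m 52 :: 'a mat)"
  then have ij: "i < 52" "j < 52" by simp_all
  show "A $$ (i, j) = 1\<^sub>m 52 $$ (i, j)"
  proof (cases "wt v i < wt v j + c")
    case True
    then show ?thesis using assms(1) ij by (simp add: unip_def)
  next
    case False
    then have "wt v j < wt v i" "i \<noteq> j" using assms(3) by auto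
    then show ?thesis using assms(2) ij by (simp add: noninc_def)
  qed
qed

lemma wt_rneg: "wt (rneg v) i = - wt v i"
  by (simp add: wt_def rneg_rscale)

lemma unip_rneg_noninc: "unip (rneg v) c A \<Longrightarrow> 0 < c \<Longrightarrow> noninc v A"
  by (auto simp: unip_def noninc_def wt_rneg)

lemma wt_e4: "r \<in> F4_Phi \<Longrightarrow> ip r e4 = 2 * level r"
  by (cases r) (simp add: ip_def e4_def level_def)

lemma u_entry_zero:
  assumes n: "n < 48" and ij: "i < 52" "j < 52" "i \<noteq> j"
    and z: "\<And>k. 0 < k \<Longrightarrow> weight i \<noteq> radd (weight j) (rscale k (F4_roots ! n))"
  shows "u_el (F4_roots ! n) (t::'a::field) $$ (i, j) = 0"
proof -
  have "(\<Sum>e\<leftarrow>C. if fst e = i then t powi snd e else 0) = (0::'a)" if "set C \<subseteq> set (ucol n j)" for C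
    using that
  proof (induction C)
    case (Cons e C)
    have e: "(fst e, snd e) \<in> set (ucol n j)" using Cons.prems by simp
    have "0 < snd e" using ucolD(5)[OF e] by auto
    then have "fst e \<noteq> i" using ucolD(6)[OF e] z weight_root[OF n] by auto
    then show ?case using Cons by simp
  qed simp
  from this[OF subset_refl] show ?thesis using u_entry[OF n ij(1,2), of t] ij(3) by simp
qed

lemma u_diag:
  assumes n: "n < 48" and i: "i < 52"
  shows "u_el (F4_roots ! n) (t::'a::field) $$ (i, i) = 1"
proof -
  have "(\<Sum>e\<leftarrow>C. if fst e = i then t powi snd e else 0) = (0::'a)" if "set C \<subseteq> set (ucol n i)" for C
    using that
  proof (induction C)
    case (Cons e C)
    then have "fst e \<noteq> i" using ucolD(4)[of "fst e" "snd e" n i] by auto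
    then show ?case using Cons by simp
  qed simp
  from this[OF subset_refl] show ?thesis using u_entry[OF n i i, of t] by simp
qed

lemma wt_radd: "weight i = radd (weight j) (rscale k r) \<Longrightarrow> wt v i = wt v j + k * ip r v"
  by (simp add: wt_def)

lemma u_unip:
  assumes "r \<in> F4_Phi" "0 < c" "c \<le> ip r v" shows "unip v c (u_el r (t::'a::field))"
  unfolding unip_def
proof (intro conjI allI impI)
  obtain n where n: "n < 48" "r = F4_roots ! n" using assms(1) by (rule Phi_cases)
  fix i j :: nat assume i: "i < 52" and j: "j < 52" and ij: "wt v i < wt v j + c"
  show "u_el r t $$ (i, j) = (if i = j then 1 else 0)"
  proof (cases "i = j")
    case False
    have "weight i \<noteq> radd (weight j) (rscale k r)" if "0 < k" for k
    proof
      assume "weight i = radd (weight j) (rscale k r)"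
      then have "wt v i = wt v j + k * ip r v" by (rule wt_radd)
      moreover have "1 * ip r v \<le> k * ip r v" using that assms by (intro mult_right_mono) auto
      ultimately show False using ij assms by simp
    qed
    then show ?thesis using u_entry_zero[OF n(1) i j False] n(2) False by simp
  qed (use u_diag[OF n(1) i] n(2) in simp)
qed simp

lemma u_noninc:
  assumes "r \<in> F4_Phi" "ip r v \<le> 0" shows "noninc v (u_el r (t::'a::field))"
  unfolding noninc_def
proof (intro conjI allI impI)
  obtain n where n: "n < 48" "r = F4_roots ! n" using assms(1) by (rule Phi_cases)
  fix i j :: nat assume i: "i < 52" and j: "j < 52" and ij: "wt v j < wt v i"
  have "weight i \<noteq> radd (weight j) (rscale k r)" if "0 < k" for k
  proof
    assume "weight i = radd (weight j) (rscale k r)"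
    then have "wt v i = wt v j + k * ip r v" by (rule wt_radd)
    moreover have "k * ip r v \<le> 0" using that assms by (simp add: mult_nonneg_nonpos)
    ultimately show False using ij by simp
  qed
  moreover have "i \<noteq> j" using ij by auto
  ultimately show "u_el r t $$ (i, j) = 0" using u_entry_zero[OF n(1) i j] n(2) by simp
qed simp

context char2
begin

lemma word_inv_surj:
  assumes "simple_word ws" "s \<in> F4_Phi"
  obtains r where "r \<in> F4_Phi" "word_inv ws r = s"
proof -
  have "\<exists>r\<in>F4_Phi. word_inv ws r = s"
    using assms(1)
  proof (induction ws)
    case Nil
    then show ?case using assms(2) by simp
  next
    case (Cons a ws)
    have a: "F4_roots ! a \<in> refl_roots" using Cons.prems by (intro index_refl) simp
    obtain r where r: "r \<in> F4_Phi" "word_inv ws r = s" using Cons by auto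
    then show ?case
      using refl_Phi[OF a r(1)] refl_refl[OF a even_tuple_Phi[OF r(1)]]
      by (intro bexI[of _ "refl (F4_roots ! a) r"]) simp_all
  qed
  then show ?thesis using that by blast
qed

end

section \<open>Coordinates on Z and its quadratic form\<close>

definition zlist :: "nat list" where
  "zlist = [30, 8, 10, 16, 18, 20, 22]"

lemma level2_zlist: "{r \<in> F4_Phi. level r = 2} = (!) F4_roots ` set zlist"
proof -
  have "list_all (\<lambda>n. level (F4_roots ! n) = 2 \<longleftrightarrow> n \<in> set zlist) idx48"
    unfolding idx48_def list.pred_inject
    by (simp add: roots_nth[simplified] level_def zlist_def)
  then have l: "level (F4_roots ! n) = 2 \<longleftrightarrow> n \<in> set zlist" if "n < 48" for n
    using that by (simp add: list_all_iff idx48)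
  have z: "n < 48" if "n \<in> set zlist" for n using that by (auto simp: zlist_def)
  show ?thesis
  proof (intro equalityI subsetI)
    fix r assume "r \<in> {r \<in> F4_Phi. level r = 2}"
    then have r: "r \<in> F4_Phi" "level r = 2" by simp_all
    then obtain n where "n < 48" "r = F4_roots ! n" by (auto elim: Phi_cases)
    then show "r \<in> (!) F4_roots ` set zlist" using l r(2) by blast
  next
    fix r assume "r \<in> (!) F4_roots ` set zlist"
    then obtain n where "n \<in> set zlist" "r = F4_roots ! n" by blast
    then show "r \<in> {r \<in> F4_Phi. level r = 2}" using l z by simp
  qed
qed

lemma zlist_bound: "n \<in> set zlist \<Longrightarrow> n < 48"
  by (auto simp: zlist_def)

lemma zlist_level: "n \<in> set zlist \<Longrightarrow> F4_roots ! n \<in> F4_Phi \<and> level (F4_roots ! n) = 2"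
  using level2_zlist by blast

context char2
begin

text \<open>A commutator factor would be a root of level at least 3.\<close>

lemma u_commute:
  assumes "r \<in> F4_Phi" "s \<in> F4_Phi" "0 < level r" "2 \<le> level s"
  shows "u r t * u s x = u s x * u r t"
proof -
  have ok: "comm_ok r s" using assms by (intro comm_ok) auto
  have "comm_list r s = []"
  proof (rule ccontr)
    assume "comm_list r s \<noteq> []"
    then obtain e where e: "e \<in> set (comm_list r s)" using list.set_sel(1) by blast
    obtain q i j where q: "e = (q, i, j)" by (cases e)
    have "q \<in> F4_Phi" using ok e q unfolding comm_ok_def by force
    then have "level q \<le> 2" using level_bound by blast
    moreover have "level q = int i * level r + int j * level s" "0 < i" "0 < j"
      using comm_list_pos[of q i j r s] e q by simp_all
    moreover have "1 * level r \<le> int i * level r" "1 * level s \<le> int j * level s"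
      using calculation assms by (auto intro!: mult_right_mono)
    ultimately show False using assms by simp
  qed
  then have "u r t * (u s x * u r t) = u s x"
    using ok by (simp add: comm_ok_def comm_word_def)
  then have "u r t * (u s x * u r t) * u r t = u s x * u r t" by simp
  then show ?thesis using assms(1) by (simp add: assoc52)
qed

definition zprod :: "nat list \<Rightarrow> (nat \<Rightarrow> 'a) \<Rightarrow> 'a mat" where
  "zprod ns f = prodl (map (\<lambda>n. u (F4_roots ! n) (f n)) ns)"

abbreviation zmat :: "(nat \<Rightarrow> 'a) \<Rightarrow> 'a mat" where
  "zmat \<equiv> zprod zlist"

lemma zprod_simps [simp]: "zprod [] f = 1\<^sub>m 52" "zprod (n # ns) f = u (F4_roots ! n) (f n) * zprod ns f"
  by (simp_all add: zprod_def)

lemma zprod_carrier [simp]: "zprod ns f \<in> M52"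
  by (induction ns) simp_all

lemma zprod_commute:
  assumes "r \<in> F4_Phi" "0 < level r" "set ns \<subseteq> set zlist"
  shows "u r t * zprod ns f = zprod ns f * u r t"
  using assms(3)
proof (induction ns)
  case (Cons n ns)
  have c: "u r t * u (F4_roots ! n) x = u (F4_roots ! n) x * u r t" for x
    using Cons.prems zlist_level[of n] assms by (intro u_commute) auto
  have "u r t * (u (F4_roots ! n) (f n) * zprod ns f) = u (F4_roots ! n) (f n) * (u r t * zprod ns f)"
    using c[of "f n"] by (simp add: assoc52[symmetric])
  then show ?case using Cons by (simp add: assoc52)
qed (use assms in simp)

lemma zprod_add:
  assumes "set ns \<subseteq> set zlist"
  shows "zprod ns f * zprod ns g = zprod ns (\<lambda>n. f n + g n)"
  using assms
proof (induction ns)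
  case (Cons n ns)
  have n: "F4_roots ! n \<in> F4_Phi" "level (F4_roots ! n) = 2" using Cons.prems zlist_level[of n] by auto
  let ?u = "u (F4_roots ! n)"
  have "?u (f n) * zprod ns f * (?u (g n) * zprod ns g) = ?u (f n) * (zprod ns f * ?u (g n)) * zprod ns g"
    by (simp add: assoc52)
  also have "\<dots> = ?u (f n) * (?u (g n) * zprod ns f) * zprod ns g"
    using zprod_commute[OF n(1), of ns "g n" f] n Cons.prems by simp
  also have "\<dots> = (?u (f n) * ?u (g n)) * (zprod ns f * zprod ns g)"
    by (simp add: assoc52)
  finally show ?case using Cons n by (simp add: u_add)
qed simp

lemma zprod_single:
  assumes "set ns \<subseteq> set zlist" "distinct ns" "m \<in> set zlist"
  shows "zprod ns (\<lambda>n. if n = m then x else 0) = (if m \<in> set ns then u (F4_roots ! m) x else 1\<^sub>m 52)"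
  using assms
proof (induction ns)
  case (Cons n ns)
  then show ?case using zlist_level[of n] by auto
qed simp

lemma zmat_single: "m \<in> set zlist \<Longrightarrow> u (F4_roots ! m) x = zmat (\<lambda>n. if n = m then x else 0)"
  using zprod_single[of zlist m x] by (simp add: zlist_def)

lemma zmat_add: "zmat f * zmat g = zmat (\<lambda>n. f n + g n)"
  by (rule zprod_add) simp

lemma zmat_sq: "zmat f * zmat f = 1\<^sub>m 52"
  unfolding zmat_add by (simp add: zlist_def)

definition zcol :: "(nat \<Rightarrow> 'a) \<Rightarrow> (nat \<times> 'a) list \<Rightarrow> (nat \<times> 'a) list" where
  "zcol f V = acts 30 (f 30) (acts 8 (f 8) (acts 10 (f 10) (acts 16 (f 16) (acts 18 (f 18) (acts 20 (f 20) (acts 22 (f 22) V))))))"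

lemma zmat_colv:
  assumes B: "B \<in> M52" and i: "i < 52" and j: "j < 52"
    and V: "\<And>e. e \<in> set V \<Longrightarrow> fst e < 52" and BV: "\<And>l. l < 52 \<Longrightarrow> B $$ (l, j) = colv V l"
  shows "(zmat f * B) $$ (i, j) = colv (zcol f V) i"
proof -
  have "(prodl (map (\<lambda>n. u (F4_roots ! n) (f n)) ns) * B) $$ (l, j) = colv (foldr (\<lambda>n. acts n (f n)) ns V) l \<and>
      (\<forall>e\<in>set (foldr (\<lambda>n. acts n (f n)) ns V). fst e < 52)"
    if "l < 52" "set ns \<subseteq> set zlist" for ns l
    using that
  proof (induction ns arbitrary: l)
    case Nil
    then show ?case using B BV V by simp
  next
    case (Cons n ns)
    let ?Q = "prodl (map (\<lambda>n. u (F4_roots ! n) (f n)) ns)" and ?W = "foldr (\<lambda>n. acts n (f n)) ns V"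
    have Q: "?Q \<in> M52" by (rule prodl_carrier) auto
    have n: "n < 48" using Cons.prems zlist_bound by simp
    have IH: "(?Q * B) $$ (l, j) = colv ?W l" "\<forall>e\<in>set ?W. fst e < 52" if "l < 52" for l
      using Cons.IH[OF that] Cons.prems by simp_all
    have "(u (F4_roots ! n) (f n) * (?Q * B)) $$ (l, j) = colv (acts n (f n) ?W) l"
      using IH Cons.prems(1) Q B by (intro u_mult_colv[OF n _ _ j]) simp_all
    moreover have "\<forall>e\<in>set (acts n (f n) ?W). fst e < 52"
      using acts_bounded[of ?W _ n "f n"] IH(2)[OF Cons.prems(1)] by blast
    ultimately show ?case using Q B by (simp add: assoc52)
  qed
  from this[OF i subset_refl] show ?thesis by (simp add: zprod_def zlist_def zcol_def)
qed

lemmas acts_rules = acts_def ucol_rules list.map concat.simps append.simps fst_conv snd_conv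

text \<open>Column 31 belongs to the root -e4. The seven coordinates of z appear in the rows 24 to
  29, for e_i and -e_i, and in row 49, for the coroot of alpha2. Row 30, for e4, collects the
  quadratic form.\<close>

lemma zcol_31: "zcol f [(31, 1)] = [(31, 1), (30, f 30 ^ 2), (49, f 30), (24, f 8), (25, f 10), (30, f 8 * f 10),
    (26, f 16), (27, f 18), (30, f 16 * f 18), (28, f 20), (29, f 22), (30, f 20 * f 22)]"
  unfolding zcol_def by (simp only: acts_rules) (simp add: power_int_def)

lemma zmat_31: "i < 52 \<Longrightarrow> zmat f $$ (i, 31) = colv (zcol f [(31, 1)]) i"
proof -
  assume i: "i < 52"
  have "(zmat f * 1\<^sub>m 52) $$ (i, 31) = colv (zcol f [(31, 1)]) i"
    using i by (intro zmat_colv) auto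
  then show ?thesis by simp
qed

text \<open>After e4 the roots of \<open>zlist\<close> come in pairs e_i + e4, -e_i + e4 with sum 2
  e4; each pair contributes a hyperbolic plane.\<close>

definition zq :: "(nat \<Rightarrow> 'a) \<Rightarrow> 'a" where
  "zq f = f 30 ^ 2 + f 8 * f 10 + f 16 * f 18 + f 20 * f 22"

lemma zmat_coords:
  "zmat f $$ (49, 31) = f 30" "zmat f $$ (24, 31) = f 8" "zmat f $$ (25, 31) = f 10"
  "zmat f $$ (26, 31) = f 16" "zmat f $$ (27, 31) = f 18" "zmat f $$ (28, 31) = f 20" "zmat f $$ (29, 31) = f 22"
  "zmat f $$ (30, 31) = zq f"
  by (simp_all add: zmat_31 zcol_31 zq_def)

lemma zmat_inj:
  assumes "zmat f = zmat g" "n \<in> set zlist" shows "f n = g n"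
proof -
  have "f n = zmat f $$ (if n = 30 then 49 else if n = 8 then 24 else if n = 10 then 25 else if n = 16 then 26
      else if n = 18 then 27 else if n = 20 then 28 else 29, 31)" for f
  proof -
    have "n \<in> {30, 8, 10, 16, 18, 20, 22}" using assms(2) by (simp add: zlist_def)
    then show ?thesis by (auto simp: zmat_coords simp del: index_mult_mat)
  qed
  then show ?thesis using assms(1) by metis
qed

text \<open>The four columns of z * u_v(1), for the root v = (e1 + e2 - e3 - e4) / 2, which isolate the
  coordinates of z that are negative on v.\<close>
lemma zcol_35:
  "colv (zcol f ((44, 1) # map (\<lambda>x. (fst x, 1)) (ucol 35 44))) 30 = f 30"
  "colv (zcol f ((36, 1) # map (\<lambda>x. (fst x, 1)) (ucol 35 36))) 30 = f 10"
  "colv (zcol f ((40, 1) # map (\<lambda>x. (fst x, 1)) (ucol 35 40))) 30 = f 18"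
  "colv (zcol f ((46, 1) # map (\<lambda>x. (fst x, 1)) (ucol 35 46))) 30 = f 20"
  unfolding zcol_def by (simp_all only: acts_rules) (simp_all add: power_int_def)

lemma zmat_35:
  assumes "j < 52"
  shows "(zmat f * u (F4_roots ! 35) 1) $$ (30, j) = colv (zcol f ((j, 1) # map (\<lambda>x. (fst x, 1)) (ucol 35 j))) 30"
proof (rule zmat_colv)
  have 1: "(u (F4_roots ! 35) 1 * 1\<^sub>m 52) $$ (l, j) = colv (acts 35 1 [(j, 1)]) l" if "l < 52" for l
    using that assms by (intro u_mult_colv) auto
  have 2: "acts 35 1 [(j, 1)] = (j, 1) # map (\<lambda>x. (fst x, 1)) (ucol 35 j)"
    by (simp add: acts_def)
  show "u (F4_roots ! 35) 1 $$ (l, j) = colv ((j, 1) # map (\<lambda>x. (fst x, 1)) (ucol 35 j)) l" if "l < 52" for l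
    using 1[OF that] unfolding 2 by simp
  show "fst e < 52" if "e \<in> set ((j, 1) # map (\<lambda>x. (fst x, 1 :: 'a)) (ucol 35 j))" for e
    using that assms ucolD(2)[of _ _ 35 j] by auto
qed (use assms in simp_all)

end

lemma wt_values:
  "wt e4 30 = 4" "wt e4 31 = -4" "wt e4 49 = 0" "wt e4 24 = 0" "wt e4 25 = 0" "wt e4 26 = 0" "wt e4 27 = 0"
  "wt e4 28 = 0" "wt e4 29 = 0" "wt e4 44 = 2" "wt e4 36 = 2" "wt e4 40 = 2" "wt e4 46 = 2"
  by (simp_all add: wt_def weight_eval[simplified] ip_def e4_def)

text \<open>A long root of Phi_J plus e4 or -e4 is not a root. For a short root of Phi_J the sum is
  a root, but the structure constant is 2 up to sign and vanishes. So these root elements fix the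
  vectors of e4 and -e4.\<close>

lemma level0_col31:
  assumes "n < 48" "level (F4_roots ! n) = 0" shows "ucol n 31 = [] \<and> ucol n 30 = []"
proof -
  have "list_all (\<lambda>n. level (F4_roots ! n) = 0 \<longrightarrow> ucol n 31 = [] \<and> ucol n 30 = []) idx48"
    unfolding idx48_def list.pred_inject
    by (simp only: ucol_rules roots_nth level_def prod.case num_rules) simp
  then show ?thesis using assms by (simp add: list_all_iff idx48)
qed

context mixed
begin

lemma grp_unip:
  assumes R: "R \<subseteq> F4_Phi" and c: "0 < c" and ip: "\<And>r. r \<in> R \<Longrightarrow> c \<le> ip r v" and A: "A \<in> XX R"
  shows "unip v c A"
  using Ugen_GL[OF R] Ugen_ginv[OF R] A[unfolded XX_def]
proof (induction rule: grp_gen_induct_left)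
  case one
  show ?case using c by (rule unip_one)
next
  case (mult A B)
  obtain r t where r: "r \<in> R" "A = u r t" using mult(1) unfolding Ugen_iff by blast
  have "unip v c A" unfolding r(2) using r(1) R ip c by (intro u_unip) auto
  then show ?case using mult.IH c by (rule unip_mult)
qed

lemma grp_noninc:
  assumes S: "S \<subseteq> GL52" "\<forall>A\<in>S. ginv A \<in> S" and gen: "\<And>A. A \<in> S \<Longrightarrow> noninc v A" and A: "A \<in> grp_gen S"
  shows "noninc v A"
  using S A
proof (induction rule: grp_gen_induct_left)
  case one
  show ?case by (rule noninc_one)
next
  case (mult A B)
  then show ?case using gen noninc_mult by blast
qed

lemma Tgen_diag: "h \<in> Tgen \<Longrightarrow> i < 52 \<Longrightarrow> j < 52 \<Longrightarrow> i \<noteq> j \<Longrightarrow> h $$ (i, j) = 0"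
  by (metis TgenE torus_diag)

text \<open>Taking both signs, elements of \<open>Lm\<close> preserve the grading of the module by
  the e4-coordinate.\<close>

lemma Lm_noninc:
  assumes v: "v \<in> {e4, rneg e4}" and l: "l \<in> Lm" shows "noninc v l"
proof (rule grp_noninc[OF Lgen_GL Lgen_ginv _ l[unfolded Lm_def]])
  fix A assume "A \<in> Lgen"
  then consider "A \<in> Tgen" | r t where "r \<in> F4_Phi" "level r = 0" "A = u r t"
    unfolding Lgen_def Un_iff Ugen_iff by blast
  then show "noninc v A"
  proof cases
    case 1
    then have "A \<in> M52" using Tgen_GL by auto
    moreover have "A $$ (i, j) = 0" if "i < 52" "j < 52" "wt v j < wt v i" for i j
      using Tgen_diag[OF 1 that(1,2)] that(3) by auto
    ultimately show ?thesis by (simp add: noninc_def)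
  next
    case 2
    have "ip r v = 0" using v wt_e4[OF 2(1)] 2(2) by (auto simp: rneg_rscale)
    then show ?thesis unfolding 2(3) using 2(1) by (intro u_noninc) simp_all
  qed
qed

lemma Lm_cols:
  assumes l: "l \<in> Lm" and i: "i < 52"
  shows "i \<noteq> 31 \<Longrightarrow> l $$ (i, 31) = 0"
proof -
  have "\<forall>i<52. i \<noteq> 31 \<longrightarrow> l $$ (i, 31) = 0"
    using Lgen_GL Lgen_ginv l[unfolded Lm_def]
  proof (induction rule: grp_gen_induct_left)
    case one
    show ?case by simp
  next
    case (mult A B)
    have M: "A \<in> M52" "B \<in> M52" using mult Lgen_GL grp_gen_GL[OF Lgen_GL] by auto
    have A: "A $$ (i, 31) = 0" if "i < 52" "i \<noteq> 31" for i
    proof -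
      consider "A \<in> Tgen" | r t where "r \<in> F4_Phi" "level r = 0" "A = u r t"
        using mult(1) unfolding Lgen_def Un_iff Ugen_iff by blast
      then show ?thesis
      proof cases
        case 1
        show ?thesis using Tgen_diag[OF 1 that(1) _ that(2)] by simp
      next
        case 2
        obtain n where n: "n < 48" "r = F4_roots ! n" using 2(1) by (rule Phi_cases)
        then have "ucol n 31 = []" using level0_col31 2(2) by simp
        then show ?thesis using u_entry[OF n(1) that(1), of 31 t] that(2) n(2) 2(3) by simp
      qed
    qed
    show ?case
    proof (intro allI impI)
      fix i :: nat assume i: "i < 52" "i \<noteq> 31"
      have "A $$ (i, l) * B $$ (l, 31) = 0" if "l < 52" for l
        using A[OF i] mult.IH that by (cases "l = 31") auto
      then show "(A * B) $$ (i, 31) = 0"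
        unfolding mult_entry[OF M i(1), of 31, simplified] by (intro sum.neutral ballI) simp
    qed
  qed
  then show "i \<noteq> 31 \<Longrightarrow> l $$ (i, 31) = 0" using i by simp
qed

lemma Zm_zmat:
  assumes "z \<in> Zm"
  obtains f where "z = zmat f" "\<And>n. n \<in> set zlist \<Longrightarrow> f n \<in> adm (F4_roots ! n)"
proof -
  have R: "{r \<in> F4_Phi. level r = 2} \<subseteq> F4_Phi" by blast
  have "\<exists>f. z = zmat f \<and> (\<forall>n\<in>set zlist. f n \<in> adm (F4_roots ! n))"
    using Ugen_GL[OF R] Ugen_ginv[OF R] assms[unfolded Zm_def XX_def]
  proof (induction rule: grp_gen_induct_left)
    case one
    show ?case by (intro exI[of _ "\<lambda>n. 0"]) (simp add: zlist_def)
  next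
    case (mult A B)
    obtain f where f: "B = zmat f" "\<forall>n\<in>set zlist. f n \<in> adm (F4_roots ! n)" using mult.IH by blast
    obtain r t where r: "r \<in> (!) F4_roots ` set zlist" "t \<in> adm r" "A = u r t"
      using mult(1) unfolding Ugen_iff level2_zlist by blast
    obtain m where m: "m \<in> set zlist" "r = F4_roots ! m" using r(1) by blast
    have "A * B = zmat (\<lambda>n. (if n = m then t else 0) + f n)"
      unfolding r(3) m(2) f(1) zmat_single[OF m(1)] zmat_add ..
    moreover have "\<forall>n\<in>set zlist. (if n = m then t else 0) + f n \<in> adm (F4_roots ! n)"
      using f(2) r(2) m(2) by (auto intro: adm_closed)
    ultimately show ?case by blast
  qed
  then show ?thesis using that by blast
qed

lemma Zm_entry:
  assumes "z \<in> Zm" "i < 52" "wt e4 i = 4" "i \<noteq> 30" shows "z $$ (i, 31) = 0"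
proof -
  obtain f where f: "z = zmat f" using Zm_zmat[OF assms(1)] by blast
  have "colv (zcol f [(31, 1)]) i = 0"
    using assms(3,4) wt_values unfolding zcol_31 by (intro colv_outside) auto
  then show ?thesis using zmat_31[OF assms(2)] f by simp
qed

lemma Um_Zm_commute:
  assumes "x \<in> Um" "z \<in> Zm" shows "x * z = z * x"
proof -
  obtain f where f: "z = zmat f" using Zm_zmat[OF assms(2)] by blast
  have R: "{r \<in> F4_Phi. 0 < level r} \<subseteq> F4_Phi" by blast
  show ?thesis
    using Ugen_GL[OF R] Ugen_ginv[OF R] assms(1)[unfolded Um_def XX_def]
  proof (induction rule: grp_gen_induct_left)
    case one
    show ?case unfolding f by simp
  next
    case (mult A B)
    obtain r t where r: "r \<in> F4_Phi" "0 < level r" "A = u r t"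
      using mult(1) unfolding Ugen_iff by blast
    have B: "B \<in> M52" using mult(2) grp_gen_GL[OF Ugen_GL[OF R]] by auto
    have A: "A * z = z * A" unfolding r(3) f by (rule zprod_commute[OF r(1,2)]) simp
    have "A * B * z = A * (z * B)" using B mult.IH r(3) f by (simp add: assoc52)
    also have "\<dots> = (A * z) * B" using B r(3) f by (simp add: assoc52)
    also have "\<dots> = z * (A * B)" unfolding A using B r(3) f by (simp add: assoc52)
    finally show ?case .
  qed
qed

text \<open>The entry for the basis vectors of e4 and -e4; on Z it is the quadratic form zq.\<close>
definition singular :: "'a mat \<Rightarrow> bool" where
  "singular z \<longleftrightarrow> z $$ (30, 31) = 0"

text \<open>On the right, the inverse of l multiplies column 31 by a scalar. On the left, row 30 of
  l meets only rows of the top level, and there column 31 of z has no entry except in row 30. So the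
  entry in question is multiplied by a scalar.\<close>

lemma singular_Lm:
  assumes l: "l \<in> Lm" and z: "z \<in> Zm" "singular z" shows "singular (l * z * ginv l)"
proof -
  have GL: "l \<in> GL52" "z \<in> GL52" using l z Lm_GL Zm_GL by auto
  have gl: "ginv l \<in> Lm" using grp_gen_ginv[OF Lgen_GL] l unfolding Lm_def by blast
  have M: "l * z \<in> M52" "ginv l \<in> M52" "l \<in> M52" "z \<in> M52" using GL by simp_all
  have "(l * z * ginv l) $$ (30, 31) = (\<Sum>k<52. (l * z) $$ (30, k) * ginv l $$ (k, 31))"
    by (rule mult_entry[OF M(1,2)]) simp_all
  also have "\<dots> = (\<Sum>k<52::nat. if k = 31 then (l * z) $$ (30, 31) * ginv l $$ (31, 31) else 0)"
    using Lm_cols[OF gl] by (intro sum.cong) auto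
  also have "\<dots> = (l * z) $$ (30, 31) * ginv l $$ (31, 31)" by simp
  also have "(l * z) $$ (30, 31) = (\<Sum>k<52. l $$ (30, k) * z $$ (k, 31))"
    by (rule mult_entry[OF M(3,4)]) simp_all
  also have "\<dots> = 0"
  proof (rule sum.neutral, rule ballI)
    fix k :: nat assume "k \<in> {..<52}"
    then have k: "k < 52" by simp
    show "l $$ (30, k) * z $$ (k, 31) = 0"
    proof (cases "k = 30")
      case True
      then show ?thesis using z(2) by (simp add: singular_def)
    next
      case False
      show ?thesis
      proof (cases "wt e4 k = 4")
        case True
        then show ?thesis using Zm_entry[OF z(1) k True False] by simp
      next
        case wk: False
        have "noninc e4 l" "noninc (rneg e4) l" using Lm_noninc l by blast+
        then have "l $$ (30, k) = 0"
          using wk k wt_values(1) by (cases "wt e4 k < 4") (auto simp: noninc_def wt_rneg)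
        then show ?thesis by simp
      qed
    qed
  qed
  finally show ?thesis by (simp add: singular_def)
qed

text \<open>\<open>Um\<close> centralises \<open>Zm\<close>, so p acts on z through its factor in
  \<open>Lm\<close>.\<close>

lemma singular_Pm:
  assumes p: "p \<in> Pm" and z: "z \<in> Zm" "singular z" shows "singular (p * z * ginv p)"
proof -
  obtain x l where xl: "x \<in> Um" "l \<in> Lm" "p = x * l" using Pm_decomp[OF p] by blast
  have GL: "x \<in> GL52" "l \<in> GL52" "z \<in> GL52" using xl z Um_GL Lm_GL Zm_GL by auto
  have lz: "l * z * ginv l \<in> Zm" using Zm_norm xl(2) Lm_Pm z(1) by blast
  have "p * z * ginv p = x * (l * z * ginv l) * ginv x" using GL by (simp add: xl(3) assoc52)
  also have "\<dots> = (l * z * ginv l) * x * ginv x" using Um_Zm_commute[OF xl(1) lz] by simp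
  also have "\<dots> = l * z * ginv l" using GL by (simp add: assoc52)
  finally show ?thesis using singular_Lm[OF xl(2) z] by simp
qed

lemma nprod_GL: "simple_word ws \<Longrightarrow> nprod ws \<in> GL52"
proof (induction ws)
  case (Cons a ws)
  have "F4_roots ! a \<in> F4_Phi" using Cons.prems by (intro refl_roots_Phi index_refl) simp
  then show ?case using Cons by simp
qed simp

text \<open>Here v is the image of e4 under the word. The roots of Z have product 4 with e4, so
  those of the conjugate have product 4 with v.\<close>

lemma nprod_Zm:
  assumes ws: "simple_word ws" and v: "v \<in> F4_Phi" "word_inv ws v = e4" and z: "z \<in> Zm"
  shows "nprod ws * z * ginv (nprod ws) \<in> XX {s \<in> F4_Phi. ip s v = 4}"
  unfolding XX_def
proof (rule grp_gen_conj[OF nprod_GL[OF ws] Ugen_GL])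
  show "{r \<in> F4_Phi. level r = 2} \<subseteq> F4_Phi" by blast
  show "z \<in> grp_gen (Ugen {r \<in> F4_Phi. level r = 2})" using z by (simp add: Zm_def XX_def)
  fix A assume "A \<in> Ugen {r \<in> F4_Phi. level r = 2}"
  then obtain r t where r: "r \<in> F4_Phi" "level r = 2" "t \<in> adm r" "A = u r t" unfolding Ugen_iff by blast
  obtain s where s: "s \<in> F4_Phi" "word_inv ws s = r" using word_inv_surj[OF ws r(1)] by blast
  have "u s t * nprod ws = nprod ws * A" using u_nprod[OF ws s(1), of t] s(2) r(4) by simp
  then have "nprod ws * A * ginv (nprod ws) = u s t * nprod ws * ginv (nprod ws)" by simp
  also have "\<dots> = u s t" using nprod_GL[OF ws] by (simp add: assoc52)
  finally have "nprod ws * A * ginv (nprod ws) = u s t" .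
  moreover have "ip s v = 4"
    using word_inv_ip[OF ws s(1) v(1)] s(2) v(2) wt_e4[OF r(1)] r(2) by simp
  moreover have "t \<in> adm s" using r(3) s word_inv_long[OF ws s(1)] by (simp add: adm_def)
  ultimately show "nprod ws * A * ginv (nprod ws) \<in> grp_gen (Ugen {s \<in> F4_Phi. ip s v = 4})"
    using u_XX[of s "{s \<in> F4_Phi. ip s v = 4}" t] s(1) by (simp add: XX_def)
qed

end

section \<open>The involution\<close>

lemma sigma_root_simps:
  "sigma_root (radd r s) = radd (sigma_root r) (sigma_root s)"
  "sigma_root (rscale n r) = rscale n (sigma_root r)"
  "sigma_root (rneg r) = rneg (sigma_root r)"
  "sigma_root (sigma_root r) = r"
  "ip (sigma_root r) (sigma_root s) = ip r s"
  by (cases r; cases s; simp add: sigma_root_def radd_def rscale_def rneg_def ip_def)+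

lemma sigma_long: "F4_long (sigma_root r) = F4_long r"
  by (simp add: long_ip sigma_root_simps)

lemma sigma_comm_list:
  "comm_list (sigma_root r) (sigma_root s) = map (\<lambda>(q, ij). (sigma_root q, ij)) (comm_list r s)"
  by (simp add: comm_list_def sigma_long sigma_root_simps)

context char2
begin

lemma u_nontrivial:
  assumes "r \<in> F4_Phi" "x \<noteq> 0" shows "u r x \<noteq> 1\<^sub>m 52"
proof -
  have "\<forall>x. x \<noteq> 0 \<longrightarrow> u r x \<noteq> 1\<^sub>m 52"
    using assms(1)
  proof (induction r rule: root_induct)
    case short
    \<comment> \<open>On the vector of -alpha2 the linear term is the coroot of alpha2, in row 49;
      its coefficient is the parameter.\<close>
    have "ucol 28 29 = [(28, 2), (49, 1)]" by (simp only: ucol_rules simp_thms)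
    then have "u alpha2 x $$ (49, 29) = x" for x
      unfolding roots_simple using u_entry[of 28 49 29 x] by simp
    then show ?case by (metis index_one_mat(1) numeral_eq_iff num.inject num.distinct rel_simps zero_neq_numeral)
  next
    case long
    have "ucol 13 14 = [(13, 2), (50, 1)]" by (simp only: ucol_rules simp_thms)
    then have "u alpha3 x $$ (50, 14) = x" for x
      unfolding roots_simple using u_entry[of 13 50 14 x] by simp
    then show ?case by (metis index_one_mat(1) numeral_eq_iff num.inject num.distinct rel_simps zero_neq_numeral)
  next
    case (refl a r)
    have a: "a \<in> refl_roots" using refl by (simp add: simple_refl)
    show ?case
    proof (intro allI impI notI)
      fix x :: 'a assume x: "x \<noteq> 0" "u (refl a r) x = 1\<^sub>m 52"
      have "nn a * u r x = nn a * 1\<^sub>m 52" using nn_u[OF a refl.hyps(2), of x] x(2) by simp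
      then have "u r x = 1\<^sub>m 52" by (rule nn_cancel_left[OF a, rotated 2]) simp_all
      then show False using refl.IH x(1) by blast
    qed
  qed
  then show ?thesis using assms(2) by blast
qed

lemma u_inj:
  assumes "r \<in> F4_Phi" "u r x = u r y" shows "x = y"
proof -
  have "u r (x + y) = 1\<^sub>m 52" using assms u_add[OF assms(1), of x y] by simp
  then show ?thesis using u_nontrivial[OF assms(1), of "x + y"] add_eq_0 by blast
qed

text \<open>An off-diagonal entry shifts weights by k a on one side and by l b on the other, with k
  and l in {1, 2}. The squared lengths 4 k^2 and 8 l^2 of these shifts never agree.\<close>

lemma u_indep:
  assumes a: "a \<in> F4_Phi" "\<not> F4_long a" and b: "b \<in> F4_Phi" "F4_long b" and eq: "u a x = u b y"
  shows "x = 0 \<and> y = 0"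
proof -
  obtain n m where n: "n < 48" "a = F4_roots ! n" and m: "m < 48" "b = F4_roots ! m"
    using a(1) b(1) by (metis Phi_cases)
  have "u a x = 1\<^sub>m 52"
  proof (rule eq_matI)
    fix i j assume "i < dim_row (1\<^sub>m 52 :: 'a mat)" "j < dim_col (1\<^sub>m 52 :: 'a mat)"
    then have ij: "i < 52" "j < 52" by simp_all
    show "u a x $$ (i, j) = 1\<^sub>m 52 $$ (i, j)"
    proof (cases "i = j")
      case True
      then show ?thesis using u_diag[OF n(1) ij(1)] n(2) ij by simp
    next
      case False
      show ?thesis
      proof (rule ccontr)
        assume "u a x $$ (i, j) \<noteq> 1\<^sub>m 52 $$ (i, j)"
        then have nz: "u a x $$ (i, j) \<noteq> 0" "u b y $$ (i, j) \<noteq> 0" using False ij eq by simp_all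
        have ent: "\<exists>k\<in>{1, 2}. weight i = radd (weight j) (rscale k (F4_roots ! n))"
          if "n < 48" "u (F4_roots ! n) t $$ (i, j) \<noteq> 0" for n t
        proof -
          have "\<exists>e\<in>set (ucol n j). fst e = i"
          proof (rule ccontr)
            assume none: "\<not> (\<exists>e\<in>set (ucol n j). fst e = i)"
            have "(\<Sum>e\<leftarrow>C. if fst e = i then t powi snd e else 0) = 0" if "set C \<subseteq> set (ucol n j)" for C
              using that none by (induction C) auto
            from this[OF subset_refl] show False using that u_entry[OF that(1) ij, of t] False by simp
          qed
          then obtain k where "(i, k) \<in> set (ucol n j)" by auto
          then show ?thesis using ucolD(5,6)[of i k n j] weight_root[OF that(1)] by auto
        qed
        obtain k l where k: "k \<in> {1, 2}" "weight i = radd (weight j) (rscale k a)"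
          and l: "l \<in> {1, 2}" "weight i = radd (weight j) (rscale l b)"
          using ent[OF n(1)] ent[OF m(1)] nz n(2) m(2) by metis
        have "rscale k a = rscale l b"
          using k(2) l(2) by (cases "weight j"; cases "rscale k a"; cases "rscale l b") (auto simp: tuple_simps)
        then have "ip (rscale k a) (rscale k a) = ip (rscale l b) (rscale l b)" by simp
        then have "k * k * ip a a = l * l * ip b b" by simp
        moreover have "ip a a = 4" "ip b b = 8" using a b root_length[OF a(1)] by (auto simp: long_ip)
        ultimately show False using k(1) l(1) by auto
      qed
    qed
  qed auto
  then show ?thesis using eq u_nontrivial a(1) b(1) by metis
qed

end

text \<open>The setting with K, L and \<open>bar\<close> described by their field properties alone.
  The set \<open>lf\<close> stands for the field ell and contains the fixed points of
  \<open>bar\<close>.\<close>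

locale sigma_mixed = mixed ty K L for ty :: "'a::field itself" and K L :: "'a set" +
  fixes lf :: "'a set" and bar :: "'a \<Rightarrow> 'a" and \<sigma> :: "'a mat \<Rightarrow> 'a mat" and c :: "root4 \<Rightarrow> 'a" and \<alpha> \<beta> :: 'a
  assumes bar_K: "x \<in> K \<Longrightarrow> bar x \<in> K" and bar_L: "x \<in> L \<Longrightarrow> bar x \<in> L"
    and bar_add: "x \<in> L \<Longrightarrow> y \<in> L \<Longrightarrow> bar (x + y) = bar x + bar y"
    and bar_mult: "x \<in> L \<Longrightarrow> y \<in> L \<Longrightarrow> bar (x * y) = bar x * bar y"
    and bar_one: "bar 1 = 1"
    and bar_fixed: "x \<in> L \<Longrightarrow> bar x = x \<Longrightarrow> x \<in> lf"
    and ab: "bar \<alpha> = \<alpha>" "bar \<beta> = \<beta>" "\<alpha> \<in> L" "\<beta> \<in> L" "\<alpha> \<noteq> 0" "\<beta> \<noteq> 0"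
    and aniso: "\<And>y1 y2 y3 y4. y1 \<in> lf \<Longrightarrow> y2 \<in> K \<Longrightarrow> y3 \<in> K \<Longrightarrow> y4 \<in> K \<Longrightarrow>
        y1 ^ 2 + \<alpha> * y2 * bar y2 + \<beta> * y3 * bar y3 + \<alpha> * \<beta> * y4 * bar y4 = 0 \<Longrightarrow>
        y1 = 0 \<and> y2 = 0 \<and> y3 = 0 \<and> y4 = 0"
    and \<sigma>_mem: "g \<in> XX F4_Phi \<Longrightarrow> \<sigma> g \<in> XX F4_Phi"
    and \<sigma>_mult: "g \<in> XX F4_Phi \<Longrightarrow> h \<in> XX F4_Phi \<Longrightarrow> \<sigma> (g * h) = \<sigma> g * \<sigma> h"
    and \<sigma>_\<sigma>: "g \<in> XX F4_Phi \<Longrightarrow> \<sigma> (\<sigma> g) = g"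
    and c_K: "r \<in> F4_Phi \<Longrightarrow> c r \<in> K \<and> c r \<noteq> 0"
    and \<sigma>_u: "r \<in> F4_Phi \<Longrightarrow> t \<in> adm r \<Longrightarrow> \<sigma> (u r t) = u (sigma_root r) (c r * bar t)"
    and c_alpha: "c alpha1 = inverse (\<alpha> * \<beta>)" "c alpha2 = \<alpha> * \<beta>" "c alpha3 = inverse \<alpha>" "c alpha4 = \<alpha> * inverse \<beta>"
begin

abbreviation G :: "'a mat set" where "G \<equiv> XX F4_Phi"

lemma G_GL: "G \<subseteq> GL52"
  by (rule XX_GL) simp

lemma G_mult: "g \<in> G \<Longrightarrow> h \<in> G \<Longrightarrow> g * h \<in> G"
  unfolding XX_def by (rule grp_gen.gen_mult)

lemma G_ginv: "g \<in> G \<Longrightarrow> ginv g \<in> G"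
  unfolding XX_def by (rule grp_gen_ginv[OF Ugen_GL[OF subset_refl]])

lemma G_one: "1\<^sub>m 52 \<in> G"
  unfolding XX_def by (rule grp_gen.gen_one)

lemma u_G: "r \<in> F4_Phi \<Longrightarrow> t \<in> adm r \<Longrightarrow> u r t \<in> G"
  by (rule u_XX)

lemma \<sigma>_one: "\<sigma> (1\<^sub>m 52) = 1\<^sub>m 52"
proof -
  have GL: "\<sigma> (1\<^sub>m 52) \<in> GL52" using \<sigma>_mem[OF G_one] G_GL by blast
  have "\<sigma> (1\<^sub>m 52) * \<sigma> (1\<^sub>m 52) = \<sigma> (1\<^sub>m 52) * 1\<^sub>m 52"
    using \<sigma>_mult[OF G_one G_one] GL by simp
  then show ?thesis using GL_cancel_left[OF GL, of "\<sigma> (1\<^sub>m 52)" "1\<^sub>m 52"] GL by simp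
qed

lemma \<sigma>_ginv: "g \<in> G \<Longrightarrow> \<sigma> (ginv g) = ginv (\<sigma> g)"
proof -
  assume g: "g \<in> G"
  then have GL: "g \<in> GL52" "\<sigma> g \<in> M52" "\<sigma> (ginv g) \<in> M52" using G_GL \<sigma>_mem G_ginv by (auto simp: subset_iff)
  have "\<sigma> g * \<sigma> (ginv g) = 1\<^sub>m 52" using \<sigma>_mult[OF g G_ginv[OF g]] GL \<sigma>_one by simp
  then show ?thesis using ginv_unique(3)[OF GL(2,3)] by simp
qed

lemma adm_sigma: "adm (sigma_root r) = adm r"
  by (simp add: adm_def sigma_long)

lemma c_adm: "r \<in> F4_Phi \<Longrightarrow> t \<in> adm r \<Longrightarrow> c r * bar t \<in> adm (sigma_root r)"
proof -
  assume r: "r \<in> F4_Phi" and t: "t \<in> adm r"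
  have "c r \<in> adm r" using c_K[OF r] KL by (auto simp: adm_def)
  moreover have "bar t \<in> adm r" using t bar_K bar_L by (auto simp: adm_def split: if_splits)
  ultimately show ?thesis unfolding adm_sigma by (rule adm_closed)
qed

lemma bar_zero: "bar 0 = 0"
proof -
  have "0 \<in> L" using L by (simp add: is_subfield_def)
  then have "bar 0 + bar 0 = bar 0" using bar_add[of 0 0] by simp
  then show ?thesis by simp
qed

lemma bar_inverse: "t \<in> L \<Longrightarrow> t \<noteq> 0 \<Longrightarrow> bar t \<noteq> 0 \<and> bar (inverse t) = inverse (bar t)"
proof -
  assume t: "t \<in> L" "t \<noteq> 0"
  then have "inverse t \<in> L" using L by (simp add: is_subfield_def)
  then have "bar t * bar (inverse t) = 1" using bar_mult[OF t(1)] t(2) bar_one by (metis right_inverse)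
  then show ?thesis using inverse_unique by fastforce
qed

lemma \<sigma>_XX:
  assumes R: "R \<subseteq> F4_Phi" "\<And>r. r \<in> R \<Longrightarrow> sigma_root r \<in> R" and A: "A \<in> XX R"
  shows "\<sigma> A \<in> XX R"
  using Ugen_GL[OF R(1)] Ugen_ginv[OF R(1)] A[unfolded XX_def]
proof (induction rule: grp_gen_induct_left)
  case one
  show ?case unfolding \<sigma>_one XX_def by (rule grp_gen.gen_one)
next
  case (mult A B)
  obtain r t where r: "r \<in> R" "t \<in> adm r" "A = u r t" using mult(1) unfolding Ugen_iff by blast
  have rP: "r \<in> F4_Phi" using r(1) R(1) by blast
  have B: "B \<in> G" using mult(2) XX_mono[OF R(1)] by (auto simp: XX_def)
  have "\<sigma> (A * B) = u (sigma_root r) (c r * bar t) * \<sigma> B"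
    using \<sigma>_mult[OF u_G[OF rP r(2)] B] \<sigma>_u[OF rP r(2)] r(3) by simp
  then show ?case
    using u_XX[OF R(2)[OF r(1)] c_adm[OF rP r(2)]] mult.IH unfolding XX_def by (simp add: grp_gen.gen_mult)
qed

lemma \<sigma>_Um: "x \<in> Um \<Longrightarrow> \<sigma> x \<in> Um" and \<sigma>_Zm: "z \<in> Zm \<Longrightarrow> \<sigma> z \<in> Zm"
  unfolding Um_def Zm_def by (rule \<sigma>_XX; auto simp: sigma_root_Phi)+

lemma sigma_involution_c: "r \<in> F4_Phi \<Longrightarrow> c (sigma_root r) * bar (c r) = 1"
proof -
  assume r: "r \<in> F4_Phi"
  have c1: "c r \<in> adm (sigma_root r)" using c_adm[OF r, of 1] bar_one by simp
  have "\<sigma> (\<sigma> (u r 1)) = u r 1" using \<sigma>_\<sigma> u_G[OF r, of 1] by simp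
  then have "u r (c (sigma_root r) * bar (c r)) = u r 1"
    using \<sigma>_u[OF r, of 1] \<sigma>_u[OF sigma_root_Phi[OF r] c1] bar_one by (simp add: sigma_root_simps)
  then show ?thesis by (rule u_inj[OF r])
qed

lemma nn_braid: "r \<in> F4_Phi \<Longrightarrow> u r 1 * (u (rneg r) 1 * u r 1) = u (rneg r) 1 * (u r 1 * u (rneg r) 1)"
  using nn_rneg[of r] by (simp add: n_el_def assoc52)

lemma \<sigma>_mult3: "x \<in> G \<Longrightarrow> y \<in> G \<Longrightarrow> z \<in> G \<Longrightarrow> \<sigma> (x * (y * z)) = \<sigma> x * (\<sigma> y * \<sigma> z)"
  by (simp add: \<sigma>_mult G_mult)

text \<open>\<sigma> maps the braid relation between u_r(1) and u_-r(1) to one with parameters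
  \<open>c r\<close> and \<open>c (rneg r)\<close>, and such a relation forces their product to be
  1.\<close>

lemma c_rneg: "r \<in> F4_Phi \<Longrightarrow> c r * c (rneg r) = 1"
proof -
  assume r: "r \<in> F4_Phi"
  have G: "u r 1 \<in> G" "u (rneg r) 1 \<in> G" using r by (simp_all add: u_G)
  have s: "\<sigma> (u r 1) = u (sigma_root r) (c r)" "\<sigma> (u (rneg r) 1) = u (rneg (sigma_root r)) (c (rneg r))"
    using \<sigma>_u[of r 1] \<sigma>_u[of "rneg r" 1] r bar_one by (simp_all add: sigma_root_simps)
  have "\<sigma> (u r 1 * (u (rneg r) 1 * u r 1)) = \<sigma> (u (rneg r) 1 * (u r 1 * u (rneg r) 1))"
    using nn_braid[OF r] by simp
  then have "u (sigma_root r) (c r) * (u (rneg (sigma_root r)) (c (rneg r)) * u (sigma_root r) (c r)) =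
      u (rneg (sigma_root r)) (c (rneg r)) * (u (sigma_root r) (c r) * u (rneg (sigma_root r)) (c (rneg r)))"
    using G by (simp add: \<sigma>_mult3 s)
  then show ?thesis
    using c_K[OF r] c_K[OF rneg_Phi[OF r]] by (intro opposite_params[OF sigma_root_Phi[OF r]]) simp_all
qed

lemma \<sigma>_n:
  assumes r: "r \<in> F4_Phi" and t: "t \<in> adm r" "t \<noteq> 0"
  shows "\<sigma> (n_el r t) = n_el (sigma_root r) (c r * bar t)"
proof -
  have it: "inverse t \<in> adm (rneg r)" using t by (simp add: adm_closed adm_rneg)
  have "c (rneg r) = inverse (c r)" using c_rneg[OF r] by (simp add: inverse_unique)
  then have "c (rneg r) * bar (inverse t) = inverse (c r * bar t)"
    using bar_inverse[OF adm_L[OF t(1)] t(2)] by (simp add: inverse_mult_distrib)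
  then have "\<sigma> (u (rneg r) (inverse t)) = u (rneg (sigma_root r)) (inverse (c r * bar t))"
    using \<sigma>_u[OF rneg_Phi[OF r] it] by (simp add: sigma_root_simps)
  then show ?thesis
    using \<sigma>_mult3[OF u_G[OF r t(1)] u_G[OF rneg_Phi[OF r] it] u_G[OF r t(1)]] \<sigma>_u[OF r t(1)]
    by (simp add: n_el_def assoc52)
qed

lemma n_G: "r \<in> F4_Phi \<Longrightarrow> t \<in> adm r \<Longrightarrow> t \<noteq> 0 \<Longrightarrow> n_el r t \<in> G"
  by (rule n_mixed) simp_all

lemma \<sigma>_Tgen: assumes "h \<in> Tgen" shows "\<sigma> h \<in> Tgen"
proof -
  obtain r t t' where h: "h = n_el r t * n_el r t'" and r: "r \<in> F4_Phi" and t: "t \<in> adm r" "t \<noteq> 0" "t' \<in> adm r" "t' \<noteq> 0"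
    using TgenE[OF assms] by blast
  have "\<sigma> h = n_el (sigma_root r) (c r * bar t) * n_el (sigma_root r) (c r * bar t')"
    unfolding h using \<sigma>_mult[OF n_G[OF r t(1,2)] n_G[OF r t(3,4)]] \<sigma>_n[OF r] t by simp
  moreover have "c r * bar t \<noteq> 0" "c r * bar t' \<noteq> 0"
    using c_K[OF r] bar_inverse[OF adm_L] t by auto
  ultimately show ?thesis
    unfolding Tgen_def mem_Collect_eq using c_adm[OF r] t sigma_root_Phi[OF r] by blast
qed

lemma \<sigma>_Lm: assumes "l \<in> Lm" shows "\<sigma> l \<in> Lm"
  using Lgen_GL Lgen_ginv assms[unfolded Lm_def]
proof (induction rule: grp_gen_induct_left)
  case one
  show ?case unfolding \<sigma>_one Lm_def by (rule grp_gen.gen_one)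
next
  case (mult A B)
  have P: "A \<in> G" "B \<in> G"
    using mult(1,2) Lm_Pm Pm_mixed unfolding Lm_def by (auto intro: grp_gen.gen_incl)
  have "\<sigma> A \<in> Lgen"
  proof -
    consider "A \<in> Tgen" | r t where "r \<in> F4_Phi" "level r = 0" "t \<in> adm r" "A = u r t"
      using mult(1) unfolding Lgen_def Un_iff Ugen_iff by blast
    then show ?thesis
    proof cases
      case 1
      then show ?thesis using \<sigma>_Tgen by (simp add: Lgen_def)
    next
      case 2
      have "\<sigma> A = u (sigma_root r) (c r * bar t)" using \<sigma>_u[OF 2(1,3)] 2(4) by simp
      moreover have "sigma_root r \<in> {r \<in> F4_Phi. level r = 0}" using 2 sigma_root_Phi by simp
      ultimately show ?thesis using c_adm[OF 2(1,3)] unfolding Lgen_def Un_iff Ugen_iff by blast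
    qed
  qed
  then have "\<sigma> A * \<sigma> B \<in> Lm" using mult.IH unfolding Lm_def by (rule grp_gen.gen_mult[OF grp_gen.gen_incl])
  then show ?case using \<sigma>_mult[OF P] by simp
qed

text \<open>Applying \<sigma> to the relation for r and s gives a relation for the image roots,
  which is compared with the one that \<open>comm_ok\<close> gives for them. This relates c on sums
  of roots to c on the summands.\<close>

lemma c_comm:
  assumes r: "r \<in> F4_Phi" "s \<in> F4_Phi" "s \<noteq> rneg r"
  shows "comm_word (sigma_root r) (sigma_root s) (c r) (c s) = \<sigma> (comm_word r s 1 1)"
proof -
  have ok: "comm_ok r s" by (rule comm_ok[OF r])
  have "sigma_root s \<noteq> rneg (sigma_root r)" using r(3) by (metis sigma_root_simps(3,4))
  then have ok': "comm_ok (sigma_root r) (sigma_root s)"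
    using r sigma_root_Phi by (intro comm_ok) auto
  have sr: "\<sigma> (u r 1) = u (sigma_root r) (c r)" "\<sigma> (u s 1) = u (sigma_root s) (c s)"
    using \<sigma>_u[of r 1] \<sigma>_u[of s 1] r bar_one by simp_all
  have G: "u r 1 \<in> G" "u s 1 \<in> G" using r by (simp_all add: u_G)
  have w: "comm_word r s 1 1 = u s 1 * (u r 1 * (u s 1 * u r 1))"
    using ok r(2) unfolding comm_ok_def by simp
  have wG: "comm_word r s 1 1 \<in> G" unfolding w using G by (intro G_mult)
  have "u (sigma_root s) (c s) * comm_word (sigma_root r) (sigma_root s) (c r) (c s) =
      u (sigma_root r) (c r) * (u (sigma_root s) (c s) * u (sigma_root r) (c r))"
    using ok' by (simp add: comm_ok_def)
  also have "\<dots> = \<sigma> (u r 1 * (u s 1 * u r 1))" using G by (simp add: \<sigma>_mult3 sr)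
  also have "u r 1 * (u s 1 * u r 1) = u s 1 * comm_word r s 1 1" using ok by (simp add: comm_ok_def)
  also have "\<sigma> \<dots> = u (sigma_root s) (c s) * \<sigma> (comm_word r s 1 1)" using \<sigma>_mult[OF G(2) wG] sr by simp
  finally have eq: "u (sigma_root s) (c s) * comm_word (sigma_root r) (sigma_root s) (c r) (c s) =
      u (sigma_root s) (c s) * \<sigma> (comm_word r s 1 1)" .
  have "\<sigma> (comm_word r s 1 1) \<in> GL52" using \<sigma>_mem[OF wG] G_GL by blast
  then have M: "\<sigma> (comm_word r s 1 1) \<in> M52" by simp
  have "u (sigma_root s) (c s) \<in> GL52" using r(2) sigma_root_Phi by simp
  then show ?thesis by (rule GL_cancel_left[OF _ comm_word_carrier M eq])
qed

lemma c_add: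
  assumes r: "r \<in> F4_Phi" "s \<in> F4_Phi" "s \<noteq> rneg r" and q: "comm_list r s = [(q, 1, 1)]"
  shows "c q = c r * c s"
proof -
  have qP: "q \<in> F4_Phi" using comm_ok[OF r] q by (simp add: comm_ok_def)
  have "u (sigma_root q) (c r * c s) = u (sigma_root q) (c q)"
    using c_comm[OF r] \<sigma>_u[OF qP, of 1] bar_one unfolding comm_word_def sigma_comm_list q by simp
  then show ?thesis using u_inj[OF sigma_root_Phi[OF qP]] by metis
qed

text \<open>The product of two factors is known and each factor is wanted. One belongs to a short
  and the other to a long root, so \<open>u_indep\<close> separates them.\<close>

lemma c_add2:
  assumes r: "r \<in> F4_Phi" "s \<in> F4_Phi" "s \<noteq> rneg r" and q: "comm_list r s = [(q, 1, 1), (q', 1, 2)]"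
    and long: "\<not> F4_long q" "F4_long q'"
  shows "c q = c r * c s \<and> c q' = c r * (c s)\<^sup>2"
proof -
  have qP: "q \<in> F4_Phi" "q' \<in> F4_Phi" using comm_ok[OF r] q by (simp_all add: comm_ok_def)
  let ?a = "sigma_root q" and ?b = "sigma_root q'"
  have P: "?a \<in> F4_Phi" "?b \<in> F4_Phi" using qP sigma_root_Phi by auto
  have G: "u q 1 \<in> G" "u q' 1 \<in> G" using qP by (simp_all add: u_G)
  have eq: "u ?a (c r * c s) * u ?b (c r * (c s)\<^sup>2) = u ?a (c q) * u ?b (c q')"
    using c_comm[OF r] \<sigma>_u[OF qP(1), of 1] \<sigma>_u[OF qP(2), of 1] \<sigma>_mult[OF G] bar_one
    unfolding comm_word_def sigma_comm_list q by simp
  have "u ?a (c q + c r * c s) = u ?b (c q' + c r * (c s)\<^sup>2)"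
  proof -
    have "u ?a (c q) * (u ?a (c r * c s) * u ?b (c r * (c s)\<^sup>2)) * u ?b (c r * (c s)\<^sup>2) =
        u ?a (c q) * (u ?a (c q) * u ?b (c q')) * u ?b (c r * (c s)\<^sup>2)" unfolding eq ..
    then show ?thesis using P u_add[OF P(1), of "c q" "c r * c s"] u_add[OF P(2), of "c q'" "c r * (c s)\<^sup>2"]
      by (simp add: assoc52)
  qed
  then have "c q + c r * c s = 0 \<and> c q' + c r * (c s)\<^sup>2 = 0"
    using u_indep[OF P(1) _ P(2)] long sigma_long by blast
  then show ?thesis by (simp add: add_eq_0)
qed

lemmas comm_eval = comm_list_def F4_long_def ip_def radd_def rscale_def rneg_def F4_Phi_def F4_roots_def
  alpha1_def alpha2_def alpha3_def alpha4_def

text \<open>The commutator rules lead from the simple roots to long roots of Phi_J, and adding 2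
  alpha1 to those gives the roots -e_i + e4. Their partners e_i + e4 follow because \<sigma> is an
  involution. Finally e4 is the sum of alpha1 and its image under \<open>sigma_root\<close>, so
  \<open>c e4\<close> is 1, which makes n_e4 fixed. The other values become the coefficients of the
  anisotropic form.\<close>

lemma c_values:
  "c (0, 0, 0, 2) = 1" "c (0, 0, 0, -2) = 1" "c (2, 0, 0, 2) = \<alpha>" "c (0, 2, 0, 2) = \<beta>" "c (0, 0, 2, 2) = \<alpha> * \<beta>"
  "c (-2, 0, 0, 2) = inverse \<alpha>" "c (0, -2, 0, 2) = inverse \<beta>" "c (0, 0, -2, 2) = inverse (\<alpha> * \<beta>)"
proof -
  have 1: "c (0, 2, 0, 0) = \<beta>" "c (0, 2, 2, 0) = \<alpha> * \<beta>\<^sup>2"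
    using c_add2[of alpha3 alpha2 "(0, 2, 0, 0)" "(0, 2, 2, 0)"] c_alpha ab
    by (simp_all add: comm_eval power2_eq_square)
  have 2: "c (2, 2, 0, 0) = \<alpha> * \<beta>"
    using c_add2[of alpha4 "(0, 2, 0, 0)" "(2, 0, 0, 0)" "(2, 2, 0, 0)"] c_alpha ab 1
    by (simp_all add: comm_eval power2_eq_square)
  have 3: "c (2, 0, -2, 0) = inverse \<beta>"
    using c_add[of alpha3 alpha4 "(2, 0, -2, 0)"] c_alpha ab by (simp add: comm_eval)
  have 4: "c (2, 0, 2, 0) = \<alpha>\<^sup>2 * \<beta>"
    using c_add2[of "(2, 0, -2, 0)" alpha2 "(2, 0, 0, 0)" "(2, 0, 2, 0)"] c_alpha ab 3
    by (simp_all add: comm_eval power2_eq_square)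
  have 5: "c (0, 0, -2, 2) = inverse (\<alpha> * \<beta>)"
    using c_add2[of "(2, 2, 0, 0)" alpha1 "(1, 1, -1, 1)" "(0, 0, -2, 2)"] c_alpha ab 2
    by (simp_all add: comm_eval power2_eq_square, simp add: field_simps)
  have 6: "c (0, -2, 0, 2) = inverse \<beta>"
    using c_add2[of "(2, 0, 2, 0)" alpha1 "(1, -1, 1, 1)" "(0, -2, 0, 2)"] c_alpha ab 4
    by (simp_all add: comm_eval power2_eq_square, simp add: field_simps)
  have 7: "c (-2, 0, 0, 2) = inverse \<alpha>"
    using c_add2[of "(0, 2, 2, 0)" alpha1 "(-1, 1, 1, 1)" "(-2, 0, 0, 2)"] c_alpha ab 1
    by (simp_all add: comm_eval power2_eq_square, simp add: field_simps)
  have abL: "\<alpha> * \<beta> \<in> L" "\<alpha> * \<beta> \<noteq> 0" "bar (\<alpha> * \<beta>) = \<alpha> * \<beta>"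
    using ab L bar_mult by (auto simp: is_subfield_def)
  have inv: "bar (inverse \<alpha>) = inverse \<alpha>" "bar (inverse \<beta>) = inverse \<beta>" "bar (inverse (\<alpha> * \<beta>)) = inverse (\<alpha> * \<beta>)"
    using bar_inverse[of \<alpha>] bar_inverse[of \<beta>] bar_inverse[of "\<alpha> * \<beta>"] ab abL by simp_all
  have x: "y * inverse x = 1 \<Longrightarrow> y = x" for x y :: 'a
    by (metis inverse_inverse_eq inverse_unique mult.commute)
  have Phi: "(-2, 0, 0, 2) \<in> F4_Phi" "(0, -2, 0, 2) \<in> F4_Phi" "(0, 0, -2, 2) \<in> F4_Phi" "(-1, -1, -1, 1) \<in> F4_Phi"
    by (simp_all add: F4_Phi_def F4_roots_def)
  show "c (-2, 0, 0, 2) = inverse \<alpha>" "c (0, -2, 0, 2) = inverse \<beta>" "c (0, 0, -2, 2) = inverse (\<alpha> * \<beta>)"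
    by (fact 7 6 5)+
  show "c (2, 0, 0, 2) = \<alpha>" using x sigma_involution_c[OF Phi(1)] 7 inv by (simp add: sigma_root_def)
  show "c (0, 2, 0, 2) = \<beta>" using x sigma_involution_c[OF Phi(2)] 6 inv by (simp add: sigma_root_def)
  show "c (0, 0, 2, 2) = \<alpha> * \<beta>" using x[of _ "\<alpha> * \<beta>"] sigma_involution_c[OF Phi(3)] 5 inv by (simp add: sigma_root_def)
  have 8: "c (1, 1, 1, 1) = \<alpha> * \<beta>"
    using x[of _ "\<alpha> * \<beta>"] sigma_involution_c[OF Phi(4)] c_alpha(1) inv by (simp add: sigma_root_def alpha1_def)
  show 9: "c (0, 0, 0, 2) = 1"
    using c_add[of alpha1 "(1, 1, 1, 1)" "(0, 0, 0, 2)"] c_alpha abL 8 by (simp add: comm_eval, simp add: field_simps)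
  have "(0, 0, 0, 2) \<in> F4_Phi" by (simp add: F4_Phi_def F4_roots_def)
  from c_rneg[OF this] show "c (0, 0, 0, -2) = 1" using 9 by (simp add: rneg_def)
qed

end

context char2
begin

lemma zprod_cong: "(\<And>n. n \<in> set ns \<Longrightarrow> f n = g n) \<Longrightarrow> zprod ns f = zprod ns g"
  by (induction ns) simp_all

end

section \<open>Uniqueness in the big cell, and singular elements from the middle cosets\<close>

context mixed
begin

abbreviation Nm :: "'a mat set" where
  "Nm \<equiv> XX {r \<in> F4_Phi. level r < 0}"

lemma Nm_GL: "Nm \<subseteq> GL52"
  by (rule XX_GL) blast

text \<open>Solved for a, the equation shows a matrix that never raises the e4-weight, while a
  differs from the identity only by raising it. So a is the identity, and the same argument with the
  opposite sign applies to b.\<close>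

lemma opposite_unique:
  assumes a: "a \<in> Um" and l: "l \<in> Lm" "l' \<in> Lm" and b: "b \<in> Nm" and eq: "a * l * b = l'"
  shows "a = 1\<^sub>m 52" "b = 1\<^sub>m 52" "l = l'"
proof -
  have GL: "a \<in> GL52" "l \<in> GL52" "l' \<in> GL52" "b \<in> GL52" "ginv b \<in> GL52" using a l b Um_GL Lm_GL Nm_GL by auto
  have inv: "ginv b \<in> Nm" "ginv l \<in> Lm"
    using grp_gen_ginv[OF Ugen_GL] grp_gen_ginv[OF Lgen_GL] b l unfolding XX_def Lm_def by auto
  have neg: "unip (rneg e4) 2 y" if "y \<in> Nm" for y
    by (rule grp_unip[OF _ _ _ that]) (auto simp: rneg_rscale wt_e4)
  have ua: "unip e4 2 a"
    using a unfolding Um_def by (rule grp_unip[rotated 3]) (auto simp: wt_e4)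
  have "l' * ginv b * ginv l = a * l * b * ginv b * ginv l" by (simp only: eq)
  also have "\<dots> = a" using GL by (simp add: assoc52)
  finally have "a = l' * ginv b * ginv l" ..
  moreover have "noninc e4 (l' * ginv b * ginv l)"
    using Lm_noninc l inv unip_rneg_noninc[OF neg[OF inv(1)]] by (intro noninc_mult) auto
  ultimately show a1: "a = 1\<^sub>m 52" using unip_noninc_one[OF ua] by simp
  have lb: "l * b = l'" using eq GL a1 by simp
  then have "b = ginv l * l'" using GL by (metis GL_M ginv_cancel(2))
  moreover have "noninc (rneg e4) (ginv l * l')" using Lm_noninc l inv by (intro noninc_mult) auto
  ultimately show b1: "b = 1\<^sub>m 52" using unip_noninc_one[OF neg[OF b]] by simp
  show "l = l'" using lb b1 GL by simp
qed

lemma level_refl_e4: "r \<in> F4_Phi \<Longrightarrow> level (refl e4 r) = - level r"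
proof -
  assume r: "r \<in> F4_Phi"
  have "refl e4 r = radd r (rscale (- level r) e4)"
    using wt_e4[OF r] by (intro refl_unique) (simp_all add: ip_def e4_def)
  then show ?thesis by (cases r) (simp add: e4_def level_def radd_def rscale_def)
qed

lemma e4_refl: "e4 \<in> refl_roots"
  by (simp add: refl_roots_def)

lemma nn_e4_Um:
  assumes "x \<in> Um" shows "nn e4 * x * nn e4 \<in> Nm"
proof -
  have "nn e4 * x * ginv (nn e4) \<in> grp_gen (Ugen {r \<in> F4_Phi. level r < 0})"
  proof (rule grp_gen_conj[OF _ Ugen_GL])
    show "{r \<in> F4_Phi. 0 < level r} \<subseteq> F4_Phi" by blast
    show "nn e4 \<in> GL52" by simp
    show "x \<in> grp_gen (Ugen {r \<in> F4_Phi. 0 < level r})" using assms by (simp add: Um_def XX_def)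
    fix A assume "A \<in> Ugen {r \<in> F4_Phi. 0 < level r}"
    then obtain r t where r: "r \<in> F4_Phi" "0 < level r" "t \<in> adm r" "A = u r t" unfolding Ugen_iff by blast
    have "nn e4 * A * ginv (nn e4) = u (refl e4 r) t"
      unfolding r(4) nn_u[OF e4_refl r(1)] by (simp add: assoc52)
    moreover have "refl e4 r \<in> {r \<in> F4_Phi. level r < 0}"
      using refl_Phi[OF e4_refl r(1)] level_refl_e4[OF r(1)] r(2) by simp
    moreover have "t \<in> adm (refl e4 r)"
      using r(3) long_refl[OF e4_refl even_tuple_Phi[OF r(1)]] by (simp add: adm_def)
    ultimately show "nn e4 * A * ginv (nn e4) \<in> grp_gen (Ugen {r \<in> F4_Phi. level r < 0})"
      using u_XX by (simp add: XX_def)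
  qed
  then show ?thesis by (simp add: XX_def)
qed

lemma nn_e4_Lm:
  assumes "l \<in> Lm" shows "nn e4 * l * nn e4 \<in> Lm"
proof -
  have "nn e4 * l * ginv (nn e4) \<in> grp_gen Lgen"
  proof (rule grp_gen_conj[OF _ Lgen_GL])
    show "nn e4 \<in> GL52" by simp
    show "l \<in> grp_gen Lgen" using assms by (simp add: Lm_def)
    fix A assume "A \<in> Lgen"
    then consider "A \<in> Tgen" | r t where "r \<in> F4_Phi" "level r = 0" "t \<in> adm r" "A = u r t"
      unfolding Lgen_def Un_iff Ugen_iff by blast
    then have "nn e4 * A * nn e4 \<in> Lgen"
    proof cases
      case 1
      obtain r t t' where h: "A = n_el r t * n_el r t'" and r: "r \<in> F4_Phi" and t: "t \<in> adm r" "t \<noteq> 0" "t' \<in> adm r" "t' \<noteq> 0"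
        using TgenE[OF 1] by blast
      have "nn e4 * A * nn e4 = n_el (refl e4 r) t * n_el (refl e4 r) t'"
        unfolding h using nn_n_swap[OF e4_refl r] nn_n[OF e4_refl r] by (simp add: assoc52)
      moreover have "adm (refl e4 r) = adm r"
        using long_refl[OF e4_refl even_tuple_Phi[OF r]] by (simp add: adm_def)
      ultimately have "nn e4 * A * nn e4 \<in> Tgen"
        unfolding Tgen_def mem_Collect_eq using t refl_Phi[OF e4_refl r] by metis
      then show ?thesis by (simp add: Lgen_def)
    next
      case 2
      have "nn e4 * A * nn e4 = u (refl e4 r) t"
        unfolding 2(4) nn_u[OF e4_refl 2(1)] by (simp add: assoc52)
      moreover have "refl e4 r \<in> {r \<in> F4_Phi. level r = 0}"
        using refl_Phi[OF e4_refl 2(1)] level_refl_e4[OF 2(1)] 2(2) by simp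
      moreover have "t \<in> adm (refl e4 r)"
        using 2(3) long_refl[OF e4_refl even_tuple_Phi[OF 2(1)]] by (simp add: adm_def)
      ultimately show ?thesis unfolding Lgen_def Un_iff Ugen_iff by blast
    qed
    then show "nn e4 * A * ginv (nn e4) \<in> grp_gen Lgen" by (simp add: grp_gen.gen_incl)
  qed
  then show ?thesis by (simp add: Lm_def)
qed

text \<open>The three middle double cosets lead to elements of Z on which the quadratic form vanishes.\<close>

lemma singular_word1:
  assumes z: "z \<in> Zm" "z \<in> XX {s \<in> F4_Phi. ip s (1, 1, 1, 1) = 4}"
  shows "singular z"
proof -
  obtain f where f: "z = zmat f" using Zm_zmat[OF z(1)] by blast
  have "unip (1, 1, 1, 1) 4 z"
    by (rule grp_unip[OF _ _ _ z(2)]) auto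
  \<comment> \<open>These entries raise the weight along (1, 1, 1, 1) by less than 4. They are the
    coordinates for e4 and for the roots -e_i + e4, so each product in \<open>zq\<close> loses a
    factor.\<close>
  then have "z $$ (i, 31) = 0" if "i \<in> {49, 25, 27, 29}" for i
    using that by (auto simp: unip_def wt_def weight_eval[simplified] ip_def)
  then have "f 30 = 0" "f 10 = 0" "f 18 = 0" "f 22 = 0"
    using zmat_coords[of f] unfolding f by auto
  then show ?thesis unfolding singular_def f zmat_coords zq_def by simp
qed

text \<open>The vectors of e4 and -e4 both have weight 0 along e1, so the entry in question raises
  no weight and must vanish.\<close>

lemma singular_word2:
  assumes z: "z \<in> XX {s \<in> F4_Phi. ip s (2, 0, 0, 0) = 4}"
  shows "singular z"
proof -
  have "unip (2, 0, 0, 0) 4 z"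
    by (rule grp_unip[OF _ _ _ z]) auto
  then show ?thesis by (simp add: unip_def singular_def wt_def weight_eval[simplified] ip_def)
qed

text \<open>Let m be the conjugate of u_v(1) by z, with v = (e1 + e2 - e3 - e4)/2, and compare z
  u_v(1) with m z in row 30 and columns of level 1. Roots with product 4 with v have level at most
  0, so m raises no level, while z differs from the identity only in raising levels by at least 2.
  Hence the entries of m z vanish, and those of z u_v(1) show the coordinates 30, 10, 18 and 20 of
  z.\<close>

lemma singular_word3:
  assumes z: "z \<in> Zm" and m: "z * u (F4_roots ! 35) 1 * ginv z \<in> XX {s \<in> F4_Phi. ip s (1, 1, -1, -1) = 4}"
  shows "singular z"
proof -
  obtain f where f: "z = zmat f" using Zm_zmat[OF z] by blast
  define m' where "m' = z * u (F4_roots ! 35) 1 * ginv z"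
  have GL: "z \<in> GL52" using z Zm_GL by auto
  have m'_M: "m' \<in> M52" using GL by (simp add: m'_def)
  have R: "{s \<in> F4_Phi. ip s (1, 1, -1, -1) = 4} \<subseteq> F4_Phi" by blast
  have lev: "level s \<le> 0" if "s \<in> F4_Phi" "ip s (1, 1, -1, -1) = 4" for s
  proof -
    have "list_all (\<lambda>s. ip s (1, 1, -1, -1) = 4 \<longrightarrow> level s \<le> 0) F4_roots"
      by (simp add: F4_roots_def ip_def level_def)
    then show ?thesis using that unfolding F4_Phi_def list_all_iff by blast
  qed
  have ni: "noninc e4 m'"
    unfolding m'_def
  proof (rule grp_noninc[OF Ugen_GL[OF R] Ugen_ginv[OF R] _ m[unfolded XX_def]])
    fix A assume "A \<in> Ugen {s \<in> F4_Phi. ip s (1, 1, -1, -1) = 4}"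
    then obtain s t where s: "s \<in> F4_Phi" "ip s (1, 1, -1, -1) = 4" "A = u s t" unfolding Ugen_iff by blast
    show "noninc e4 A" unfolding s(3) using s(1) lev[OF s(1,2)] wt_e4[OF s(1)] by (intro u_noninc) simp_all
  qed
  have uz: "unip e4 4 z"
    using z unfolding Zm_def by (rule grp_unip[rotated 3]) (auto simp: wt_e4)
  have eq: "z * u (F4_roots ! 35) 1 = m' * z" using GL by (simp add: m'_def assoc52)
  have zero: "(z * u (F4_roots ! 35) 1) $$ (30, j) = 0" if j: "j < 52" "wt e4 j = 2" for j
  proof -
    have terms: "m' $$ (30, l) * z $$ (l, j) = 0" if l: "l < 52" for l
    proof (cases "wt e4 l < 4")
      case True
      then show ?thesis using ni l wt_values(1) by (simp add: noninc_def)
    next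
      case False
      show ?thesis
      proof (cases "wt e4 l < 6")
        case True
        then have "z $$ (l, j) = 0" using uz l j False by (auto simp: unip_def)
        then show ?thesis by simp
      next
        case F2: False
        \<comment> \<open>The largest weight along e4 is 4, attained at level 2.\<close>
        have "list_all (\<lambda>l. wt e4 l < 6) idx52"
          unfolding idx52_def list.pred_inject by (simp add: wt_def weight_eval[simplified] ip_def e4_def)
        then show ?thesis using F2 l by (simp add: list_all_iff idx52)
      qed
    qed
    have "(m' * z) $$ (30, j) = (\<Sum>l<52. m' $$ (30, l) * z $$ (l, j))"
      using m'_M GL j by (intro mult_entry) simp_all
    also have "\<dots> = 0" using terms by (intro sum.neutral ballI) (simp only: lessThan_iff)
    finally show ?thesis unfolding eq .
  qed
  have "f 30 = 0" "f 10 = 0" "f 18 = 0" "f 20 = 0"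
    using zero[of 44] zero[of 36] zero[of 40] zero[of 46] wt_values
    unfolding f by (simp_all only: zmat_35 zcol_35 rel_simps)
  then show ?thesis unfolding singular_def f zmat_coords zq_def by simp
qed

end

section \<open>The action of sigma on Z, and the double cosets of fixed elements\<close>

context sigma_mixed
begin

lemma Zm_G: "z \<in> Zm \<Longrightarrow> z \<in> G" and Um_G: "x \<in> Um \<Longrightarrow> x \<in> G" and Lm_G: "l \<in> Lm \<Longrightarrow> l \<in> G"
  using XX_mono[of "{r \<in> F4_Phi. level r = 2}" F4_Phi] Um_Pm Lm_Pm Pm_mixed unfolding Zm_def by blast+

lemma \<sigma>_zmat:
  assumes f: "\<And>n. n \<in> set zlist \<Longrightarrow> f n \<in> adm (F4_roots ! n)"
  shows "\<sigma> (zmat f) = zmat (\<lambda>n. if n = 30 then bar (f 30)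
    else if n = 8 then inverse \<alpha> * bar (f 10) else if n = 10 then \<alpha> * bar (f 8)
    else if n = 16 then inverse \<beta> * bar (f 18) else if n = 18 then \<beta> * bar (f 16)
    else if n = 20 then inverse (\<alpha> * \<beta>) * bar (f 22) else \<alpha> * \<beta> * bar (f 20))"
proof -
  have mem: "u (F4_roots ! n) (f n) \<in> G" if "n \<in> set zlist" for n
    using zlist_level[OF that] f[OF that] by (intro u_G) simp_all
  have S: "sigma_root (F4_roots ! 30) = F4_roots ! 30" "sigma_root (F4_roots ! 8) = F4_roots ! 10"
    "sigma_root (F4_roots ! 10) = F4_roots ! 8" "sigma_root (F4_roots ! 16) = F4_roots ! 18"
    "sigma_root (F4_roots ! 18) = F4_roots ! 16" "sigma_root (F4_roots ! 20) = F4_roots ! 22"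
    "sigma_root (F4_roots ! 22) = F4_roots ! 20"
    by (simp_all only: roots_nth sigma_root_def prod.case minus_zero minus_minus)
  have C: "c (F4_roots ! 30) = 1" "c (F4_roots ! 8) = \<alpha>" "c (F4_roots ! 10) = inverse \<alpha>" "c (F4_roots ! 16) = \<beta>"
    "c (F4_roots ! 18) = inverse \<beta>" "c (F4_roots ! 20) = \<alpha> * \<beta>" "c (F4_roots ! 22) = inverse (\<alpha> * \<beta>)"
    by (simp_all only: roots_nth c_values)
  have s: "\<sigma> (u (F4_roots ! n) (f n)) = u (sigma_root (F4_roots ! n)) (c (F4_roots ! n) * bar (f n))"
    if "n \<in> set zlist" for n
    using zlist_level[OF that] f[OF that] by (intro \<sigma>_u) simp_all
  have in_z: "30 \<in> set zlist" "8 \<in> set zlist" "10 \<in> set zlist" "16 \<in> set zlist" "18 \<in> set zlist" "20 \<in> set zlist" "22 \<in> set zlist"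
    by (simp_all add: zlist_def)
  note mem' = in_z[THEN mem]
  have "\<sigma> (zmat f) = u (F4_roots ! 30) (c (F4_roots ! 30) * bar (f 30)) * (u (F4_roots ! 10) (c (F4_roots ! 8) * bar (f 8)) *
      (u (F4_roots ! 8) (c (F4_roots ! 10) * bar (f 10)) * (u (F4_roots ! 18) (c (F4_roots ! 16) * bar (f 16)) *
      (u (F4_roots ! 16) (c (F4_roots ! 18) * bar (f 18)) * (u (F4_roots ! 22) (c (F4_roots ! 20) * bar (f 20)) *
      u (F4_roots ! 20) (c (F4_roots ! 22) * bar (f 22)))))))"
    unfolding zlist_def zprod_simps
    using mem' in_z[THEN s] by (simp add: \<sigma>_mult G_mult S)
  \<comment> \<open>The factors come in a permuted order. Adding functions supported on one
    coordinate avoids sorting them.\<close>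
  also have "\<dots> = zmat (\<lambda>n. (if n = 30 then bar (f 30) else 0) + ((if n = 10 then \<alpha> * bar (f 8) else 0) +
      ((if n = 8 then inverse \<alpha> * bar (f 10) else 0) + ((if n = 18 then \<beta> * bar (f 16) else 0) +
      ((if n = 16 then inverse \<beta> * bar (f 18) else 0) + ((if n = 22 then \<alpha> * \<beta> * bar (f 20) else 0) +
      (if n = 20 then inverse (\<alpha> * \<beta>) * bar (f 22) else 0)))))))"
    unfolding C mult_1_left using in_z by (simp only: zmat_single zmat_add)
  also have "\<dots> = zmat (\<lambda>n. if n = 30 then bar (f 30)
    else if n = 8 then inverse \<alpha> * bar (f 10) else if n = 10 then \<alpha> * bar (f 8)
    else if n = 16 then inverse \<beta> * bar (f 18) else if n = 18 then \<beta> * bar (f 16)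
    else if n = 20 then inverse (\<alpha> * \<beta>) * bar (f 22) else \<alpha> * \<beta> * bar (f 20))"
    by (rule zprod_cong) (auto simp: zlist_def)
  finally show ?thesis .
qed

lemma zlist_long: "n \<in> {8, 10, 16, 18, 20, 22} \<Longrightarrow> adm (F4_roots ! n) = K"
  by (auto simp: adm_def F4_long_def roots_nth[simplified])

text \<open>For fixed z the coordinate at -e_i + e4 is a constant times \<open>bar\<close> of its
  partner, so each pair in \<open>zq\<close> becomes a norm term. The coordinate at e4 is fixed by
  \<open>bar\<close> and hence lies in \<open>lf\<close>.\<close>

lemma fixed_singular:
  assumes z: "z \<in> Zm" "singular z" "\<sigma> z = z" shows "z = 1\<^sub>m 52"
proof -
  obtain f where f: "z = zmat f" and adm: "\<And>n. n \<in> set zlist \<Longrightarrow> f n \<in> adm (F4_roots ! n)"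
    using Zm_zmat[OF z(1)] by blast
  have eq: "zmat f = zmat (\<lambda>n. if n = 30 then bar (f 30)
    else if n = 8 then inverse \<alpha> * bar (f 10) else if n = 10 then \<alpha> * bar (f 8)
    else if n = 16 then inverse \<beta> * bar (f 18) else if n = 18 then \<beta> * bar (f 16)
    else if n = 20 then inverse (\<alpha> * \<beta>) * bar (f 22) else \<alpha> * \<beta> * bar (f 20))"
    using z(3) \<sigma>_zmat[OF adm] f by simp
  have 30: "f 30 = bar (f 30)" and 10: "f 10 = \<alpha> * bar (f 8)" and 18: "f 18 = \<beta> * bar (f 16)" and 22: "f 22 = \<alpha> * \<beta> * bar (f 20)"
    using zmat_inj[OF eq, of 30] zmat_inj[OF eq, of 10] zmat_inj[OF eq, of 18] zmat_inj[OF eq, of 22]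
    by (simp_all add: zlist_def)
  have "f 30 \<in> lf" using adm[of 30] adm_L 30 by (intro bar_fixed) (auto simp: zlist_def)
  moreover have "f 8 \<in> K" "f 16 \<in> K" "f 20 \<in> K"
    using adm[of 8] adm[of 16] adm[of 20] zlist_long[of 8] zlist_long[of 16] zlist_long[of 20]
    by (simp_all add: zlist_def)
  moreover have "f 30 ^ 2 + \<alpha> * f 8 * bar (f 8) + \<beta> * f 16 * bar (f 16) + \<alpha> * \<beta> * f 20 * bar (f 20) = 0"
    using z(2) unfolding singular_def f zmat_coords zq_def 10 18 22 by (simp add: mult_ac)
  ultimately have "f 30 = 0 \<and> f 8 = 0 \<and> f 16 = 0 \<and> f 20 = 0" by (rule aniso)
  then have "zmat f = zmat (\<lambda>n. 0)"
    using 10 18 22 bar_zero by (intro zprod_cong) (auto simp: zlist_def)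
  then show ?thesis unfolding f by (simp add: zlist_def)
qed

text \<open>In a stable group of singular elements, z * sigma(z) is fixed and hence trivial; so z, being
  an involution, is fixed itself and hence trivial as well.\<close>
lemma no_singular_group:
  assumes A: "A \<subseteq> Zm" "\<And>z. z \<in> A \<Longrightarrow> singular z" "\<And>z. z \<in> A \<Longrightarrow> \<sigma> z \<in> A"
    "\<And>z z'. z \<in> A \<Longrightarrow> z' \<in> A \<Longrightarrow> z * z' \<in> A" and z: "z \<in> A"
  shows "z = 1\<^sub>m 52"
proof -
  have zZ: "z \<in> Zm" "\<sigma> z \<in> Zm" "z * \<sigma> z \<in> Zm" using A z by auto
  obtain f g where fg: "z = zmat f" "\<sigma> z = zmat g" using Zm_zmat zZ(1,2) by metis
  have comm: "z * \<sigma> z = \<sigma> z * z" unfolding fg(2) unfolding fg(1) zmat_add by (simp add: add.commute)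
  have "\<sigma> (z * \<sigma> z) = z * \<sigma> z"
    using \<sigma>_mult[OF Zm_G[OF zZ(1)] Zm_G[OF zZ(2)]] \<sigma>_\<sigma>[OF Zm_G[OF zZ(1)]] comm by simp
  then have "z * \<sigma> z = 1\<^sub>m 52" using fixed_singular[OF zZ(3)] A z by blast
  moreover have "z * z = 1\<^sub>m 52" unfolding fg(1) by (rule zmat_sq)
  moreover have GL: "z \<in> GL52" "\<sigma> z \<in> GL52" using zZ Zm_GL by auto
  ultimately have "\<sigma> z = z" using GL_cancel_left[OF GL(1), of "\<sigma> z" z] by simp
  then show ?thesis using fixed_singular[OF zZ(1)] A(2)[OF z] by blast
qed

lemma conj_mult:
  "g \<in> GL52 \<Longrightarrow> x \<in> M52 \<Longrightarrow> y \<in> M52 \<Longrightarrow> (g * x * ginv g) * (g * y * ginv g) = g * (x * y) * ginv g"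
  by (simp add: assoc52)

lemma \<sigma>_conj: "g \<in> G \<Longrightarrow> \<sigma> g = g \<Longrightarrow> z \<in> G \<Longrightarrow> \<sigma> (g * z * ginv g) = g * \<sigma> z * ginv g"
  using G_ginv[of g] by (simp add: \<sigma>_mult G_mult \<sigma>_ginv)

lemma Zm_mult: "z \<in> Zm \<Longrightarrow> z' \<in> Zm \<Longrightarrow> z * z' \<in> Zm"
  unfolding Zm_def XX_def by (rule grp_gen.gen_mult)

lemma Pm_ginv: "p \<in> Pm \<Longrightarrow> ginv p \<in> Pm"
  unfolding Pm_def by (rule grp_gen_ginv[OF Pgen_GL])

lemma Zm_conj_back: "p \<in> Pm \<Longrightarrow> z \<in> Zm \<Longrightarrow> ginv p * z * p \<in> Zm"
  using Zm_norm[OF Pm_ginv, of p z] Pm_GL by (auto simp: subset_iff)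

definition gZ :: "'a mat \<Rightarrow> 'a mat set" where
  "gZ g = {g * z * ginv g | z. z \<in> Zm}"

text \<open>The factor p' normalises \<open>Zm\<close> and so drops out of the conjugate.\<close>

lemma gZ_cell:
  assumes p: "p \<in> Pm" "p' \<in> Pm" and N: "N \<in> GL52"
  shows "gZ (p * N * p') = {p * (N * z * ginv N) * ginv p | z. z \<in> Zm}"
proof (intro equalityI subsetI)
  have GL: "p \<in> GL52" "p' \<in> GL52" using p Pm_GL by auto
  fix y assume "y \<in> gZ (p * N * p')"
  then obtain z where z: "z \<in> Zm" "y = p * N * p' * z * ginv (p * N * p')" unfolding gZ_def by blast
  have "z \<in> GL52" using z Zm_GL by auto
  then have "y = p * (N * (p' * z * ginv p') * ginv N) * ginv p" unfolding z(2) using GL N by (simp add: assoc52)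
  then show "y \<in> {p * (N * z * ginv N) * ginv p | z. z \<in> Zm}" using Zm_norm[OF p(2) z(1)] by blast
next
  have GL: "p \<in> GL52" "p' \<in> GL52" using p Pm_GL by auto
  fix y assume "y \<in> {p * (N * z * ginv N) * ginv p | z. z \<in> Zm}"
  then obtain z where z: "z \<in> Zm" "y = p * (N * z * ginv N) * ginv p" by blast
  have "z \<in> GL52" using z Zm_GL by auto
  then have "y = (p * N * p') * (ginv p' * z * p') * ginv (p * N * p')" unfolding z(2) using GL N by (simp add: assoc52)
  then show "y \<in> gZ (p * N * p')" unfolding gZ_def using Zm_conj_back[OF p(2) z(1)] by blast
qed

text \<open>Root 8 is e1 + e4. Its preimages under the three middle representatives have levels 2, 2
  and 0, which lets it supply a nontrivial element of A each time.\<close>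

lemma u8_Zm: "u (F4_roots ! 8) 1 \<in> Zm"
proof -
  have "F4_roots ! 8 \<in> {r \<in> F4_Phi. level r = 2}" using zlist_level[of 8] by (simp add: zlist_def)
  then show ?thesis unfolding Zm_def by (rule u_XX) simp
qed

lemma u8_conj_nontrivial:
  assumes "p \<in> Pm" "p * u (F4_roots ! 8) 1 * ginv p = 1\<^sub>m 52" shows False
proof -
  have GL: "p \<in> GL52" using assms(1) Pm_GL by auto
  have "ginv p * (p * u (F4_roots ! 8) 1 * ginv p) * p = 1\<^sub>m 52" unfolding assms(2) using GL by simp
  then have "u (F4_roots ! 8) 1 = 1\<^sub>m 52" using GL by (simp add: assoc52)
  then show False using u_nontrivial[of "F4_roots ! 8" 1] by simp
qed

text \<open>A is the intersection of Z with its conjugate by g. After conjugating back by p its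
  elements are singular by \<open>sing\<close>, and the element of root 8, conjugated by p, belongs
  to A because w^-1 leaves that root at level 2.\<close>

lemma cell_special:
  assumes g: "g \<in> G" "\<sigma> g = g" and pp: "p \<in> Pm" "p' \<in> Pm" "g = p * nprod w * p'"
    and w: "simple_word w" and v: "v \<in> F4_Phi" "word_inv w v = e4"
    and lev: "level (word_inv w (F4_roots ! 8)) = 2"
    and sing: "\<And>z. z \<in> Zm \<Longrightarrow> z \<in> XX {s \<in> F4_Phi. ip s v = 4} \<Longrightarrow> singular z"
  shows False
proof -
  let ?N = "nprod w" and ?z0 = "u (F4_roots ! 8) 1"
  have GL: "?N \<in> GL52" "p \<in> GL52" "g \<in> GL52" using nprod_GL[OF w] pp Pm_GL g G_GL by auto
  have gZ: "gZ g = {p * (?N * z * ginv ?N) * ginv p | z. z \<in> Zm}"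
    unfolding pp(3) by (rule gZ_cell[OF pp(1,2) GL(1)])
  define A where "A = Zm \<inter> gZ g"
  have "p * ?z0 * ginv p = 1\<^sub>m 52"
  proof (rule no_singular_group[of A])
    show "A \<subseteq> Zm" by (simp add: A_def)
    show "singular z" if "z \<in> A" for z
    proof -
      obtain y where y: "y \<in> Zm" "z = p * (?N * y * ginv ?N) * ginv p" "z \<in> Zm"
        using \<open>z \<in> A\<close> unfolding A_def gZ by blast
      have yGL: "y \<in> GL52" using y Zm_GL by auto
      have "ginv p * z * p = ?N * y * ginv ?N" unfolding y(2) using GL yGL by (simp add: assoc52)
      then have 1: "?N * y * ginv ?N \<in> Zm" using Zm_conj_back[OF pp(1) y(3)] by simp
      have "singular (?N * y * ginv ?N)" by (rule sing[OF 1 nprod_Zm[OF w v y(1)]])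
      then show ?thesis unfolding y(2) by (rule singular_Pm[OF pp(1) 1])
    qed
    show "\<sigma> z \<in> A" if "z \<in> A" for z
    proof -
      obtain y where y: "y \<in> Zm" "z = g * y * ginv g" "z \<in> Zm" using \<open>z \<in> A\<close> unfolding A_def gZ_def by blast
      have "\<sigma> z = g * \<sigma> y * ginv g" unfolding y(2) by (rule \<sigma>_conj[OF g Zm_G[OF y(1)]])
      then show ?thesis using \<sigma>_Zm y unfolding A_def gZ_def by blast
    qed
    show "z * z' \<in> A" if "z \<in> A" "z' \<in> A" for z z'
    proof -
      obtain y y' where y: "y \<in> Zm" "z = g * y * ginv g" "y' \<in> Zm" "z' = g * y' * ginv g" "z \<in> Zm" "z' \<in> Zm"
        using \<open>z \<in> A\<close> \<open>z' \<in> A\<close> unfolding A_def gZ_def by blast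
      have "y \<in> M52" "y' \<in> M52" using y Zm_GL by auto
      then have "z * z' = g * (y * y') * ginv g" unfolding y(2,4) by (rule conj_mult[OF GL(3)])
      then show ?thesis using Zm_mult y unfolding A_def gZ_def by blast
    qed
    show "p * ?z0 * ginv p \<in> A"
    proof -
      let ?r = "word_inv w (F4_roots ! 8)"
      have "?r \<in> {r \<in> F4_Phi. level r = 2}" using word_inv_Phi[OF w] lev by simp
      then have Z: "u ?r 1 \<in> Zm" unfolding Zm_def by (rule u_XX) simp
      have "?N * u ?r 1 * ginv ?N = ?z0"
        using u_nprod[OF w, of "F4_roots ! 8" 1, symmetric] GL by (simp add: assoc52)
      then have "p * ?z0 * ginv p \<in> gZ g" unfolding gZ using Z by force
      then show ?thesis using Zm_norm[OF pp(1) u8_Zm] by (simp add: A_def)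
    qed
  qed
  then show False by (rule u8_conj_nontrivial[OF pp(1)])
qed

text \<open>Now w^-1 takes root 8 to level 0, where its root element lies in P and normalises Z. So
  u_8(1), conjugated by p, carries the conjugate of Z into itself and thus belongs to A.\<close>

lemma cell_far:
  assumes g: "g \<in> G" "\<sigma> g = g" and pp: "p \<in> Pm" "p' \<in> Pm" "g = p * nprod w * p'"
    and w: "simple_word w" and v: "word_inv w (F4_roots ! 35) = e4"
    and lev: "level (word_inv w (F4_roots ! 8)) = 0"
  shows False
proof -
  let ?N = "nprod w" and ?z0 = "u (F4_roots ! 8) 1" and ?v = "F4_roots ! 35"
  have vt: "?v = (1, 1, -1, -1)" by (simp only: roots_nth)
  have vP: "?v \<in> F4_Phi" unfolding vt by (simp add: F4_Phi_def F4_roots_def)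
  have GL: "?N \<in> GL52" "p \<in> GL52" "g \<in> GL52" using nprod_GL[OF w] pp Pm_GL g G_GL by auto
  have gZ: "gZ g = {p * (?N * z * ginv ?N) * ginv p | z. z \<in> Zm}"
    unfolding pp(3) by (rule gZ_cell[OF pp(1,2) GL(1)])
  have gZ_G: "y \<in> G" if "y \<in> gZ g" for y
    using that G_mult G_ginv g(1) Zm_G unfolding gZ_def by blast
  define A where "A = {z \<in> Zm. \<forall>y\<in>gZ g. z * y * ginv z \<in> gZ g}"
  have "p * ?z0 * ginv p = 1\<^sub>m 52"
  proof (rule no_singular_group[of A])
    show "A \<subseteq> Zm" by (auto simp: A_def)
    show "singular z" if "z \<in> A" for z
    proof -
      have z: "z \<in> Zm" "z \<in> GL52" using that Zm_GL by (auto simp: A_def)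
      define z1 where "z1 = ginv p * z * p"
      have z1: "z1 \<in> Zm" "z1 \<in> GL52" unfolding z1_def using Zm_conj_back[OF pp(1) z(1)] z GL by simp_all
      have zz1: "z = p * z1 * ginv p" using GL z by (simp add: z1_def assoc52)
      have "e4 \<in> {r \<in> F4_Phi. level r = 2}" by (simp add: e4_def level_def F4_Phi_def F4_roots_def)
      then have E: "u e4 1 \<in> Zm" unfolding Zm_def by (rule u_XX) simp
      \<comment> \<open>That z is singular follows from its effect on one element of the conjugate,
        the one coming from u_e4(1).\<close>
      have "u ?v 1 = ?N * u e4 1 * ginv ?N"
        using u_nprod[OF w, of ?v 1, symmetric] v GL by (simp add: assoc52)
      then have "p * u ?v 1 * ginv p \<in> gZ g" unfolding gZ using E by force
      then have "z * (p * u ?v 1 * ginv p) * ginv z \<in> gZ g" using that by (simp add: A_def)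
      then obtain y where y: "y \<in> Zm" "z * (p * u ?v 1 * ginv p) * ginv z = p * (?N * y * ginv ?N) * ginv p"
        unfolding gZ by blast
      have yGL: "y \<in> GL52" using y Zm_GL by auto
      have "ginv p * (z * (p * u ?v 1 * ginv p) * ginv z) * p = z1 * u ?v 1 * ginv z1"
        unfolding z1_def using GL z by (simp add: assoc52)
      moreover have "ginv p * (p * (?N * y * ginv ?N) * ginv p) * p = ?N * y * ginv ?N"
        using GL yGL by (simp add: assoc52)
      ultimately have "z1 * u ?v 1 * ginv z1 = ?N * y * ginv ?N" using y(2) by simp
      then have "z1 * u ?v 1 * ginv z1 \<in> XX {s \<in> F4_Phi. ip s (1, 1, -1, -1) = 4}"
        using nprod_Zm[OF w vP v y(1)] vt by simp
      then have "singular z1" by (rule singular_word3[OF z1(1)])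
      then show ?thesis unfolding zz1 by (rule singular_Pm[OF pp(1) z1(1)])
    qed
    show "\<sigma> z \<in> A" if "z \<in> A" for z
    proof -
      have z: "z \<in> Zm" "\<sigma> z \<in> Zm" "z \<in> G" using that \<sigma>_Zm Zm_G by (auto simp: A_def)
      have "\<sigma> z * y * ginv (\<sigma> z) \<in> gZ g" if y: "y \<in> gZ g" for y
      proof -
        have \<sigma>g: "\<sigma> y \<in> gZ g" if "y \<in> gZ g" for y
        proof -
          obtain x where x: "x \<in> Zm" "y = g * x * ginv g" using \<open>y \<in> gZ g\<close> unfolding gZ_def by blast
          have "\<sigma> y = g * \<sigma> x * ginv g" unfolding x(2) by (rule \<sigma>_conj[OF g Zm_G[OF x(1)]])
          then show ?thesis using \<sigma>_Zm[OF x(1)] unfolding gZ_def by blast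
        qed
        \<comment> \<open>The claim for \<sigma> z and y is the image under \<sigma> of the claim
          for z and \<sigma> y.\<close>
        have "z * \<sigma> y * ginv z \<in> gZ g" using \<open>z \<in> A\<close> \<sigma>g[OF y] by (simp add: A_def)
        from \<sigma>g[OF this] show ?thesis
          using z gZ_G[OF y] gZ_G[OF \<sigma>g[OF y]] G_ginv by (simp add: \<sigma>_mult G_mult \<sigma>_ginv \<sigma>_\<sigma>)
      qed
      then show ?thesis using z by (simp add: A_def)
    qed
    show "z * z' \<in> A" if "z \<in> A" "z' \<in> A" for z z'
    proof -
      have z: "z \<in> Zm" "z \<in> GL52" "z' \<in> Zm" "z' \<in> GL52" using that Zm_GL by (auto simp: A_def)
      have "z * z' * y * ginv (z * z') \<in> gZ g" if y: "y \<in> gZ g" for y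
      proof -
        have yM: "y \<in> M52" using gZ_G[OF y] G_GL by auto
        have "z * (z' * y * ginv z') * ginv z \<in> gZ g" using \<open>z \<in> A\<close> \<open>z' \<in> A\<close> y by (simp add: A_def)
        then show ?thesis using z yM by (simp add: assoc52)
      qed
      then show ?thesis using Zm_mult z by (simp add: A_def)
    qed
    show "p * ?z0 * ginv p \<in> A"
    proof -
      let ?r = "word_inv w (F4_roots ! 8)"
      have P: "u ?r 1 \<in> Pm" using word_inv_Phi[OF w] lev by (intro u_Pm) simp_all
      have zN: "?z0 = ?N * u ?r 1 * ginv ?N"
        using u_nprod[OF w, of "F4_roots ! 8" 1, symmetric] GL by (simp add: assoc52)
      have rP: "?r \<in> F4_Phi" using word_inv_Phi[OF w] by simp
      have "p * ?z0 * ginv p * y * ginv (p * ?z0 * ginv p) \<in> gZ g" if y: "y \<in> gZ g" for y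
      proof -
        obtain x where x: "x \<in> Zm" "y = p * (?N * x * ginv ?N) * ginv p" using y unfolding gZ by blast
        have xGL: "x \<in> GL52" using x Zm_GL by auto
        have "p * ?z0 * ginv p * y * ginv (p * ?z0 * ginv p) = p * (?N * (u ?r 1 * x * ginv (u ?r 1)) * ginv ?N) * ginv p"
          unfolding x(2) zN using GL xGL rP by (simp add: assoc52)
        then show ?thesis unfolding gZ using Zm_norm[OF P x(1)] by blast
      qed
      then show ?thesis using Zm_norm[OF pp(1) u8_Zm] by (simp add: A_def)
    qed
  qed
  then show False by (rule u8_conj_nontrivial[OF pp(1)])
qed

lemma fixed_cases:
  assumes g: "g \<in> G" "\<sigma> g = g"
  obtains "g \<in> Pm" | p p' where "p \<in> Pm" "p' \<in> Pm" "g = p * nn e4 * p'"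
proof -
  obtain p w p' where pp: "p \<in> Pm" "w \<in> cell_words" "p' \<in> Pm" "g = p * nprod w * p'"
    using bruhat[OF g(1)] by blast
  have words: "cell_words = {[], [46], [46, 28, 13, 28, 46], [46, 28, 13, 1, 46, 28, 13, 28, 46], snd (last reps)}"
    by (auto simp: cell_words_def reps_def)
  consider "w = []" | "w = [46]" | "w = [46, 28, 13, 28, 46]" | "w = [46, 28, 13, 1, 46, 28, 13, 28, 46]" | "w = snd (last reps)"
    using pp(2) unfolding words by blast
  then show ?thesis
  proof cases
    case 1
    have "g \<in> Pm" using pp(1,3,4) Pm_GL Pm_mult by (simp add: 1 subset_iff)
    then show ?thesis by (rule that(1))
  next
    case 2
    \<comment> \<open>In each case the root taken to e4 is w(e4), the root v of the lemma that is
      applied.\<close>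
    have "word_inv w (1, 1, 1, 1) = e4" "word_inv w (F4_roots ! 8) = (2, 0, 0, 2)"
      unfolding 2 by (simp_all add: refl_def ip_def radd_def rscale_def roots_nth[simplified] e4_def)
    then have False
      by (intro cell_special[OF g pp(1,3,4), of "(1, 1, 1, 1)"])
        (simp_all add: 2 level_def singular_word1 F4_Phi_def F4_roots_def)
    then show ?thesis ..
  next
    case 3
    have "word_inv w (2, 0, 0, 0) = e4" "word_inv w (F4_roots ! 8) = (2, 0, 0, 2)"
      unfolding 3 by (simp_all add: refl_def ip_def radd_def rscale_def roots_nth[simplified] e4_def)
    then have False
      by (intro cell_special[OF g pp(1,3,4), of "(2, 0, 0, 0)"])
        (simp_all add: 3 level_def singular_word2 F4_Phi_def F4_roots_def)
    then show ?thesis ..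
  next
    case 4
    have "word_inv w (F4_roots ! 35) = e4" "word_inv w (F4_roots ! 8) = (2, 2, 0, 0)"
      unfolding 4 by (simp_all add: refl_def ip_def radd_def rscale_def roots_nth[simplified] e4_def)
    then have False by (intro cell_far[OF g pp(1,3,4)]) (simp_all add: 4 level_def)
    then show ?thesis ..
  next
    case 5
    show ?thesis using that(2)[OF pp(1,3)] pp(4) unfolding 5 rep_last' by blast
  qed
qed

lemma \<sigma>_nn_e4: "\<sigma> (nn e4) = nn e4"
proof -
  have "sigma_root e4 = e4" "c e4 = 1" using c_values(1) by (simp_all add: sigma_root_def e4_def)
  then show ?thesis using \<sigma>_n[of e4 1] bar_one by simp
qed

lemma fixed_decomposition:
  assumes g: "g \<in> G" "\<sigma> g = g" "g \<notin> Pm"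
  obtains x l x' where "x \<in> Um" "l \<in> Lm" "x' \<in> Um" "\<sigma> x = x" "\<sigma> l = l" "\<sigma> x' = x'" "g = x * l * nn e4 * x'"
proof -
  obtain p p' where pp: "p \<in> Pm" "p' \<in> Pm" "g = p * nn e4 * p'"
    using fixed_cases[OF g(1,2)] g(3) by blast
  obtain x l1 where xl: "x \<in> Um" "l1 \<in> Lm" "p = x * l1" using Pm_decomp[OF pp(1)] by blast
  \<comment> \<open>Decomposing the inverse places the factor of p' from \<open>Um\<close> on the
    right. The factor from \<open>Lm\<close> can then be moved across n_e4, which normalises
    \<open>Lm\<close>.\<close>
  obtain y l2 where yl: "y \<in> Um" "l2 \<in> Lm" "ginv p' = y * l2" using Pm_decomp[OF Pm_ginv[OF pp(2)]] by blast
  have inv: "ginv y \<in> Um" "ginv l2 \<in> Lm"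
    using grp_gen_ginv[OF Ugen_GL] grp_gen_ginv[OF Lgen_GL] yl unfolding Um_def XX_def Lm_def by auto
  have GL: "x \<in> GL52" "l1 \<in> GL52" "y \<in> GL52" "l2 \<in> GL52" "p' \<in> GL52" "nn e4 \<in> GL52"
    using xl yl pp Um_GL Lm_GL Pm_GL by auto
  have p': "p' = ginv l2 * ginv y" using arg_cong[OF yl(3), of ginv] GL by simp
  define l where "l = l1 * (nn e4 * ginv l2 * nn e4)"
  define x' where "x' = ginv y"
  have l: "l \<in> Lm" "l \<in> GL52" unfolding l_def using Lm_mult[OF xl(2) nn_e4_Lm[OF inv(2)]] Lm_GL by auto
  have x': "x' \<in> Um" "x' \<in> GL52" using inv Um_GL by (auto simp: x'_def)
  have eq: "g = x * l * nn e4 * x'"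
    unfolding pp(3) xl(3) p' l_def x'_def using GL by (simp add: assoc52)
  have s: "\<sigma> x \<in> Um" "\<sigma> l \<in> Lm" "\<sigma> x' \<in> Um" using \<sigma>_Um \<sigma>_Lm xl l x' by auto
  have sGL: "\<sigma> x \<in> GL52" "\<sigma> l \<in> GL52" "\<sigma> x' \<in> GL52" using s Um_GL Lm_GL by auto
  have nG: "nn e4 \<in> G" by (rule n_G) simp_all
  have "g = \<sigma> x * \<sigma> l * nn e4 * \<sigma> x'"
    using g(2) unfolding eq using Um_G[OF xl(1)] Lm_G[OF l(1)] Um_G[OF x'(1)] nG
    by (simp add: \<sigma>_mult G_mult \<sigma>_nn_e4)
  then have two: "x * l * nn e4 * x' = \<sigma> x * \<sigma> l * nn e4 * \<sigma> x'" using eq by simp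
  have inv': "ginv (\<sigma> x) \<in> Um" "ginv (\<sigma> x') \<in> Um"
    using grp_gen_ginv[OF Ugen_GL] s unfolding Um_def XX_def by auto
  have mult: "a * b \<in> Um" if "a \<in> Um" "b \<in> Um" for a b
    using that unfolding Um_def XX_def by (rule grp_gen.gen_mult)
  \<comment> \<open>The two factorisations are rearranged into the shape of
    \<open>opposite_unique\<close>: n_e4 turns the quotient of the right-hand factors into an
    element of negative level.\<close>
  let ?a = "ginv (\<sigma> x) * x" and ?b = "nn e4 * (x' * ginv (\<sigma> x')) * nn e4"
  have "?a * l * ?b = ginv (\<sigma> x) * (x * l * nn e4 * x') * ginv (\<sigma> x') * nn e4"
    using GL l x' sGL by (simp add: assoc52)
  also have "\<dots> = \<sigma> l" unfolding two using GL l x' sGL by (simp add: assoc52)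
  finally have fin: "?a * l * ?b = \<sigma> l" .
  note uniq = opposite_unique[OF mult[OF inv'(1) xl(1)] l(1) s(2) nn_e4_Um[OF mult[OF x'(1) inv'(2)]] fin]
  have "\<sigma> x * ?a = \<sigma> x" unfolding uniq(1) using sGL by simp
  then have fx: "\<sigma> x = x" using sGL GL by simp
  have "nn e4 * ?b * nn e4 * \<sigma> x' = \<sigma> x'" unfolding uniq(2) using sGL by simp
  then have fx': "\<sigma> x' = x'" using sGL x' by (simp add: assoc52)
  show ?thesis by (rule that[OF xl(1) l(1) x'(1) fx uniq(3)[symmetric] fx' eq])
qed

lemma fixed_generated:
  assumes S: "S \<subseteq> {g \<in> G. \<sigma> g = g}" and g: "g \<in> grp_gen S" shows "g \<in> G \<and> \<sigma> g = g"
  using g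
proof induction
  case gen_one
  then show ?case using G_one \<sigma>_one by simp
next
  case (gen_mult A B)
  then show ?case using G_mult \<sigma>_mult by simp
next
  case (gen_inv A B)
  have "A \<in> M52" using gen_inv G_GL by auto
  then have "B = ginv A" using ginv_unique(3)[OF _ gen_inv(2,3)] by simp
  then show ?case using gen_inv G_ginv \<sigma>_ginv by simp
qed (use S in blast)

end

section \<open>Comparison with the groups of the statement\<close>

context mixed
begin

lemma Um_U_J: "Um \<subseteq> U_J L"
  unfolding Um_def XX_def U_J_def
proof (rule grp_gen_mono, rule subsetI)
  fix A assume "A \<in> Ugen {r \<in> F4_Phi. 0 < level r}"
  then obtain r t where r: "r \<in> F4_Phi" "0 < level r" "t \<in> adm r" "A = u r t" unfolding Ugen_iff by blast
  then show "A \<in> {u_el r t | r t. F4_pos r \<and> \<not> in_PhiJ r \<and> t \<in> L}"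
    using pos_not_PhiJ[of r] adm_L[OF r(3)] by blast
qed

lemma Lm_L_J: "Lm \<subseteq> L_J L"
  unfolding Lm_def L_J_def
proof (rule grp_gen_least, rule subsetI)
  fix A assume "A \<in> Lgen"
  then consider "A \<in> Tgen" | r t where "r \<in> F4_Phi" "level r = 0" "t \<in> adm r" "A = u r t"
    unfolding Lgen_def Un_iff Ugen_iff by blast
  then show "A \<in> grp_gen (torus L \<union> {u_el r t | r t. in_PhiJ r \<and> t \<in> L})"
  proof cases
    case 1
    obtain r t t' where h: "A = n_el r t * n_el r t'" and r: "r \<in> F4_Phi" and t: "t \<in> adm r" "t \<noteq> 0" "t' \<in> adm r" "t' \<noteq> 0"
      using TgenE[OF 1] by blast
    have h_torus: "h_el r s \<in> torus L" if "s \<in> adm r" "s \<noteq> 0" for s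
      unfolding torus_def using r that adm_L by (intro grp_gen.gen_incl) blast
    have GL: "h_el r t' \<in> GL52" using r by (simp add: h_el_def)
    have "ginv (h_el r t') \<in> torus L"
      using h_torus[OF t(3,4)] GL unfolding torus_def
      by (intro grp_gen.gen_inv[of "h_el r t'" _ "ginv (h_el r t')"]) simp_all
    \<comment> \<open>The factors n_r(1) cancel in the quotient, as they are involutions.\<close>
    moreover have "A = h_el r t * ginv (h_el r t')" using r by (simp add: h h_el_def assoc52)
    ultimately have "A \<in> torus L" using h_torus[OF t(1,2)] unfolding torus_def by (simp add: grp_gen.gen_mult)
    then show ?thesis by (intro grp_gen.gen_incl) simp
  next
    case 2
    have "in_PhiJ r" using 2(1,2) by (cases r) (simp add: in_PhiJ_def level_def)
    then show ?thesis using 2(4) adm_L[OF 2(3)] by (intro grp_gen.gen_incl) blast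
  qed
qed

lemma Pm_P_J: "Pm \<subseteq> P_J L"
proof
  fix p assume "p \<in> Pm"
  then obtain x l where "x \<in> Um" "l \<in> Lm" "p = x * l" using Pm_decomp by blast
  then show "p \<in> P_J L" using Um_U_J Lm_L_J unfolding P_J_def by blast
qed

lemma U_w_e4_J_Um: "U_w_e4_J K L = Um"
  unfolding U_w_e4_J_def Um_def XX_def Ugen_def w_e4_roots ..

end

section \<open>Adjoining a root of an Artin-Schreier polynomial\<close>

lemma adjoin_quadratic:
  fixes F :: "'a::field set"
  assumes char2: "CHAR('a) = 2" and F: "is_subfield F" and d: "\<delta> \<in> F" and \<gamma>: "\<gamma> ^ 2 + \<gamma> + \<delta> = 0"
  shows "is_subfield (adjoin F \<gamma>)" "adjoin F \<gamma> = {a + b * \<gamma> | a b. a \<in> F \<and> b \<in> F}"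
proof -
  interpret char2 "TYPE('a)" by unfold_locales (rule char2)
  let ?E = "{a + b * \<gamma> | a b. a \<in> F \<and> b \<in> F}"
  have cl: "x + y \<in> F" "x * y \<in> F" if "x \<in> F" "y \<in> F" for x y using F that by (simp_all add: is_subfield_def)
  have c01: "0 \<in> F" "1 \<in> F" "x \<in> F \<Longrightarrow> x \<noteq> 0 \<Longrightarrow> inverse x \<in> F" for x using F by (simp_all add: is_subfield_def)
  have g2: "\<gamma> * \<gamma> = \<gamma> + \<delta>" using \<gamma> by (simp add: power2_eq_square add.assoc add_eq_0)
  have I: "a + b * \<gamma> \<in> ?E" if "a \<in> F" "b \<in> F" for a b using that by blast
  have E: "is_subfield ?E"
    unfolding is_subfield_def
  proof (intro conjI ballI impI)
    show "0 \<in> ?E" "1 \<in> ?E" using I[of 0 0] I[of 1 0] c01 by simp_all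
    fix x assume "x \<in> ?E"
    then obtain a b where x: "a \<in> F" "b \<in> F" "x = a + b * \<gamma>" by blast
    show "- x \<in> ?E" using I[OF x(1,2)] x(3) by simp
    show "inverse x \<in> ?E" if "x \<noteq> 0"
    proof -
      \<comment> \<open>The norm of x: the other root \<gamma> + 1 of the polynomial gives the
        conjugate a + b + b \<gamma>.\<close>
      define N where "N = a * a + a * b + \<delta> * (b * b)"
      have N: "N \<in> F" using x d cl by (simp add: N_def)
      have "(a + b * \<gamma>) * (a + b + b * \<gamma>) = a * a + a * b + (b * b) * (\<gamma> * \<gamma> + \<gamma>) + (a * b * \<gamma> + a * b * \<gamma>)"
        by (simp only: distrib_left distrib_right) (simp add: ac_simps)
      also have "\<gamma> * \<gamma> + \<gamma> = \<delta>" unfolding g2 by (simp add: add.commute add.left_commute)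
      finally have xN: "x * (a + b + b * \<gamma>) = N" by (simp add: N_def x(3) mult.commute)
      show ?thesis
      proof (cases "N = 0")
        \<comment> \<open>A nonzero x can have norm 0 when \<gamma> lies in F. Its conjugate is then
          zero, and adding that to x leaves b.\<close>
        case True
        then have z: "a + b + b * \<gamma> = 0" using xN that by simp
        have "x = x + (a + b + b * \<gamma>)" using z by simp
        also have "\<dots> = b + ((a + a) + (b * \<gamma> + b * \<gamma>))" unfolding x(3) by (simp only: ac_simps)
        finally have "x = b" by simp
        then show ?thesis using I[OF c01(3)[OF x(2)] c01(1)] that by simp
      next
        case False
        have "inverse x = (a + b + b * \<gamma>) * inverse N"
          using xN False that by (simp add: field_simps)
        also have "\<dots> = (a + b) * inverse N + (b * inverse N) * \<gamma>" by (simp add: algebra_simps)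
        finally show ?thesis using I[of "(a + b) * inverse N" "b * inverse N"] x cl c01(3)[OF N False] by simp
      qed
    qed
    fix y assume "y \<in> ?E"
    then obtain a' b' where y: "a' \<in> F" "b' \<in> F" "y = a' + b' * \<gamma>" by blast
    have s: "x + y = (a + a') + (b + b') * \<gamma>" by (simp add: x(3) y(3) algebra_simps)
    show "x + y \<in> ?E" unfolding s by (intro I cl x y)
    have "x * y = a * a' + (a * b' + b * a') * \<gamma> + b * b' * (\<gamma> * \<gamma>)" by (simp add: x(3) y(3) algebra_simps)
    also have "\<dots> = (a * a' + b * b' * \<delta>) + (a * b' + b * a' + b * b') * \<gamma>" unfolding g2 by (simp add: algebra_simps)
    finally have m: "x * y = (a * a' + b * b' * \<delta>) + (a * b' + b * a' + b * b') * \<gamma>" .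
    show "x * y \<in> ?E" unfolding m by (intro I cl x y d)
  qed
  have "F \<subseteq> ?E" using I[OF _ c01(1)] by force
  moreover have "\<gamma> \<in> ?E" using I[OF c01(1,2)] by simp
  ultimately have "adjoin F \<gamma> \<subseteq> ?E" using E unfolding adjoin_def by blast
  moreover have "?E \<subseteq> adjoin F \<gamma>"
    unfolding adjoin_def
  proof (intro subsetI InterI)
    fix x H assume "x \<in> ?E" "H \<in> {E. is_subfield E \<and> F \<subseteq> E \<and> \<gamma> \<in> E}"
    then show "x \<in> H" by (auto simp: is_subfield_def subset_iff)
  qed
  ultimately show eq: "adjoin F \<gamma> = ?E" by blast
  show "is_subfield (adjoin F \<gamma>)" unfolding eq by (rule E)
qed

theorem mainTheorem9:
  fixes k lf K L :: "'a::field set"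
    and \<delta> \<gamma> \<alpha> \<beta> :: 'a
    and bar :: "'a \<Rightarrow> 'a"
    and \<sigma> :: "'a mat \<Rightarrow> 'a mat"
    and c :: "root4 \<Rightarrow> 'a"
  assumes char2: "CHAR('a) = 2"
    and k_field: "is_subfield k" and l_field: "is_subfield lf" and k_sub_l: "k \<subseteq> lf"
    and l_sq: "\<forall>x\<in>lf. x ^ 2 \<in> k"
    and \<delta>_in: "\<delta> \<in> k"
    and irred: "irreducible_over lf [:\<delta>, 1, 1:]"
    and \<gamma>_root: "\<gamma> ^ 2 + \<gamma> + \<delta> = 0"
    and K_def: "K = adjoin k \<gamma>" and L_def: "L = adjoin lf \<gamma>"
    and bar_bij: "bij_betw bar L L"
    and bar_add: "\<forall>x\<in>L. \<forall>y\<in>L. bar (x + y) = bar x + bar y"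
    and bar_mult: "\<forall>x\<in>L. \<forall>y\<in>L. bar (x * y) = bar x * bar y"
    and bar_fix: "\<forall>x\<in>lf. bar x = x"
    and bar_nontriv: "\<exists>x\<in>L. bar x \<noteq> x"
    and \<alpha>_in: "\<alpha> \<in> k" "\<alpha> \<noteq> 0" and \<beta>_in: "\<beta> \<in> k" "\<beta> \<noteq> 0"
    and aniso: "\<forall>y1\<in>lf. \<forall>y2\<in>K. \<forall>y3\<in>K. \<forall>y4\<in>K.
        y1 ^ 2 + \<alpha> * y2 * bar y2 + \<beta> * y3 * bar y3 + \<alpha> * \<beta> * y4 * bar y4 = 0 \<longrightarrow>
        y1 = 0 \<and> y2 = 0 \<and> y3 = 0 \<and> y4 = 0"
    and \<sigma>_maps: "\<forall>g\<in>F4_mixed K L. \<sigma> g \<in> F4_mixed K L"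
    and \<sigma>_hom: "\<forall>g\<in>F4_mixed K L. \<forall>h\<in>F4_mixed K L. \<sigma> (g * h) = \<sigma> g * \<sigma> h"
    and \<sigma>_bij: "bij_betw \<sigma> (F4_mixed K L) (F4_mixed K L)"
    and \<sigma>_inv: "\<forall>g\<in>F4_mixed K L. \<sigma> (\<sigma> g) = g"
    and c_in: "\<forall>r\<in>F4_Phi. c r \<in> K \<and> c r \<noteq> 0"
    and \<sigma>_u: "\<forall>r\<in>F4_Phi. \<forall>t\<in>(if F4_long r then K else L).
        \<sigma> (u_el r t) = u_el (sigma_root r) (c r * bar t)"
    and c1: "c alpha1 = inverse (\<alpha> * \<beta>)" and c2: "c alpha2 = \<alpha> * \<beta>"
    and c3: "c alpha3 = inverse \<alpha>" and c4: "c alpha4 = \<alpha> * inverse \<beta>"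
  shows "\<forall>g \<in> grp_gen ((U_J L \<inter> F4_mixed K L \<inter> Fix K L \<sigma>) \<union> (U_J_minus L \<inter> F4_mixed K L \<inter> Fix K L \<sigma>))
            - (P_J L \<inter> F4_mixed K L \<inter> grp_gen ((U_J L \<inter> F4_mixed K L \<inter> Fix K L \<sigma>) \<union> (U_J_minus L \<inter> F4_mixed K L \<inter> Fix K L \<sigma>))).
          \<exists>x \<in> U_J L \<inter> F4_mixed K L \<inter> Fix K L \<sigma>.
          \<exists>l \<in> L_J L \<inter> F4_mixed K L \<inter> Fix K L \<sigma>.
          \<exists>x' \<in> U_w_e4_J K L \<inter> Fix K L \<sigma>.
            g = x * l * n_e4 * x'"
proof
  fix g
  let ?S = "(U_J L \<inter> F4_mixed K L \<inter> Fix K L \<sigma>) \<union> (U_J_minus L \<inter> F4_mixed K L \<inter> Fix K L \<sigma>)"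
  assume g: "g \<in> grp_gen ?S - (P_J L \<inter> F4_mixed K L \<inter> grp_gen ?S)"
  interpret char2 "TYPE('a)" by unfold_locales (rule char2)
  have \<delta>l: "\<delta> \<in> lf" using \<delta>_in k_sub_l by blast
  note Kq = adjoin_quadratic[OF char2 k_field \<delta>_in \<gamma>_root, folded K_def]
  note Lq = adjoin_quadratic[OF char2 l_field \<delta>l \<gamma>_root, folded L_def]
  have g2: "\<gamma> ^ 2 = \<gamma> + \<delta>" using \<gamma>_root by (simp add: add.assoc add_eq_0)
  have KL: "K \<subseteq> L" using Kq(2) Lq(2) k_sub_l by auto
  have k01: "0 \<in> k" "1 \<in> k" and l01: "0 \<in> lf" "1 \<in> lf" using k_field l_field by (simp_all add: is_subfield_def)
  have kcl: "x + y \<in> k" "x * y \<in> k" if "x \<in> k" "y \<in> k" for x y using k_field that by (simp_all add: is_subfield_def)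
  have KI: "a + b * \<gamma> \<in> K" if "a \<in> k" "b \<in> k" for a b using that unfolding Kq(2) by blast
  have LI: "a + b * \<gamma> \<in> L" if "a \<in> lf" "b \<in> lf" for a b using that unfolding Lq(2) by blast
  have lL: "x \<in> L" if "x \<in> lf" for x using LI[OF that l01(1)] by simp
  have \<gamma>L: "\<gamma> \<in> L" using LI[OF l01] by simp
  \<comment> \<open>Squaring removes the mixed term, and the coefficients a^2 and b^2 lie in
    k.\<close>
  have LK: "x ^ 2 \<in> K" if x: "x \<in> L" for x
  proof -
    obtain a b where ab: "a \<in> lf" "b \<in> lf" "x = a + b * \<gamma>" using x unfolding Lq(2) by blast
    have "x ^ 2 = a ^ 2 + b ^ 2 * \<gamma> ^ 2 + (a * b * \<gamma> + a * b * \<gamma>)"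
      unfolding ab(3) power2_eq_square by (simp only: distrib_left distrib_right) (simp add: ac_simps)
    also have "\<dots> = (a ^ 2 + b ^ 2 * \<delta>) + b ^ 2 * \<gamma>" unfolding g2 by (simp add: algebra_simps)
    finally have "x ^ 2 = (a ^ 2 + b ^ 2 * \<delta>) + b ^ 2 * \<gamma>" .
    moreover have "a ^ 2 \<in> k" "b ^ 2 \<in> k" using l_sq ab by blast+
    ultimately show ?thesis using KI kcl \<delta>_in by simp
  qed
  have bar_lin: "bar (a + b * \<gamma>) = a + b * bar \<gamma>" if ab: "a \<in> lf" "b \<in> lf" for a b
  proof -
    have "b * \<gamma> \<in> L" using LI[OF l01(1) ab(2)] by simp
    then show ?thesis using bar_add bar_mult bar_fix lL \<gamma>L ab by simp
  qed
  have bar_ne: "bar \<gamma> \<noteq> \<gamma>"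
  proof
    assume e: "bar \<gamma> = \<gamma>"
    obtain x where x: "x \<in> L" "bar x \<noteq> x" using bar_nontriv by blast
    then obtain a b where "a \<in> lf" "b \<in> lf" "x = a + b * \<gamma>" unfolding Lq(2) by blast
    then show False using x(2) bar_lin e by simp
  qed
  have bar_\<gamma>: "bar \<gamma> = \<gamma> + 1"
  proof -
    have "bar (\<gamma> * \<gamma>) = bar (\<delta> + 1 * \<gamma>)" using g2 by (simp add: power2_eq_square add.commute)
    also have "\<dots> = \<delta> + bar \<gamma>" using bar_lin[OF \<delta>l l01(2)] by simp
    finally have "bar \<gamma> * bar \<gamma> = bar \<gamma> + \<delta>" using bar_mult \<gamma>L by (simp add: add.commute)
    moreover have "\<gamma> * \<gamma> = \<gamma> + \<delta>" using g2 by (simp add: power2_eq_square)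
    \<comment> \<open>Both elements are roots of the same quadratic polynomial, and they are
      distinct, so their sum is 1.\<close>
    ultimately have "(bar \<gamma> - \<gamma>) * (bar \<gamma> + \<gamma> - 1) = 0" by (simp add: algebra_simps)
    then have "bar \<gamma> + \<gamma> = 1" using bar_ne by simp
    then have "\<gamma> + (bar \<gamma> + \<gamma>) = \<gamma> + 1" by simp
    then show ?thesis by (simp add: add.left_commute)
  qed
  interpret mixed "TYPE('a)" K L
    using Kq(1) Lq(1) KL LK by unfold_locales
  have bar_K: "bar x \<in> K" if x: "x \<in> K" for x
  proof -
    obtain a b where ab: "a \<in> k" "b \<in> k" "x = a + b * \<gamma>" using x unfolding Kq(2) by blast
    then have "bar x = (a + b) + b * \<gamma>" using bar_lin[of a b] k_sub_l by (auto simp: bar_\<gamma> algebra_simps)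
    then show ?thesis using KI kcl ab by simp
  qed
  have bar_fixed: "x \<in> lf" if x: "x \<in> L" "bar x = x" for x
  proof -
    obtain a b where ab: "a \<in> lf" "b \<in> lf" "x = a + b * \<gamma>" using x(1) unfolding Lq(2) by blast
    have "a + b * (\<gamma> + 1) = a + b * \<gamma>" using bar_lin[OF ab(1,2)] x(2) ab(3) bar_\<gamma> by simp
    then have "b = 0" by (simp add: algebra_simps)
    then show ?thesis using ab by simp
  qed
  have \<alpha>\<beta>: "\<alpha> \<in> lf" "\<beta> \<in> lf" using \<alpha>_in \<beta>_in k_sub_l by auto
  interpret sigma_mixed "TYPE('a)" K L lf bar \<sigma> c \<alpha> \<beta>
  proof unfold_locales
    show "bar x \<in> K" if "x \<in> K" for x by (rule bar_K[OF that])
    show "bar x \<in> L" if "x \<in> L" for x using bar_bij that by (rule bij_betw_apply)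
    show "bar (x + y) = bar x + bar y" "bar (x * y) = bar x * bar y" if "x \<in> L" "y \<in> L" for x y
      using bar_add bar_mult that by simp_all
    show "bar 1 = 1" "bar \<alpha> = \<alpha>" "bar \<beta> = \<beta>" using bar_fix l01 \<alpha>\<beta> by simp_all
    show "x \<in> lf" if "x \<in> L" "bar x = x" for x by (rule bar_fixed[OF that])
    show "\<alpha> \<in> L" "\<beta> \<in> L" using lL \<alpha>\<beta> by simp_all
    show "\<alpha> \<noteq> 0" "\<beta> \<noteq> 0" by (fact \<alpha>_in(2) \<beta>_in(2))+
    show "y1 = 0 \<and> y2 = 0 \<and> y3 = 0 \<and> y4 = 0"
      if "y1 \<in> lf" "y2 \<in> K" "y3 \<in> K" "y4 \<in> K"
        "y1 ^ 2 + \<alpha> * y2 * bar y2 + \<beta> * y3 * bar y3 + \<alpha> * \<beta> * y4 * bar y4 = 0" for y1 y2 y3 y4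
      using aniso that by blast
    show "\<sigma> x \<in> XX F4_Phi" "\<sigma> (\<sigma> x) = x" if "x \<in> XX F4_Phi" for x
      using \<sigma>_maps \<sigma>_inv that by (simp_all add: F4_mixed_XX)
    show "\<sigma> (x * y) = \<sigma> x * \<sigma> y" if "x \<in> XX F4_Phi" "y \<in> XX F4_Phi" for x y
      using \<sigma>_hom that by (simp add: F4_mixed_XX)
    show "c r \<in> K \<and> c r \<noteq> 0" if "r \<in> F4_Phi" for r using c_in that by blast
    show "\<sigma> (u_el r t) = u_el (sigma_root r) (c r * bar t)" if "r \<in> F4_Phi" "t \<in> adm r" for r t
      using \<sigma>_u that by (simp add: adm_def)
  qed (fact c1 c2 c3 c4)+
  have mem: "g \<in> G" "\<sigma> g = g"
    using fixed_generated[of ?S g] g unfolding Fix_def F4_mixed_XX by blast+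
  have "g \<notin> P_J L" using g mem(1) unfolding F4_mixed_XX by blast
  then have "g \<notin> Pm" using Pm_P_J by blast
  then obtain x l x' where d: "x \<in> Um" "l \<in> Lm" "x' \<in> Um" "\<sigma> x = x" "\<sigma> l = l" "\<sigma> x' = x'"
      "g = x * l * nn e4 * x'"
    by (rule fixed_decomposition[OF mem])
  show "\<exists>x \<in> U_J L \<inter> F4_mixed K L \<inter> Fix K L \<sigma>. \<exists>l \<in> L_J L \<inter> F4_mixed K L \<inter> Fix K L \<sigma>.
      \<exists>x' \<in> U_w_e4_J K L \<inter> Fix K L \<sigma>. g = x * l * n_e4 * x'"
  proof (intro bexI)
    show "g = x * l * n_e4 * x'" using d(7) by (simp add: n_e4_def n_el_def)
    show "x' \<in> U_w_e4_J K L \<inter> Fix K L \<sigma>" using d Um_G by (simp add: U_w_e4_J_Um Fix_def F4_mixed_XX)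
    show "l \<in> L_J L \<inter> F4_mixed K L \<inter> Fix K L \<sigma>" using d Lm_G Lm_L_J by (auto simp: Fix_def F4_mixed_XX)
    show "x \<in> U_J L \<inter> F4_mixed K L \<inter> Fix K L \<sigma>" using d Um_G Um_U_J by (auto simp: Fix_def F4_mixed_XX)
  qed
qed

end
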